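(* Let $N\in\mathbb N$, $\alpha\in(0,N)$ and $p\ge1$. The space of test functions $C^\infty_c(\mathbb R^N)$ is dense in the Coulomb--Sobolev space $E^{\alpha,p}(\mathbb R^N)$.
   Context: $\mathbb N$ denotes the positive integers. For $\alpha\in(0,N)$ the Riesz potential is $I_\alpha(x)=A_\alpha|x|^{-(N-\alpha)}$ for $x\in\mathbb R^N\setminus\{0\}$, with $A_\alpha=\frac{\Gamma((N-\alpha)/2)}{\Gamma(\alpha/2)\pi^{N/2}2^\alpha}$. For $p\ge1$, the Coulomb--Sobolev space $E^{\alpha,p}(\mathbb R^N)$ is the vector space of (a.e. classes of) measurable functions $u:\mathbb R^N\to\mathbb R$ with $\int_{\mathbb R^N}|I_{\alpha/2}*|u|^p|^2<\infty$ that are weakly differentiable with $Du\in L^2(\mathbb R^N)$, normed by $$\|u\|_{E^{\alpha,p}}=\Bigl(\int_{\mathbb R^N}|Du|^2+\Bigl(\int_{\mathbb R^N}\bigl|I_{\alpha/2}*|u|^p\bigr|^2\Bigr)^{1/p}\Bigr)^{1/2}.$$ *)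

theory Defs
  imports "HOL-Analysis.Analysis"
begin

text \<open>
  \<^item> The Euclidean space of dimension \<open>N\<close> is \<^typ>\<open>real ^ 'n\<close>, with \<open>N = CARD('n)\<close>.
  \<^item> Measurability and integrals refer to the complete measure \<^term>\<open>lebesgue\<close>.
  \<^item> A space of a.e. classes is represented by the set of all representatives. The lemmas at the
    end show that membership and norm depend only on the a.e. class.
\<close>

definition riesz_const :: "'n::finite itself \<Rightarrow> real \<Rightarrow> real" where
  "riesz_const _ \<alpha> =
     Gamma ((real CARD('n) - \<alpha>) / 2)
       / (Gamma (\<alpha> / 2) * pi powr (real CARD('n) / 2) * 2 powr \<alpha>)"

text \<open>The kernel is only meaningful away from the origin, where \<^term>\<open>(powr)\<close> makes it \<open>0\<close>. This
  does not affect the integrals below, since a single point is a null set.\<close>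

definition riesz_potential :: "real \<Rightarrow> real ^ 'n \<Rightarrow> real" where
  "riesz_potential \<alpha> x =
     riesz_const TYPE('n) \<alpha> * norm x powr (- (real CARD('n) - \<alpha>))"

text \<open>Convolution of nonnegative functions, with values in \<open>[0, \<infinity>]\<close>. Negative values would be
  truncated by \<^term>\<open>ennreal\<close>.\<close>

definition nn_convolution ::
  "(real ^ 'n \<Rightarrow> real) \<Rightarrow> (real ^ 'n \<Rightarrow> real) \<Rightarrow> real ^ 'n \<Rightarrow> ennreal" where
  "nn_convolution k f x = (\<integral>\<^sup>+ y. ennreal (k (x - y)) * ennreal (f y) \<partial>lebesgue)"

definition coulomb_energy :: "real \<Rightarrow> real \<Rightarrow> (real ^ 'n \<Rightarrow> real) \<Rightarrow> ennreal" where
  "coulomb_energy \<alpha> p u =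
     (\<integral>\<^sup>+ x. (nn_convolution (riesz_potential (\<alpha> / 2)) (\<lambda>y. \<bar>u y\<bar> powr p) x)\<^sup>2 \<partial>lebesgue)"

definition partial_deriv :: "'n \<Rightarrow> (real ^ 'n \<Rightarrow> real) \<Rightarrow> real ^ 'n \<Rightarrow> real" where
  "partial_deriv i f x = frechet_derivative f (at x) (axis i 1)"

text \<open>The class \<open>C\<^sup>k\<close> on the whole space.\<close>

primrec cont_diff :: "nat \<Rightarrow> (real ^ 'n \<Rightarrow> real) \<Rightarrow> bool" where
  "cont_diff 0 f \<longleftrightarrow> continuous_on UNIV f"
| "cont_diff (Suc k) f \<longleftrightarrow>
     f differentiable_on UNIV \<and> (\<forall>i. cont_diff k (partial_deriv i f))"

definition test_functions :: "(real ^ 'n \<Rightarrow> real) set" where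
  "test_functions = {\<phi>. (\<forall>k. cont_diff k \<phi>) \<and> compact (closure {x. \<phi> x \<noteq> 0})}"

definition locally_integrable :: "(real ^ 'n \<Rightarrow> 'b::euclidean_space) \<Rightarrow> bool" where
  "locally_integrable f \<longleftrightarrow> (\<forall>K. compact K \<longrightarrow> f absolutely_integrable_on K)"

definition has_weak_gradient ::
  "(real ^ 'n \<Rightarrow> real) \<Rightarrow> (real ^ 'n \<Rightarrow> real ^ 'n) \<Rightarrow> bool" where
  "has_weak_gradient u g \<longleftrightarrow>
     locally_integrable u \<and> locally_integrable g \<and>
     (\<forall>\<phi>\<in>test_functions. \<forall>i.
        (\<integral>x. u x * partial_deriv i \<phi> x \<partial>lebesgue) = - (\<integral>x. g x $ i * \<phi> x \<partial>lebesgue))"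

definition weakly_differentiable :: "(real ^ 'n \<Rightarrow> real) \<Rightarrow> bool" where
  "weakly_differentiable u \<longleftrightarrow> (\<exists>g. has_weak_gradient u g)"

text \<open>Weak gradients are unique up to null sets; this picks a representative.\<close>

definition weak_gradient :: "(real ^ 'n \<Rightarrow> real) \<Rightarrow> real ^ 'n \<Rightarrow> real ^ 'n" where
  "weak_gradient u = (SOME g. has_weak_gradient u g)"

definition dirichlet_energy :: "(real ^ 'n \<Rightarrow> real) \<Rightarrow> ennreal" where
  "dirichlet_energy u = (\<integral>\<^sup>+ x. ennreal ((norm (weak_gradient u x))\<^sup>2) \<partial>lebesgue)"

definition coulomb_sobolev :: "real \<Rightarrow> real \<Rightarrow> (real ^ 'n \<Rightarrow> real) set" where
  "coulomb_sobolev \<alpha> p =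
     {u \<in> borel_measurable lebesgue.
        coulomb_energy \<alpha> p u < \<infinity> \<and> weakly_differentiable u \<and> dirichlet_energy u < \<infinity>}"

text \<open>Only meaningful on \<^term>\<open>coulomb_sobolev \<alpha> p\<close>, where both energies are finite;
  \<^term>\<open>enn2real\<close> maps \<open>\<infinity>\<close> to \<open>0\<close>.\<close>

definition coulomb_sobolev_norm :: "real \<Rightarrow> real \<Rightarrow> (real ^ 'n \<Rightarrow> real) \<Rightarrow> real" where
  "coulomb_sobolev_norm \<alpha> p u =
     sqrt (enn2real (dirichlet_energy u) + enn2real (coulomb_energy \<alpha> p u) powr (1 / p))"

lemma coulomb_energy_cong_AE:
  assumes "AE x in lebesgue. u x = v x"
  shows "coulomb_energy \<alpha> p u = coulomb_energy \<alpha> p v"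
proof -
  have "nn_convolution k (\<lambda>y. \<bar>u y\<bar> powr p) x = nn_convolution k (\<lambda>y. \<bar>v y\<bar> powr p) x" for k x
    unfolding nn_convolution_def by (rule nn_integral_cong_AE) (use assms in auto)
  then show ?thesis
    by (simp add: coulomb_energy_def)
qed

lemma lebesgue_integrable_cong_AE:
  fixes f h :: "real ^ 'n \<Rightarrow> 'b::euclidean_space"
  assumes "AE x in lebesgue. f x = h x"
  shows "integrable lebesgue f \<longleftrightarrow> integrable lebesgue h"
    and "(\<integral>x. f x \<partial>lebesgue) = (\<integral>x. h x \<partial>lebesgue)"
proof -
  have *: "AE x in lebesgue. h x = f x"
    using assms by eventually_elim simp
  have meas: "f \<in> borel_measurable lebesgue \<longleftrightarrow> h \<in> borel_measurable lebesgue"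
    using borel_measurable_AE[OF _ assms] borel_measurable_AE[OF _ *] by blast
  then show int: "integrable lebesgue f \<longleftrightarrow> integrable lebesgue h"
    by (metis assms * integrable_cong_AE_imp borel_measurable_integrable)
  show "(\<integral>x. f x \<partial>lebesgue) = (\<integral>x. h x \<partial>lebesgue)"
    using meas int assms by (metis integral_cong_AE borel_measurable_integrable not_integrable_integral_eq)
qed

lemma has_weak_gradient_cong_AE:
  assumes "AE x in lebesgue. u x = v x"
  shows "has_weak_gradient u g \<longleftrightarrow> has_weak_gradient v g"
proof -
  have "locally_integrable u \<longleftrightarrow> locally_integrable v"
    unfolding locally_integrable_def set_integrable_def
    by (intro all_cong lebesgue_integrable_cong_AE) (use assms in eventually_elim, simp)
  moreover have "(\<integral>x. u x * w x \<partial>lebesgue) = (\<integral>x. v x * w x \<partial>lebesgue)" for w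
    by (rule lebesgue_integrable_cong_AE) (use assms in eventually_elim, simp)
  ultimately show ?thesis
    by (simp add: has_weak_gradient_def)
qed

lemma dirichlet_energy_cong_AE:
  assumes "AE x in lebesgue. u x = v x"
  shows "dirichlet_energy u = dirichlet_energy v"
  by (simp add: dirichlet_energy_def weak_gradient_def has_weak_gradient_cong_AE[OF assms])

lemma coulomb_sobolev_cong_AE:
  assumes "AE x in lebesgue. u x = v x"
  shows "u \<in> coulomb_sobolev \<alpha> p \<longleftrightarrow> v \<in> coulomb_sobolev \<alpha> p"
proof -
  have *: "AE x in lebesgue. v x = u x"
    using assms by eventually_elim simp
  have "u \<in> borel_measurable lebesgue \<longleftrightarrow> v \<in> borel_measurable lebesgue"
    using borel_measurable_AE[OF _ assms] borel_measurable_AE[OF _ *] by blast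
  moreover have "has_weak_gradient u = has_weak_gradient v"
    by (intro ext has_weak_gradient_cong_AE[OF assms])
  ultimately show ?thesis
    by (simp add: coulomb_sobolev_def weakly_differentiable_def
        coulomb_energy_cong_AE[OF assms] dirichlet_energy_cong_AE[OF assms])
qed

lemma coulomb_sobolev_norm_cong_AE:
  assumes "AE x in lebesgue. u x = v x"
  shows "coulomb_sobolev_norm \<alpha> p u = coulomb_sobolev_norm \<alpha> p v"
  by (simp add: coulomb_sobolev_norm_def coulomb_energy_cong_AE[OF assms]
      dirichlet_energy_cong_AE[OF assms])

end

theory Submission
  imports Defs
begin

text \<open>
  A function \<open>u\<close> of finite energy is approximated in three steps: \<open>u\<close> is mollified, the range of
  the resulting smooth function is truncated smoothly, and the resulting bounded function is
  multiplied by a cutoff \<open>\<eta> (x / R)\<close> with \<open>R \<rightarrow> \<infinity>\<close>. Both the Dirichlet and the Coulomb energy of the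
  error have to become small in each step.

  For the Coulomb energy all three steps follow from two properties. The energy satisfies a
  dominated convergence theorem, because it is an iterated integral of \<open>\<bar>u\<bar> powr p\<close>; this settles
  truncation and cutoff. It also does not increase under averaging over translates, by Jensen's
  inequality applied to the power \<open>p\<close> and then to the square. Together with density of continuous
  functions of compact support, which is again dominated convergence, this gives convergence of
  mollifications (\<open>mollification_tendsto\<close>). The argument is carried out once for an abstract
  functional and used for the Coulomb energy, for the square integral of the gradient, and for the
  integral of the absolute value, where it yields uniqueness of weak gradients.

  The only delicate term is the part \<open>w \<nabla>(\<eta> (x / R))\<close> of the gradient of a product with a cutoff. Its
  square integral is bounded by a multiple of \<open>1 / R\<^sup>2\<close> times the integral of \<open>w\<^sup>2\<close> over the annulus
  \<open>R \<le> \<bar>x\<bar> \<le> 3 R\<close>, and it has to be shown that this tends to \<open>0\<close> in every dimension \<open>N\<close>.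
  Finiteness of the Coulomb energy forces the mean of \<open>\<bar>w\<bar> powr p\<close> over the ball of radius \<open>R\<close> to
  vanish as \<open>R \<rightarrow> \<infinity>\<close> (\<open>mean_powr_tendsto_0\<close>), and if \<open>w\<close> is bounded the same holds for the mean of
  \<open>w\<^sup>2\<close> (\<open>mean_square_tendsto_0\<close>); this is the purpose of the truncation. For \<open>N \<le> 2\<close> the bound
  follows at once, as \<open>R ^ N \<le> R\<^sup>2\<close>. For \<open>N \<ge> 3\<close> one compares \<open>w (R x)\<close> with \<open>w (L x)\<close> along the ray
  through \<open>x\<close>. The comparison costs at most a multiple of \<open>R powr (2 - N)\<close> times the Dirichlet energy
  outside the ball of radius \<open>R\<close>, uniformly in \<open>L\<close>, and the mean of \<open>w (L x)\<^sup>2\<close> disappears as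
  \<open>L \<rightarrow> \<infinity>\<close> (\<open>annulus_estimate\<close>).
\<close>

section \<open>Smooth functions\<close>

definition smooth :: "(real ^ 'n \<Rightarrow> real) \<Rightarrow> bool" where
  "smooth f \<longleftrightarrow> (\<forall>k. cont_diff k f)"

definition gradient :: "(real ^ 'n \<Rightarrow> real) \<Rightarrow> real ^ 'n \<Rightarrow> real ^ 'n" where
  "gradient f x = (\<chi> i. partial_deriv i f x)"

lemma partial_deriv_eqI:
  "(f has_derivative f') (at x) \<Longrightarrow> partial_deriv i f x = f' (axis i 1)"
  unfolding partial_deriv_def by (metis frechet_derivative_at)

lemma has_derivative_gradient:
  fixes f :: "real ^ 'n \<Rightarrow> real"
  assumes "f differentiable at x"
  shows "(f has_derivative (\<lambda>h. gradient f x \<bullet> h)) (at x)"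
proof -
  let ?D = "frechet_derivative f (at x)"
  have D: "(f has_derivative ?D) (at x)"
    using assms by (simp add: frechet_derivative_works[symmetric])
  then have lin: "linear ?D" by (rule has_derivative_linear)
  have "?D h = gradient f x \<bullet> h" for h
  proof -
    have "?D h = ?D (\<Sum>i\<in>UNIV. h $ i *\<^sub>R axis i 1)"
      by (simp add: basis_expansion scalar_mult_eq_scaleR[symmetric])
    also have "\<dots> = (\<Sum>i\<in>UNIV. h $ i *\<^sub>R ?D (axis i 1))"
      by (simp add: linear_sum[OF lin] linear_scale[OF lin])
    also have "\<dots> = gradient f x \<bullet> h"
      by (simp add: inner_vec_def gradient_def partial_deriv_def mult.commute)
    finally show ?thesis .
  qed
  then have "?D = (\<lambda>h. gradient f x \<bullet> h)" by auto
  with D show ?thesis by simp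
qed

lemma gradient_eqI:
  fixes f :: "real ^ 'n \<Rightarrow> real"
  assumes "(f has_derivative (\<lambda>h. g \<bullet> h)) (at x)"
  shows "gradient f x = g"
  by (simp add: vec_eq_iff gradient_def partial_deriv_eqI[OF assms] inner_axis)

lemma cont_diff_continuous: "cont_diff k f \<Longrightarrow> continuous_on UNIV f"
  by (cases k) (auto intro: differentiable_imp_continuous_on)

lemma cont_diff_SucD: "cont_diff (Suc k) f \<Longrightarrow> cont_diff k f"
proof (induction k arbitrary: f)
  case 0
  then show ?case by (auto intro: differentiable_imp_continuous_on)
qed (metis cont_diff.simps(2))

lemma cont_diff_Suc_differentiable: "cont_diff (Suc k) f \<Longrightarrow> f differentiable at x"
  by (simp add: differentiable_on_def)

lemma partial_deriv_add:
  assumes "f differentiable at x" "g differentiable at x"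
  shows "partial_deriv i (\<lambda>x. f x + g x) x = partial_deriv i f x + partial_deriv i g x"
  using partial_deriv_eqI[OF has_derivative_add[OF assms[THEN has_derivative_gradient]], of i]
  by (simp add: inner_axis gradient_def)

lemma partial_deriv_mult:
  assumes "f differentiable at x" "g differentiable at x"
  shows "partial_deriv i (\<lambda>x. f x * g x) x
    = f x * partial_deriv i g x + partial_deriv i f x * g x"
  using partial_deriv_eqI[OF has_derivative_mult[OF assms[THEN has_derivative_gradient]], of i]
  by (simp add: inner_axis gradient_def)

lemma partial_deriv_const: "partial_deriv i (\<lambda>x. c) x = 0"
  by (simp add: partial_deriv_def)

lemma cont_diff_const: "cont_diff k (\<lambda>x. c)"
  by (induction k arbitrary: c) (simp_all add: partial_deriv_const[abs_def])

lemma cont_diff_add: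
  "cont_diff k f \<Longrightarrow> cont_diff k g \<Longrightarrow> cont_diff k (\<lambda>x. f x + g x)"
proof (induction k arbitrary: f g)
  case 0
  then show ?case by (auto intro: continuous_on_add)
next
  case (Suc k)
  have "partial_deriv i (\<lambda>x. f x + g x) = (\<lambda>x. partial_deriv i f x + partial_deriv i g x)" for i
    by (rule ext, rule partial_deriv_add) (use Suc.prems cont_diff_Suc_differentiable in blast)+
  then show ?case
    using Suc by (auto simp: differentiable_on_def)
qed

lemma cont_diff_mult:
  "cont_diff k f \<Longrightarrow> cont_diff k g \<Longrightarrow> cont_diff k (\<lambda>x. f x * g x)"
proof (induction k arbitrary: f g)
  case 0
  then show ?case by (auto intro: continuous_on_mult)
next
  case (Suc k)
  have "partial_deriv i (\<lambda>x. f x * g x)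
      = (\<lambda>x. f x * partial_deriv i g x + partial_deriv i f x * g x)" for i
    by (rule ext, rule partial_deriv_mult) (use Suc.prems cont_diff_Suc_differentiable in blast)+
  moreover have "cont_diff k f" "cont_diff k g"
    using Suc.prems cont_diff_SucD by blast+
  ultimately show ?case
    using Suc by (auto simp: differentiable_on_def intro!: cont_diff_add)
qed

lemma partial_deriv_affine:
  assumes "f differentiable at (a + c *\<^sub>R x)"
  shows "partial_deriv i (\<lambda>x. f (a + c *\<^sub>R x)) x = c * partial_deriv i f (a + c *\<^sub>R x)"
proof -
  have "((\<lambda>x. f (a + c *\<^sub>R x)) has_derivative (\<lambda>h. gradient f (a + c *\<^sub>R x) \<bullet> (c *\<^sub>R h))) (at x)"
    by (rule has_derivative_compose[where f="\<lambda>x. a + c *\<^sub>R x" and g=f,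
          OF _ has_derivative_gradient[OF assms]])
      (auto intro!: derivative_eq_intros)
  from partial_deriv_eqI[OF this, of i] show ?thesis
    by (simp add: inner_axis gradient_def)
qed

lemma cont_diff_affine: "cont_diff k f \<Longrightarrow> cont_diff k (\<lambda>x. f (a + c *\<^sub>R x))"
proof (induction k arbitrary: f)
  case 0
  then show ?case by (auto intro!: continuous_intros elim: continuous_on_compose2)
next
  case (Suc k)
  have d: "f differentiable at x" for x
    using Suc.prems cont_diff_Suc_differentiable by blast
  then have "partial_deriv i (\<lambda>x. f (a + c *\<^sub>R x)) = (\<lambda>x. c * partial_deriv i f (a + c *\<^sub>R x))" for i
    by (intro ext partial_deriv_affine)
  moreover have "(\<lambda>x. f (a + c *\<^sub>R x)) differentiable (at x)" for x
    using differentiable_chain_at[of "\<lambda>x. a + c *\<^sub>R x" x f] d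
    by (simp add: o_def)
  ultimately show ?case
    using Suc by (auto simp: differentiable_on_def intro!: cont_diff_mult cont_diff_const)
qed

lemma partial_deriv_chain_real:
  fixes f :: "real ^ 'n \<Rightarrow> real"
  assumes "f differentiable at x" "(T has_real_derivative T') (at (f x))"
  shows "partial_deriv i (\<lambda>x. T (f x)) x = T' * partial_deriv i f x"
    "(\<lambda>x. T (f x)) differentiable at x"
proof -
  have *: "((\<lambda>x. T (f x)) has_derivative (\<lambda>h. T' * (gradient f x \<bullet> h))) (at x)"
    using has_derivative_compose[OF has_derivative_gradient[OF assms(1)]
        assms(2)[unfolded has_field_derivative_def]] by simp
  show "partial_deriv i (\<lambda>x. T (f x)) x = T' * partial_deriv i f x"
    using partial_deriv_eqI[OF *, of i] by (simp add: inner_axis gradient_def)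
  show "(\<lambda>x. T (f x)) differentiable at x"
    using * by (auto simp: differentiable_def)
qed

lemma cont_diff_inverse:
  "cont_diff k f \<Longrightarrow> (\<And>x. f x \<noteq> 0) \<Longrightarrow> cont_diff k (\<lambda>x. inverse (f x))"
proof (induction k)
  case 0
  then show ?case by (auto intro: continuous_on_inverse)
next
  case (Suc k)
  have d: "f differentiable at x" for x
    using Suc.prems cont_diff_Suc_differentiable by blast
  have "(inverse has_real_derivative - (inverse (f x) * inverse (f x))) (at (f x))" for x
    using DERIV_inverse[OF Suc.prems(2)[of x]] by (simp add: power2_eq_square numeral_2_eq_2)
  note * = partial_deriv_chain_real[OF d this]
  have "partial_deriv i (\<lambda>x. inverse (f x))
      = (\<lambda>x. (- 1) * ((inverse (f x) * inverse (f x)) * partial_deriv i f x))" for i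
    by (rule ext) (use *(1) in simp)
  moreover have inv: "cont_diff k (\<lambda>x. inverse (f x))"
    using Suc cont_diff_SucD by blast
  moreover have "cont_diff k (\<lambda>x. (- 1) * ((inverse (f x) * inverse (f x)) * partial_deriv i f x))" for i
    using Suc.prems inv by (intro cont_diff_mult cont_diff_const) auto
  ultimately show ?case
    using *(2) by (simp only: cont_diff.simps differentiable_on_def) auto
qed

text \<open>Smoothness is coinductive: it suffices to exhibit a class of differentiable functions that is
  closed under taking partial derivatives.\<close>

lemma smooth_coinduct:
  assumes "f \<in> S"
    and "\<And>f x. f \<in> S \<Longrightarrow> f differentiable at x"
    and "\<And>f i. f \<in> S \<Longrightarrow> partial_deriv i f \<in> S"
  shows "smooth f"
proof -
  have "f \<in> S \<Longrightarrow> cont_diff k f" for k f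
    by (induction k arbitrary: f)
      (auto simp: differentiable_on_def assms(2,3)
        intro!: continuous_at_imp_continuous_on differentiable_imp_continuous_within)
  with assms(1) show ?thesis
    by (simp add: smooth_def)
qed

lemma smooth_differentiable: "smooth f \<Longrightarrow> f differentiable at x"
  unfolding smooth_def using cont_diff_Suc_differentiable by blast

lemma smooth_partial_deriv: "smooth f \<Longrightarrow> smooth (partial_deriv i f)"
  unfolding smooth_def using cont_diff.simps(2) by blast

lemma smooth_continuous: "smooth f \<Longrightarrow> continuous_on UNIV f"
  unfolding smooth_def using cont_diff_continuous by blast

lemma smooth_measurable [measurable_dest]: "smooth f \<Longrightarrow> f \<in> borel_measurable borel"
  by (intro borel_measurable_continuous_onI smooth_continuous)

lemma smooth_add: "smooth f \<Longrightarrow> smooth g \<Longrightarrow> smooth (\<lambda>x. f x + g x)"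
  by (simp add: smooth_def cont_diff_add)

lemma smooth_mult: "smooth f \<Longrightarrow> smooth g \<Longrightarrow> smooth (\<lambda>x. f x * g x)"
  by (simp add: smooth_def cont_diff_mult)

lemma smooth_const: "smooth (\<lambda>x. c)"
  by (simp add: smooth_def cont_diff_const)

lemma smooth_affine: "smooth f \<Longrightarrow> smooth (\<lambda>x. f (a + c *\<^sub>R x))"
  by (simp add: smooth_def cont_diff_affine)

lemma smooth_inverse: "smooth f \<Longrightarrow> (\<And>x. f x \<noteq> 0) \<Longrightarrow> smooth (\<lambda>x. inverse (f x))"
  by (simp add: smooth_def cont_diff_inverse)

lemma smooth_has_derivative:
  "smooth f \<Longrightarrow> (f has_derivative (\<lambda>h. gradient f x \<bullet> h)) (at x)"
  by (intro has_derivative_gradient smooth_differentiable)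

lemma continuous_gradient: "smooth f \<Longrightarrow> continuous_on UNIV (gradient f)"
  unfolding gradient_def
  by (intro continuous_on_vec_lambda smooth_continuous smooth_partial_deriv)

lemma measurable_gradient [measurable_dest]: "smooth f \<Longrightarrow> gradient f \<in> borel_measurable borel"
  by (intro borel_measurable_continuous_onI continuous_gradient)

section \<open>Test functions\<close>

lemma test_functions_iff:
  fixes f :: "real ^ 'n \<Rightarrow> real"
  shows "f \<in> test_functions \<longleftrightarrow> smooth f \<and> (\<exists>r. \<forall>x. r < norm x \<longrightarrow> f x = 0)"
proof -
  have "compact (closure {x. f x \<noteq> 0}) \<longleftrightarrow> (\<exists>r. \<forall>x. r < norm x \<longrightarrow> f x = 0)"
    unfolding compact_closure bounded_iff by (auto simp: not_less[symmetric])
  then show ?thesis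
    by (auto simp: test_functions_def smooth_def)
qed

lemma test_function_smooth: "f \<in> test_functions \<Longrightarrow> smooth f"
  by (simp add: test_functions_iff)

lemma test_function_supportE:
  assumes "f \<in> test_functions"
  obtains r where "0 < r" "\<And>x. r < norm x \<Longrightarrow> f x = 0"
proof -
  obtain r where "\<forall>x. r < norm x \<longrightarrow> f x = 0"
    using assms by (auto simp: test_functions_iff)
  then show ?thesis
    by (intro that[of "max r 1"]) auto
qed

lemma partial_deriv_zero_outside:
  fixes f :: "real ^ 'n \<Rightarrow> real"
  assumes "\<And>x. r < norm x \<Longrightarrow> f x = 0" and "r < norm x"
  shows "partial_deriv i f x = 0"
proof -
  have "(f has_derivative (\<lambda>h. 0)) (at x)"
  proof (rule has_derivative_transform_within_open)
    show "((\<lambda>x. 0) has_derivative (\<lambda>h. 0)) (at x)" by simp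
    show "open (- cball 0 r)" by auto
  qed (use assms in \<open>auto simp: dist_norm\<close>)
  from partial_deriv_eqI[OF this] show ?thesis .
qed

lemma test_function_partial_deriv:
  "f \<in> test_functions \<Longrightarrow> partial_deriv i f \<in> test_functions"
  by (metis test_functions_iff smooth_partial_deriv partial_deriv_zero_outside)

lemma test_function_mult_left:
  "smooth f \<Longrightarrow> g \<in> test_functions \<Longrightarrow> (\<lambda>x. f x * g x) \<in> test_functions"
  by (auto simp: test_functions_iff smooth_mult)

lemma test_function_scale: "f \<in> test_functions \<Longrightarrow> (\<lambda>x. c * f x) \<in> test_functions"
  by (intro test_function_mult_left smooth_const)

lemma test_function_affine:
  fixes f :: "real ^ 'n \<Rightarrow> real"
  assumes "f \<in> test_functions" "c \<noteq> 0"
  shows "(\<lambda>x. f (a + c *\<^sub>R x)) \<in> test_functions"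
proof -
  obtain r where r: "\<And>x. r < norm x \<Longrightarrow> f x = 0"
    using assms by (auto simp: test_functions_iff)
  have "f (a + c *\<^sub>R x) = 0" if "(r + norm a) / \<bar>c\<bar> < norm x" for x
  proof (rule r)
    have "r + norm a < \<bar>c\<bar> * norm x"
      using that assms(2) by (simp add: field_simps)
    also have "\<bar>c\<bar> * norm x = norm (c *\<^sub>R x)" by simp
    also have "\<dots> \<le> norm (a + c *\<^sub>R x) + norm a"
      using norm_triangle_ineq4[of "a + c *\<^sub>R x" a] by simp
    finally show "r < norm (a + c *\<^sub>R x)" by simp
  qed
  then show ?thesis
    using assms by (auto simp: test_functions_iff smooth_affine)
qed

lemma test_function_bounded:
  fixes f :: "real ^ 'n \<Rightarrow> real"
  assumes "f \<in> test_functions"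
  obtains B where "0 < B" "\<And>x. \<bar>f x\<bar> \<le> B"
proof -
  obtain r where r: "0 < r" "\<And>x. r < norm x \<Longrightarrow> f x = 0"
    using test_function_supportE[OF assms] by blast
  have "compact (f ` cball 0 r)"
    using assms by (intro compact_continuous_image continuous_on_subset[OF smooth_continuous])
      (auto simp: test_functions_iff)
  then obtain B where B: "0 < B" "\<forall>x\<in>cball 0 r. \<bar>f x\<bar> \<le> B"
    using compact_imp_bounded bounded_pos by (metis (no_types, lifting) image_eqI real_norm_def)
  then have "\<bar>f x\<bar> \<le> B" for x
    using r(2)[of x] by (cases "r < norm x") auto
  with B show ?thesis using that by blast
qed

lemma test_function_Lipschitz:
  fixes f :: "real ^ 'n \<Rightarrow> real"
  assumes "f \<in> test_functions"
  obtains L where "0 < L" "\<And>x y. \<bar>f x - f y\<bar> \<le> L * norm (x - y)"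
    "\<And>x. norm (gradient f x) \<le> L"
proof -
  have "\<forall>i. \<exists>B. \<forall>x. \<bar>partial_deriv i f x\<bar> \<le> B"
    using assms test_function_bounded test_function_partial_deriv by metis
  then obtain B where B: "\<And>i x. \<bar>partial_deriv i f x\<bar> \<le> B i" by metis
  define L where "L = (\<Sum>i\<in>UNIV. B i) + 1"
  have B0: "0 \<le> B i" for i using B[of i 0] by linarith
  have le: "norm (gradient f x) \<le> L" for x
  proof -
    have "norm (gradient f x) \<le> (\<Sum>i\<in>UNIV. \<bar>gradient f x $ i\<bar>)"
      by (rule norm_le_l1_cart)
    also have "\<dots> \<le> (\<Sum>i\<in>UNIV. B i)"
      by (intro sum_mono) (simp add: gradient_def B)
    finally show ?thesis by (simp add: L_def)
  qed
  have "norm (f x - f y) \<le> L * norm (x - y)" for x y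
  proof (rule differentiable_bound[of UNIV f "\<lambda>x h. gradient f x \<bullet> h"])
    show "(f has_derivative (\<lambda>h. gradient f x \<bullet> h)) (at x)" for x
      using assms by (intro smooth_has_derivative test_function_smooth)
    show "onorm (\<lambda>h. gradient f x \<bullet> h) \<le> L" for x
      by (rule onorm_le) (metis Cauchy_Schwarz_ineq2 le mult_right_mono norm_ge_zero order_trans real_norm_def)
  qed auto
  moreover have "0 < L"
    using B0 by (simp add: L_def add_nonneg_pos sum_nonneg)
  ultimately show ?thesis
    using that le by auto
qed

text \<open>The remainder of the first order Taylor expansion is quadratic, uniformly in the base point.
  This one estimate yields both differentiation under the convolution integral and, because
  integrals are translation invariant, the vanishing of the integral of a partial derivative.\<close>

lemma test_function_Taylor:
  fixes f :: "real ^ 'n \<Rightarrow> real"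
  assumes "f \<in> test_functions"
  obtains M where "0 < M" "\<And>x h. \<bar>f (x + h) - f x - gradient f x \<bullet> h\<bar> \<le> M * (norm h)\<^sup>2"
proof -
  have "\<forall>i. \<exists>L. \<forall>x y. \<bar>partial_deriv i f x - partial_deriv i f y\<bar> \<le> L * norm (x - y)"
    using assms test_function_Lipschitz test_function_partial_deriv by metis
  then obtain L where L: "\<And>i x y. \<bar>partial_deriv i f x - partial_deriv i f y\<bar> \<le> L i * norm (x - y)"
    by metis
  define M where "M = (\<Sum>i\<in>UNIV. \<bar>L i\<bar>) + 1"
  have M0: "0 < M" by (simp add: M_def add_nonneg_pos sum_nonneg)
  have le: "norm (gradient f x - gradient f y) \<le> M * norm (x - y)" for x y
  proof -
    have "norm (gradient f x - gradient f y) \<le> (\<Sum>i\<in>UNIV. \<bar>(gradient f x - gradient f y) $ i\<bar>)"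
      by (rule norm_le_l1_cart)
    also have "\<dots> \<le> (\<Sum>i\<in>UNIV. \<bar>L i\<bar> * norm (x - y))"
    proof (rule sum_mono)
      fix i
      have "\<bar>(gradient f x - gradient f y) $ i\<bar> \<le> L i * norm (x - y)"
        by (simp add: gradient_def L)
      also have "\<dots> \<le> \<bar>L i\<bar> * norm (x - y)"
        by (intro mult_right_mono) auto
      finally show "\<bar>(gradient f x - gradient f y) $ i\<bar> \<le> \<bar>L i\<bar> * norm (x - y)" .
    qed
    also have "\<dots> \<le> M * norm (x - y)"
      unfolding M_def sum_distrib_right[symmetric] by (intro mult_right_mono) auto
    finally show ?thesis .
  qed
  have "\<bar>f (x + h) - f x - gradient f x \<bullet> h\<bar> \<le> M * (norm h)\<^sup>2" for x h
  proof -
    let ?S = "(\<lambda>t. x + t *\<^sub>R h) ` {0..1}"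
    have "norm (f (x + h) - f x - gradient f x \<bullet> ((x + h) - x)) \<le> norm ((x + h) - x) * (M * norm h)"
    proof (rule differentiable_bound_linearization[where S="?S" and a=x and b="x + h" and ?x0.0=x and f=f and B="M * norm h" and f'="\<lambda>x h. gradient f x \<bullet> h"])
      show "x + t *\<^sub>R (x + h - x) \<in> ?S" if "t \<in> {0..1}" for t
        by (rule image_eqI[of _ _ t]) (use that in simp_all)
      show "(f has_derivative (\<lambda>h. gradient f y \<bullet> h)) (at y within ?S)" for y
        by (rule has_derivative_at_withinI[OF smooth_has_derivative[OF test_function_smooth[OF assms]]])
      show "x \<in> ?S" by (rule image_eqI[of _ _ 0]) simp_all
    next
      fix y assume "y \<in> ?S"
      then obtain t where t: "t \<in> {0..1}" "y = x + t *\<^sub>R h" by blast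
      have *: "norm (y - x) \<le> norm h"
        using t by (simp add: mult_left_le_one_le)
      have "\<bar>(gradient f y - gradient f x) \<bullet> z\<bar> \<le> M * norm h * norm z" for z
      proof -
        have "\<bar>(gradient f y - gradient f x) \<bullet> z\<bar> \<le> norm (gradient f y - gradient f x) * norm z"
          by (rule Cauchy_Schwarz_ineq2)
        also have "\<dots> \<le> (M * norm (y - x)) * norm z"
          by (intro mult_right_mono le) simp
        also have "\<dots> \<le> M * norm h * norm z"
          using * M0 by (intro mult_right_mono mult_left_mono) simp_all
        finally show ?thesis .
      qed
      then show "onorm ((\<lambda>h. gradient f y \<bullet> h) - (\<lambda>h. gradient f x \<bullet> h)) \<le> M * norm h"
        by (intro onorm_le) (simp add: inner_diff_left)
    qed
    then show ?thesis by (simp add: power2_eq_square algebra_simps)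
  qed
  then show ?thesis
    by (rule that[OF M0])
qed

section \<open>A bump function\<close>

text \<open>For \<open>t > 0\<close>, differentiating \<open>exp (- 1 / t)\<close> only produces further powers of \<open>1 / t\<close>, so this family is closed
  under derivatives up to linear combinations; the factor \<open>exp (- 1 / t)\<close> makes all its members
  tend to \<open>0\<close> at the origin.\<close>

definition flat :: "nat \<Rightarrow> real \<Rightarrow> real" where
  "flat k t = (if 0 < t then (1 / t) ^ k * exp (- 1 / t) else 0)"

lemma flat_tendsto_0: "(flat k \<longlongrightarrow> 0) (at 0)"
proof -
  have "((\<lambda>t::real. (1 / t) ^ k * exp (- 1 / t)) \<longlongrightarrow> 0) (at_right 0)"
  proof -
    have "filterlim (\<lambda>t::real. 1 / t) at_top (at_right 0)"
      using filterlim_inverse_at_top_right by (simp add: inverse_eq_divide)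
    from filterlim_compose[OF tendsto_power_div_exp_0[of k] this]
    show ?thesis by (simp add: exp_minus divide_inverse)
  qed
  then have "(flat k \<longlongrightarrow> 0) (at_right 0)"
    by (rule Lim_transform_eventually) (auto simp: flat_def eventually_at_right_less
        intro!: eventually_mono[OF eventually_at_right_less])
  moreover have "(flat k \<longlongrightarrow> 0) (at_left 0)"
    by (rule Lim_transform_eventually[of "\<lambda>_. 0"])
      (auto simp: flat_def eventually_at_filter)
  ultimately show ?thesis
    by (simp add: filterlim_split_at)
qed

lemma has_derivative_flat:
  "(flat k has_real_derivative (- real k * flat (Suc k) t + flat (Suc (Suc k)) t)) (at t)"
proof -
  consider "t < 0" | "t = 0" | "0 < t" by linarith
  then show ?thesis
  proof cases
    case 1
    have "((\<lambda>t. 0) has_real_derivative 0) (at t)" by simp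
    then have "(flat k has_real_derivative 0) (at t)"
      by (rule has_field_derivative_transform_within_open[where S="{..<0}"])
        (use 1 in \<open>auto simp: flat_def\<close>)
    then show ?thesis using 1 by (simp add: flat_def)
  next
    case 2
    have "((\<lambda>h. (flat k (0 + h) - flat k 0) / h) \<longlongrightarrow> 0) (at 0)"
      using flat_tendsto_0[of "Suc k"]
      by (rule Lim_transform_eventually)
        (auto simp: flat_def eventually_at_filter field_simps)
    then show ?thesis using 2 by (simp add: DERIV_def flat_def)
  next
    case 3
    have "((\<lambda>t. (1 / t) ^ k * exp (- 1 / t)) has_real_derivative
        (- real k * flat (Suc k) t + flat (Suc (Suc k)) t)) (at t)"
    proof -
      have inv: "((\<lambda>t. 1 / t) has_real_derivative - ((1 / t) * (1 / t))) (at t)"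
        using 3 by (auto intro!: derivative_eq_intros simp: power2_eq_square)
      have "((\<lambda>t. exp (- 1 / t)) has_real_derivative exp (- 1 / t) * ((1 / t) * (1 / t))) (at t)"
        using 3 by (auto intro!: derivative_eq_intros simp: power2_eq_square)
      from DERIV_mult[OF DERIV_power[OF inv, of k] this] show ?thesis
        by (rule DERIV_cong) (use 3 in \<open>cases k; simp add: flat_def field_simps\<close>)
    qed
    then show ?thesis
      by (rule has_field_derivative_transform_within_open[where S="{0<..}"])
        (use 3 in \<open>auto simp: flat_def\<close>)
  qed
qed

text \<open>The smallest class of functions that contains \<open>x \<mapsto> flat k (1 - \<bar>x\<bar>\<^sup>2)\<close> and is visibly closed
  under partial derivatives.\<close>

inductive_set bump_class :: "(real ^ 'n \<Rightarrow> real) set" where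
  flat: "(\<lambda>x. flat k (1 - x \<bullet> x)) \<in> bump_class"
| coord: "f \<in> bump_class \<Longrightarrow> (\<lambda>x. x $ i * f x) \<in> bump_class"
| scale: "f \<in> bump_class \<Longrightarrow> (\<lambda>x. c * f x) \<in> bump_class"
| add: "f \<in> bump_class \<Longrightarrow> g \<in> bump_class \<Longrightarrow> (\<lambda>x. f x + g x) \<in> bump_class"

lemma coord_derivative: "((\<lambda>x::real ^ 'n. x $ i) has_derivative (\<lambda>h. h $ i)) (at x)"
  by (rule bounded_linear_imp_has_derivative[OF bounded_linear_vec_nth])

lemma bump_class_deriv:
  fixes f :: "real ^ 'n \<Rightarrow> real"
  shows "f \<in> bump_class \<Longrightarrow> (\<forall>x. f differentiable at x) \<and> (\<forall>i. partial_deriv i f \<in> bump_class)"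
proof (induction rule: bump_class.induct)
  case (flat k)
  have *: "((\<lambda>x::real ^ 'n. flat k (1 - x \<bullet> x)) has_derivative
      (\<lambda>h. - 2 * (x \<bullet> h) * (- real k * flat (Suc k) (1 - x \<bullet> x) + flat (Suc (Suc k)) (1 - x \<bullet> x)))) (at x)"
    for x
  proof -
    have "((\<lambda>x::real ^ 'n. 1 - x \<bullet> x) has_derivative (\<lambda>h. - 2 * (x \<bullet> h))) (at x)"
      by (auto intro!: derivative_eq_intros simp: inner_commute)
    from has_derivative_compose[OF this has_derivative_flat[unfolded has_field_derivative_def]]
    show ?thesis by (simp add: algebra_simps)
  qed
  have eq: "partial_deriv i (\<lambda>x::real ^ 'n. flat k (1 - x \<bullet> x))
     = (\<lambda>x. (2 * real k) * (x $ i * flat (Suc k) (1 - x \<bullet> x))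
         + (- 2) * (x $ i * flat (Suc (Suc k)) (1 - x \<bullet> x)))" for i
    by (rule ext, subst partial_deriv_eqI[OF *]) (simp add: inner_axis algebra_simps)
  have "(\<lambda>x::real ^ 'n. (2 * real k) * (x $ i * flat (Suc k) (1 - x \<bullet> x))
         + (- 2) * (x $ i * flat (Suc (Suc k)) (1 - x \<bullet> x))) \<in> bump_class" for i
    by (intro bump_class.intros)
  then show ?case
    unfolding eq using differentiableI[OF *] by blast
next
  case (coord f i)
  have d: "(\<lambda>x::real ^ 'n. x $ i) differentiable at x" for x
    using coord_derivative by (auto simp: differentiable_def)
  have "partial_deriv j (\<lambda>x. x $ i * f x)
      = (\<lambda>x. x $ i * partial_deriv j f x + (axis j 1 $ i) * f x)" for j
    using coord.IH d
    by (intro ext) (auto simp: partial_deriv_mult partial_deriv_eqI[OF coord_derivative])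
  with coord d show ?case
    by (auto intro!: bump_class.intros differentiable_mult)
next
  case (scale f c)
  have "partial_deriv j (\<lambda>x. c * f x) = (\<lambda>x. c * partial_deriv j f x)" for j
    using scale.IH by (intro ext) (auto simp: partial_deriv_mult partial_deriv_const)
  with scale show ?case
    by (auto intro!: bump_class.intros differentiable_mult)
next
  case (add f g)
  have "partial_deriv j (\<lambda>x. f x + g x) = (\<lambda>x. partial_deriv j f x + partial_deriv j g x)" for j
    using add.IH by (intro ext) (auto simp: partial_deriv_add)
  with add show ?case
    by (auto intro!: bump_class.intros differentiable_add)
qed

definition bump :: "real ^ 'n \<Rightarrow> real" where
  "bump x = flat 0 (1 - x \<bullet> x)"

lemma bump_nonneg: "0 \<le> bump x"
  by (simp add: bump_def flat_def)

lemma bump_eq_0_iff: "bump x = 0 \<longleftrightarrow> 1 \<le> norm x"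
  using abs_square_less_1[of "norm x"] by (auto simp: bump_def flat_def dot_square_norm)

lemma test_function_bump: "bump \<in> test_functions"
proof -
  have "smooth (bump :: real ^ 'n \<Rightarrow> real)"
  proof (rule smooth_coinduct)
    show "(bump :: real ^ 'n \<Rightarrow> real) \<in> bump_class"
      using bump_class.flat[of 0] by (simp add: bump_def[abs_def])
  qed (use bump_class_deriv in blast)+
  moreover have "bump x = 0" if "1 < norm x" for x :: "real ^ 'n"
    using that by (simp add: bump_eq_0_iff)
  ultimately show ?thesis
    unfolding test_functions_iff by blast
qed

section \<open>Changes of variables\<close>

lemma nn_integral_lborel_affine:
  fixes f :: "real ^ 'n \<Rightarrow> ennreal"
  assumes [measurable]: "f \<in> borel_measurable borel" and "c \<noteq> 0"
  shows "(\<integral>\<^sup>+ x. f x \<partial>lborel) = ennreal (\<bar>c\<bar> ^ CARD('n)) * (\<integral>\<^sup>+ x. f (t + c *\<^sub>R x) \<partial>lborel)"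
  by (subst lborel_affine[OF assms(2), of t])
    (simp add: nn_integral_density nn_integral_distr nn_integral_cmult)

lemma lborel_isometry:
  fixes t :: "'a::euclidean_space"
  assumes "\<bar>c\<bar> = 1"
  shows "distr lborel borel (\<lambda>x. t + c *\<^sub>R x) = lborel"
proof -
  have "c \<noteq> 0" using assms by auto
  from lborel_affine[OF this, of t] show ?thesis
    by (simp add: assms density_1)
qed

lemma lborel_integral_isometry:
  fixes f :: "real ^ 'n \<Rightarrow> real"
  assumes "f \<in> borel_measurable borel" "\<bar>c\<bar> = 1"
  shows "(\<integral>x. f (t + c *\<^sub>R x) \<partial>lborel) = (\<integral>x. f x \<partial>lborel)"
    "integrable lborel (\<lambda>x. f (t + c *\<^sub>R x)) \<longleftrightarrow> integrable lborel f"
  using integral_distr[of "\<lambda>x. t + c *\<^sub>R x" lborel borel f] integrable_distr_eq[of "\<lambda>x. t + c *\<^sub>R x" lborel borel f] assms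
  by (simp_all add: lborel_isometry)

lemma nn_integral_lborel_isometry:
  fixes f :: "real ^ 'n \<Rightarrow> ennreal"
  assumes "f \<in> borel_measurable borel" "\<bar>c\<bar> = 1"
  shows "(\<integral>\<^sup>+x. f (t + c *\<^sub>R x) \<partial>lborel) = (\<integral>\<^sup>+x. f x \<partial>lborel)"
  using nn_integral_lborel_affine[OF assms(1), of c t] assms(2) by force

lemma nn_integral_lborel_translate:
  fixes f :: "real ^ 'n \<Rightarrow> ennreal"
  assumes "f \<in> borel_measurable borel"
  shows "(\<integral>\<^sup>+x. f (x - a) \<partial>lborel) = (\<integral>\<^sup>+x. f x \<partial>lborel)"
  using nn_integral_lborel_isometry[OF assms, of 1 "- a"] by simp

lemma nn_integral_lborel_reflect:
  fixes f :: "real ^ 'n \<Rightarrow> ennreal"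
  assumes "f \<in> borel_measurable borel"
  shows "(\<integral>\<^sup>+x. f (a - x) \<partial>lborel) = (\<integral>\<^sup>+x. f x \<partial>lborel)"
  using nn_integral_lborel_isometry[OF assms, of "-1" a] by simp

section \<open>Convolution with a test function\<close>

text \<open>Borel representatives are used from here on, since Tonelli's theorem is applied to
  \<^term>\<open>lborel\<close>, whose product with itself is again a Lebesgue-Borel measure.\<close>

definition loc_int :: "(real ^ 'n \<Rightarrow> real) \<Rightarrow> bool" where
  "loc_int u \<longleftrightarrow> u \<in> borel_measurable borel \<and>
     (\<forall>r. integrable lborel (\<lambda>x. indicator (cball 0 r) x * u x))"

definition conv :: "(real ^ 'n \<Rightarrow> real) \<Rightarrow> (real ^ 'n \<Rightarrow> real) \<Rightarrow> real ^ 'n \<Rightarrow> real" where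
  "conv \<phi> u x = (\<integral>y. \<phi> (x - y) * u y \<partial>lborel)"

lemma loc_int_measurable [measurable_dest]: "loc_int u \<Longrightarrow> u \<in> borel_measurable borel"
  by (simp add: loc_int_def)

lemma loc_intD: "loc_int u \<Longrightarrow> integrable lborel (\<lambda>x. indicator (cball 0 r) x * u x)"
  by (simp add: loc_int_def)

lemma integrable_mult_loc_int:
  fixes u :: "real ^ 'n \<Rightarrow> real"
  assumes u: "loc_int u" and [measurable]: "f \<in> borel_measurable borel"
    and B: "\<And>x. \<bar>f x\<bar> \<le> B" and r: "\<And>x. r < norm x \<Longrightarrow> f x = 0"
  shows "integrable lborel (\<lambda>x. f x * u x)"
proof (rule Bochner_Integration.integrable_bound)
  show "integrable lborel (\<lambda>x. B * (indicator (cball 0 r) x * u x))"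
    using loc_intD[OF u] by simp
  show "(\<lambda>x. f x * u x) \<in> borel_measurable lborel"
    using u by measurable
  have "\<bar>f x\<bar> * \<bar>u x\<bar> \<le> \<bar>B\<bar> * (indicator (cball 0 r) x * \<bar>u x\<bar>)" for x
  proof (cases "r < norm x")
    case True
    then show ?thesis using r by simp
  next
    case False
    have "\<bar>f x\<bar> \<le> \<bar>B\<bar>" using B[of x] by linarith
    with False show ?thesis by (auto intro: mult_right_mono)
  qed
  then show "AE x in lborel. norm (f x * u x) \<le> norm (B * (indicator (cball 0 r) x * u x))"
    by (simp add: abs_mult)
qed

lemma norm_diff_gt:
  fixes x y :: "'a::real_normed_vector"
  shows "norm x + r < norm y \<Longrightarrow> r < norm (x - y)"
  using norm_triangle_ineq2[of y x] by (simp add: norm_minus_commute)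

lemma conv_integrable:
  assumes f: "f \<in> test_functions" and u: "loc_int u"
  shows "integrable lborel (\<lambda>y. f (x - y) * u y)"
proof -
  obtain B where B: "\<And>x. \<bar>f x\<bar> \<le> B" using test_function_bounded[OF f] by blast
  obtain r where r: "\<And>x. r < norm x \<Longrightarrow> f x = 0" using test_function_supportE[OF f] by blast
  have [measurable]: "f \<in> borel_measurable borel"
    using smooth_measurable[OF test_function_smooth[OF f]] .
  show ?thesis
    by (rule integrable_mult_loc_int[OF u, where B=B and r="norm x + r"])
      (simp_all add: B r norm_diff_gt)
qed

lemma has_derivative_quadratic_remainder:
  fixes f :: "real ^ 'n \<Rightarrow> real"
  assumes "\<And>h. norm h \<le> 1 \<Longrightarrow> \<bar>f (x + h) - f x - g \<bullet> h\<bar> \<le> C * (norm h)\<^sup>2"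
  shows "(f has_derivative (\<lambda>h. g \<bullet> h)) (at x)"
  unfolding has_derivative_at
proof
  show "bounded_linear (\<lambda>h. g \<bullet> h)" by (rule bounded_linear_inner_right)
  show "(\<lambda>h. norm (f (x + h) - f x - g \<bullet> h) / norm h) \<midarrow>0\<rightarrow> 0"
  proof (rule Lim_null_comparison)
    have "eventually (\<lambda>h::real ^ 'n. dist h 0 < 1) (at 0)"
      by (rule eventually_at_in_open'[of "ball 0 1", simplified, THEN eventually_mono]) (auto simp: dist_commute)
    then show "eventually (\<lambda>h. norm (norm (f (x + h) - f x - g \<bullet> h) / norm h) \<le> C * norm h) (at 0)"
    proof eventually_elim
      case (elim h)
      then show ?case
        using assms[of h] by (cases "h = 0") (simp_all add: field_simps power2_eq_square)
    qed
    show "(\<lambda>h::real ^ 'n. C * norm h) \<midarrow>0\<rightarrow> 0"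
      by (auto intro!: tendsto_eq_intros)
  qed
qed

text \<open>The quadratic bound on the Taylor remainder of the test function is uniform, and the remainder
  vanishes outside a fixed ball for small increments, so it can be integrated against any locally
  integrable function.\<close>

lemma conv_has_derivative:
  fixes u :: "real ^ 'n \<Rightarrow> real"
  assumes f: "f \<in> test_functions" and u: "loc_int u"
  shows "(conv f u has_derivative (\<lambda>h. (\<chi> i. conv (partial_deriv i f) u x) \<bullet> h)) (at x)"
proof -
  obtain M where M: "0 < M" "\<And>x h. \<bar>f (x + h) - f x - gradient f x \<bullet> h\<bar> \<le> M * (norm h)\<^sup>2"
    using test_function_Taylor[OF f] by blast
  obtain r where r: "0 < r" "\<And>x. r < norm x \<Longrightarrow> f x = 0"
    using test_function_supportE[OF f] by blast
  \<comment> \<open>Increments of norm at most \<open>1\<close> only involve values of \<open>u\<close> in the ball of radius \<open>R\<close>.\<close>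
  define R where "R = norm x + r + 1"
  define C where "C = M * (\<integral>y. indicator (cball 0 R) y * \<bar>u y\<bar> \<partial>lborel)"
  have I: "integrable lborel (\<lambda>y. indicator (cball 0 R) y * \<bar>u y\<bar>)"
    using integrable_abs[OF loc_intD[OF u, of R]] by (simp add: abs_mult)
  show ?thesis
  proof (rule has_derivative_quadratic_remainder)
    fix h :: "real ^ 'n" assume h: "norm h \<le> 1"
    let ?rem = "\<lambda>y. f (x - y + h) - f (x - y) - gradient f (x - y) \<bullet> h"
    have i1: "integrable lborel (\<lambda>y. f (x - y + h) * u y)"
      using conv_integrable[OF f u, of "x + h"] by (simp add: algebra_simps)
    have i2: "integrable lborel (\<lambda>y. f (x - y) * u y)"
      by (rule conv_integrable[OF f u])
    have i3: "integrable lborel (\<lambda>y. partial_deriv i f (x - y) * u y * h $ i)" for i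
      using conv_integrable[OF test_function_partial_deriv[OF f] u] by simp
    have eq: "(\<chi> i. conv (partial_deriv i f) u x) \<bullet> h = (\<integral>y. (gradient f (x - y) \<bullet> h) * u y \<partial>lborel)"
    proof -
      have "(\<chi> i. conv (partial_deriv i f) u x) \<bullet> h
          = (\<Sum>i\<in>UNIV. (\<integral>y. partial_deriv i f (x - y) * u y * h $ i \<partial>lborel))"
        by (simp add: inner_vec_def conv_def)
      also have "\<dots> = (\<integral>y. (\<Sum>i\<in>UNIV. partial_deriv i f (x - y) * u y * h $ i) \<partial>lborel)"
        by (rule Bochner_Integration.integral_sum[symmetric]) (rule i3)
      also have "\<dots> = (\<integral>y. (gradient f (x - y) \<bullet> h) * u y \<partial>lborel)"
        by (intro Bochner_Integration.integral_cong)
          (simp_all add: inner_vec_def gradient_def sum_distrib_right sum_distrib_left mult_ac)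
      finally show ?thesis .
    qed
    have i4: "integrable lborel (\<lambda>y. (gradient f (x - y) \<bullet> h) * u y)"
    proof -
      have "integrable lborel (\<lambda>y. \<Sum>i\<in>UNIV. partial_deriv i f (x - y) * u y * h $ i)"
        by (rule Bochner_Integration.integrable_sum) (rule i3)
      then show ?thesis
        by (simp add: inner_vec_def gradient_def sum_distrib_right sum_distrib_left mult_ac)
    qed
    have "conv f u (x + h) - conv f u x - (\<chi> i. conv (partial_deriv i f) u x) \<bullet> h
       = (\<integral>y. ?rem y * u y \<partial>lborel)"
      unfolding eq using i1 i2 i4 by (simp add: conv_def left_diff_distrib algebra_simps)
    also have "\<bar>\<dots>\<bar> \<le> (\<integral>y. M * (norm h)\<^sup>2 * (indicator (cball 0 R) y * \<bar>u y\<bar>) \<partial>lborel)"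
    proof (rule integral_abs_bound_integral[THEN order_trans, OF _ _ _ order_refl])
      show "integrable lborel (\<lambda>y. ?rem y * u y)"
        using i1 i2 i4 by (simp add: left_diff_distrib)
      show "integrable lborel (\<lambda>y. M * (norm h)\<^sup>2 * (indicator (cball 0 R) y * \<bar>u y\<bar>))"
        using I by simp
      fix y
      show "\<bar>?rem y * u y\<bar> \<le> M * (norm h)\<^sup>2 * (indicator (cball 0 R) y * \<bar>u y\<bar>)"
      proof (cases "R < norm y")
        case True
        then have "r + 1 < norm (x - y)"
          using norm_diff_gt[of x "r + 1" y] by (simp add: R_def)
        moreover have "norm (x - y) \<le> norm (x - y + h) + norm h"
          using norm_triangle_ineq4[of "x - y + h" h] by simp
        ultimately have *: "r < norm (x - y + h)" "r < norm (x - y)" using h by linarith+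
        then have "gradient f (x - y) = 0"
          using partial_deriv_zero_outside[of r f] r(2) by (simp add: gradient_def vec_eq_iff)
        then show ?thesis using * r(2) True by simp
      next
        case False
        then have "y \<in> cball 0 R" by simp
        then show ?thesis
          using mult_right_mono[OF M(2)[of "x - y" h], of "\<bar>u y\<bar>"] by (simp add: abs_mult)
      qed
    qed
    also have "\<dots> = C * (norm h)\<^sup>2"
      by (simp add: C_def)
    finally show "\<bar>conv f u (x + h) - conv f u x - (\<chi> i. conv (partial_deriv i f) u x) \<bullet> h\<bar> \<le> C * (norm h)\<^sup>2" .
  qed
qed

lemma gradient_conv:
  assumes "f \<in> test_functions" "loc_int u"
  shows "gradient (conv f u) x = (\<chi> i. conv (partial_deriv i f) u x)"
  by (rule gradient_eqI[OF conv_has_derivative[OF assms]])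

lemma smooth_conv:
  assumes f: "f \<in> test_functions" and u: "loc_int u"
  shows "smooth (conv f u)"
proof (rule smooth_coinduct[where S="{conv f u |f. f \<in> test_functions}"])
  show "conv f u \<in> {conv f u |f. f \<in> test_functions}" using f by blast
next
  fix g x assume "g \<in> {conv f u |f. f \<in> test_functions}"
  then show "g differentiable at x"
    using conv_has_derivative[OF _ u] by (auto simp: differentiable_def)
next
  fix g i assume "g \<in> {conv f u |f. f \<in> test_functions}"
  then obtain f where f: "g = conv f u" "f \<in> test_functions" by blast
  have "partial_deriv i g x = gradient g x $ i" for x by (simp add: gradient_def)
  then have "partial_deriv i g = conv (partial_deriv i f) u"
    using gradient_conv[OF f(2) u] f(1) by auto
  then show "partial_deriv i g \<in> {conv f u |f. f \<in> test_functions}"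
    using test_function_partial_deriv[OF f(2)] by auto
qed

section \<open>Weak gradients of smooth functions\<close>

lemma test_function_integrable:
  fixes f :: "real ^ 'n \<Rightarrow> real"
  assumes f: "f \<in> test_functions"
  shows "integrable lborel f"
proof -
  obtain r where r: "\<And>x. r < norm x \<Longrightarrow> f x = 0" using test_function_supportE[OF f] by blast
  have "integrable lborel (\<lambda>x. indicator (cball 0 r) x *\<^sub>R f x)"
    by (intro borel_integrable_compact continuous_on_subset[OF smooth_continuous] test_function_smooth f) auto
  also have "(\<lambda>x. indicator (cball 0 r) x *\<^sub>R f x) = f"
    using r by (intro ext) (auto simp: indicator_def not_le)
  finally show ?thesis .
qed

text \<open>Each difference quotient has integral \<open>0\<close> by translation invariance, and it differs from the
  partial derivative by at most a multiple of the step on a fixed ball.\<close>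

lemma integral_partial_deriv:
  fixes f :: "real ^ 'n \<Rightarrow> real"
  assumes f: "f \<in> test_functions"
  shows "(\<integral>x. partial_deriv i f x \<partial>lborel) = 0"
proof -
  obtain M where M: "0 < M" "\<And>x h. \<bar>f (x + h) - f x - gradient f x \<bullet> h\<bar> \<le> M * (norm h)\<^sup>2"
    using test_function_Taylor[OF f] by blast
  obtain r where r: "0 < r" "\<And>x. r < norm x \<Longrightarrow> f x = 0"
    using test_function_supportE[OF f] by blast
  have [measurable]: "f \<in> borel_measurable borel"
    using smooth_measurable[OF test_function_smooth[OF f]] .
  define V where "V = measure lborel (cball (0 :: real ^ 'n) (r + 1))"
  let ?I = "\<integral>x. partial_deriv i f x \<partial>lborel"
  have bound: "\<bar>?I\<bar> \<le> M * V * t" if t: "0 < t" "t \<le> 1" for t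
  proof -
    let ?h = "t *\<^sub>R axis i (1::real)"
    have i1: "integrable lborel (\<lambda>x. f (x + ?h))"
      using lborel_integral_isometry(2)[of f 1 ?h] test_function_integrable[OF f] by (simp add: add.commute)
    have e1: "(\<integral>x. f (x + ?h) \<partial>lborel) = (\<integral>x. f x \<partial>lborel)"
      using lborel_integral_isometry(1)[of f 1 ?h] by (simp add: add.commute)
    note i2 = test_function_integrable[OF f]
    note i3 = test_function_integrable[OF test_function_partial_deriv[OF f, of i]]
    have eq: "t * ?I = - (\<integral>x. f (x + ?h) - f x - t * partial_deriv i f x \<partial>lborel)"
      using i1 i2 i3 e1 by simp
    have "t * \<bar>?I\<bar> = \<bar>t * ?I\<bar>"
      using t by (simp add: abs_mult)
    also have "\<dots> = \<bar>\<integral>x. f (x + ?h) - f x - t * partial_deriv i f x \<partial>lborel\<bar>"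
      by (simp only: eq abs_minus_cancel)
    also have "\<dots> \<le> (\<integral>x. M * t\<^sup>2 * indicator (cball 0 (r + 1)) (x :: real ^ 'n) \<partial>lborel)"
    proof (rule integral_abs_bound_integral[THEN order_trans, OF _ _ _ order_refl])
      show "integrable lborel (\<lambda>x. f (x + ?h) - f x - t * partial_deriv i f x)"
        using i1 i2 i3 by simp
      show "integrable lborel (\<lambda>x :: real ^ 'n. M * t\<^sup>2 * indicator (cball 0 (r + 1)) x :: real)"
        by (intro integrable_mult_right integrable_real_indicator emeasure_lborel_cball_finite) simp
      fix x :: "real ^ 'n"
      show "\<bar>f (x + ?h) - f x - t * partial_deriv i f x\<bar> \<le> M * t\<^sup>2 * indicator (cball 0 (r + 1)) x"
      proof (cases "norm x \<le> r + 1")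
        case True
        then show ?thesis
          using M(2)[of x ?h] t by (simp add: inner_axis gradient_def)
      next
        case False
        moreover have "norm x \<le> norm (x + ?h) + norm ?h"
          using norm_triangle_ineq4[of "x + ?h" ?h] by simp
        ultimately have "r < norm (x + ?h)" "r < norm x" using t by auto
        then show ?thesis
          using r(2) partial_deriv_zero_outside[of r f x] False by simp
      qed
    qed
    also have "\<dots> = t * (M * V * t)"
      by (simp add: V_def power2_eq_square)
    finally show ?thesis using t(1) by simp
  qed
  have "((\<lambda>t. M * V * t) \<longlongrightarrow> 0) (at_right 0)"
    by (auto intro!: tendsto_eq_intros)
  moreover have "eventually (\<lambda>t. \<bar>?I\<bar> \<le> M * V * t) (at_right 0)"
    using bound by (auto simp: eventually_at_right_field intro!: exI[of _ 1])
  ultimately have "\<bar>?I\<bar> \<le> 0"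
    by (intro tendsto_lowerbound[of _ _ "at_right 0"]) auto
  then show ?thesis by simp
qed

lemma locally_integrable_continuous:
  fixes f :: "real ^ 'n \<Rightarrow> 'b::euclidean_space"
  assumes f: "continuous_on UNIV f"
  shows "locally_integrable f"
  unfolding locally_integrable_def set_integrable_def
proof (intro allI impI)
  fix K :: "(real ^ 'n) set" assume "compact K"
  then have "integrable lborel (\<lambda>x. indicator K x *\<^sub>R f x)"
    by (intro borel_integrable_compact continuous_on_subset[OF f]) auto
  then show "integrable lebesgue (\<lambda>x. indicator K x *\<^sub>R f x)"
    by (subst integrable_completion) auto
qed

lemma has_weak_gradient_smooth:
  fixes f :: "real ^ 'n \<Rightarrow> real"
  assumes f: "smooth f"
  shows "has_weak_gradient f (gradient f)"
  unfolding has_weak_gradient_def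
proof (intro conjI ballI allI)
  show "locally_integrable f" "locally_integrable (gradient f)"
    by (intro locally_integrable_continuous smooth_continuous continuous_gradient f)+
  fix \<phi> :: "real ^ 'n \<Rightarrow> real" and i assume \<phi>: "\<phi> \<in> test_functions"
  note [measurable] = smooth_measurable[OF f] smooth_measurable[OF test_function_smooth[OF \<phi>]]
    smooth_measurable[OF smooth_partial_deriv[OF f, of i]]
    smooth_measurable[OF smooth_partial_deriv[OF test_function_smooth[OF \<phi>], of i]]
  have "(\<integral>x. f x * partial_deriv i \<phi> x + partial_deriv i f x * \<phi> x \<partial>lborel)
      = (\<integral>x. partial_deriv i (\<lambda>x. f x * \<phi> x) x \<partial>lborel)"
    by (intro Bochner_Integration.integral_cong refl partial_deriv_mult[symmetric] smooth_differentiable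
        f test_function_smooth[OF \<phi>])
  also have "\<dots> = 0"
    by (intro integral_partial_deriv test_function_mult_left f \<phi>)
  finally have "(\<integral>x. f x * partial_deriv i \<phi> x \<partial>lborel) = - (\<integral>x. partial_deriv i f x * \<phi> x \<partial>lborel)"
    using test_function_integrable[OF test_function_mult_left[OF f test_function_partial_deriv[OF \<phi>]]]
      test_function_integrable[OF test_function_mult_left[OF smooth_partial_deriv[OF f] \<phi>]]
    by (simp add: eq_neg_iff_add_eq_0)
  then show "(\<integral>x. f x * partial_deriv i \<phi> x \<partial>lebesgue) = - (\<integral>x. gradient f x $ i * \<phi> x \<partial>lebesgue)"
    by (simp add: integral_completion gradient_def)
qed

lemma locally_integrable_loc_int:
  fixes u :: "real ^ 'n \<Rightarrow> real"
  assumes [measurable]: "u \<in> borel_measurable borel"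
  assumes "locally_integrable u"
  shows "loc_int u"
  unfolding loc_int_def
proof (intro conjI allI)
  fix r
  have "integrable lebesgue (\<lambda>x. indicator (cball 0 r) x *\<^sub>R u x)"
    using assms(2) by (simp add: locally_integrable_def set_integrable_def)
  moreover have "(\<lambda>x. indicator (cball 0 r) x *\<^sub>R u x) \<in> borel_measurable lborel"
    using assms(1) by (intro borel_measurable_scaleR borel_measurable_indicator) simp_all
  ultimately show "integrable lborel (\<lambda>x. indicator (cball 0 r) x * u x)"
    by (simp add: integrable_completion)
qed fact

lemma measurable_vec_nth [measurable]:
  "(\<lambda>x :: real ^ 'n. x $ i) \<in> borel_measurable borel"
  by (intro borel_measurable_continuous_onI continuous_intros)

lemma locally_integrable_component:
  fixes g :: "real ^ 'n \<Rightarrow> real ^ 'n"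
  assumes "locally_integrable g"
  shows "locally_integrable (\<lambda>x. g x $ i)"
  unfolding locally_integrable_def set_integrable_def
proof (intro allI impI)
  fix K :: "(real ^ 'n) set" assume "compact K"
  then have "integrable lebesgue (\<lambda>x. indicator K x *\<^sub>R g x)"
    using assms by (simp add: locally_integrable_def set_integrable_def)
  from integrable_bounded_linear[OF bounded_linear_vec_nth this, of i]
  show "integrable lebesgue (\<lambda>x. indicator K x *\<^sub>R g x $ i)" by simp
qed

text \<open>The function \<open>y \<mapsto> f (x - y)\<close> is a test function, and its partial derivative is \<open>- partial_deriv i f (x - y)\<close>,
  so the definition of the weak gradient moves the derivative from \<open>f\<close> to \<open>u\<close>.\<close>

lemma gradient_conv_weak:
  fixes u :: "real ^ 'n \<Rightarrow> real"
  assumes g: "has_weak_gradient u g" and f: "f \<in> test_functions"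
    and [measurable]: "u \<in> borel_measurable borel" "g \<in> borel_measurable borel"
  shows "gradient (conv f u) x = (\<chi> i. conv f (\<lambda>y. g y $ i) x)"
proof -
  have u: "loc_int u"
    using g by (intro locally_integrable_loc_int) (auto simp: has_weak_gradient_def)
  note [measurable] = smooth_measurable[OF test_function_smooth[OF f]]
    smooth_measurable[OF smooth_partial_deriv[OF test_function_smooth[OF f]]]
  have "conv (partial_deriv i f) u x = conv f (\<lambda>y. g y $ i) x" for i
  proof -
    let ?f = "\<lambda>y. f (x + (-1) *\<^sub>R y)"
    have f': "?f \<in> test_functions" by (rule test_function_affine[OF f]) simp
    have "partial_deriv i ?f y = - partial_deriv i f (x - y)" for y
      using partial_deriv_affine[of f x "-1" y i] smooth_differentiable[OF test_function_smooth[OF f]]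
      by simp
    moreover have "(\<integral>y. u y * partial_deriv i ?f y \<partial>lebesgue) = - (\<integral>y. g y $ i * ?f y \<partial>lebesgue)"
      using g f' unfolding has_weak_gradient_def by blast
    ultimately have "(\<integral>y. u y * partial_deriv i f (x - y) \<partial>lebesgue) = (\<integral>y. g y $ i * f (x - y) \<partial>lebesgue)"
      by simp
    then show ?thesis
      unfolding conv_def by (subst (asm) (1 2) integral_completion) (simp_all add: mult.commute)
  qed
  then show ?thesis
    by (simp add: gradient_conv[OF f u])
qed

section \<open>Mollifiers\<close>

definition moll :: "nat \<Rightarrow> real ^ 'n \<Rightarrow> real" where
  "moll n x = bump (real (Suc n) *\<^sub>R x) / (\<integral>y. bump (real (Suc n) *\<^sub>R y :: real ^ 'n) \<partial>lborel)"

lemma moll_bump_test: "(\<lambda>x. bump (real (Suc n) *\<^sub>R x) :: real) \<in> test_functions"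
  using test_function_affine[OF test_function_bump, of "real (Suc n)" 0] by simp

lemma moll_integral_pos: "0 < (\<integral>y. bump (real (Suc n) *\<^sub>R y :: real ^ 'n) \<partial>lborel)"
proof -
  let ?b = "\<lambda>y :: real ^ 'n. bump (real (Suc n) *\<^sub>R y)"
  have "(\<integral>y. ?b y \<partial>lborel) \<noteq> 0"
  proof
    assume "(\<integral>y. ?b y \<partial>lborel) = 0"
    then have "AE y in lborel. ?b y = 0"
      using integral_nonneg_eq_0_iff_AE[OF test_function_integrable[OF moll_bump_test]] bump_nonneg by auto
    then have "AE y in lborel. y \<in> {y. 1 \<le> norm (real (Suc n) *\<^sub>R y :: real ^ 'n)}"
      by (simp add: bump_eq_0_iff)
    moreover have "closed {y. 1 \<le> norm (real (Suc n) *\<^sub>R y :: real ^ 'n)}"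
      by (intro closed_Collect_le continuous_intros)
    ultimately have "(0 :: real ^ 'n) \<in> {y. 1 \<le> norm (real (Suc n) *\<^sub>R y :: real ^ 'n)}"
      by (intro mem_closed_if_AE_lebesgue AE_completion)
    then show False by simp
  qed
  moreover have "0 \<le> (\<integral>y. ?b y \<partial>lborel)"
    by (intro Bochner_Integration.integral_nonneg bump_nonneg)
  ultimately show ?thesis by linarith
qed

lemma moll_test: "moll n \<in> test_functions"
  using test_function_scale[OF moll_bump_test, of "1 / (\<integral>y. bump (real (Suc n) *\<^sub>R y :: real ^ 'n) \<partial>lborel)" n]
  by (simp add: moll_def[abs_def])

lemma moll_nonneg: "0 \<le> moll n x"
  using moll_integral_pos[of n] by (simp add: moll_def bump_nonneg)

lemma moll_integral: "(\<integral>x. moll n (x :: real ^ 'n) \<partial>lborel) = 1"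
  using moll_integral_pos[of n, where 'n='n] by (simp add: moll_def)

lemma moll_zero: "1 / real (Suc n) \<le> norm x \<Longrightarrow> moll n x = 0"
  unfolding moll_def by (subst bump_eq_0_iff[THEN iffD2]) (simp_all add: field_simps del: of_nat_Suc)

lemma moll_measurable [measurable]: "moll n \<in> borel_measurable borel"
  using smooth_measurable[OF test_function_smooth[OF moll_test]] .

lemma moll_translate:
  "integrable lborel (\<lambda>y. moll n (x - y))" "(\<integral>y. moll n (x - y) \<partial>lborel) = 1"
  using lborel_integral_isometry[of "moll n" "-1" x] test_function_integrable[OF moll_test[of n]]
  by (simp_all add: moll_integral)

lemma moll_nn_integral: "(\<integral>\<^sup>+x. ennreal (moll n (x :: real ^ 'n)) \<partial>lborel) = 1"
  using nn_integral_eq_integral[OF test_function_integrable[OF moll_test[of n]]]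
  by (simp add: moll_nonneg moll_integral)

lemma ball_borel [measurable]: "ball a r \<in> sets borel" "cball a r \<in> sets borel"
  by auto

section \<open>Jensen's inequality for averages\<close>

text \<open>The tangent to the convex function \<open>t powr p\<close> at \<open>a\<close> lies below it. This is Young's inequality for
  the product of \<open>t\<close> and \<open>a powr (p - 1)\<close> with the conjugate exponents \<open>p\<close> and \<open>p / (p - 1)\<close>.\<close>

lemma powr_above_tangent:
  fixes t a p :: real
  assumes "1 \<le> p" "0 \<le> t" "0 \<le> a"
  shows "a powr p + p * a powr (p - 1) * (t - a) \<le> t powr p"
proof (cases "p = 1 \<or> a = 0")
  case True
  then show ?thesis using assms by (cases "a = 0") auto
next
  case False
  then have p: "1 < p" and a: "0 < a" using assms by auto
  let ?q = "p / (p - 1)"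
  have "t * a powr (p - 1) \<le> t powr p / p + (a powr (p - 1)) powr ?q / ?q"
    by (rule Youngs_inequality) (use p assms in \<open>auto simp: field_simps\<close>)
  also have "(a powr (p - 1)) powr ?q = a powr p"
    using p by (simp add: powr_powr)
  finally have "p * (t * a powr (p - 1)) \<le> p * (t powr p / p + a powr p / ?q)"
    using p by (intro mult_left_mono) auto
  also have "\<dots> = t powr p + (p - 1) * a powr p"
    using p by (simp add: field_simps)
  moreover have "a powr (p - 1) * a = a powr p"
    using a powr_mult_base[of a "p - 1"] by (simp add: mult.commute)
  ultimately show ?thesis
    by (simp add: algebra_simps)
qed

text \<open>The average of \<open>\<bar>f\<bar>\<close> against the density \<open>\<phi>\<close> serves as the base point of the tangent; the linear
  term of the tangent then averages to \<open>0\<close>.\<close>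

lemma Jensen_powr:
  fixes \<phi> f :: "real ^ 'n \<Rightarrow> real"
  assumes [measurable]: "\<phi> \<in> borel_measurable borel" "f \<in> borel_measurable borel"
    and nonneg: "\<And>x. 0 \<le> \<phi> x" and one: "(\<integral>\<^sup>+x. ennreal (\<phi> x) \<partial>lborel) = 1"
    and int: "integrable lborel (\<lambda>x. \<phi> x * f x)" and p: "1 \<le> p"
  shows "ennreal (\<bar>\<integral>x. \<phi> x * f x \<partial>lborel\<bar> powr p)
    \<le> (\<integral>\<^sup>+x. ennreal (\<phi> x) * ennreal (\<bar>f x\<bar> powr p) \<partial>lborel)" (is "_ \<le> ?R")
proof (cases "?R = \<infinity>")
  case False
  have i\<phi>: "integrable lborel \<phi>"
    using one nonneg by (intro integrableI_nonneg) auto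
  have one': "(\<integral>x. \<phi> x \<partial>lborel) = 1"
    using one nonneg by (simp add: integral_eq_nn_integral)
  have ia: "integrable lborel (\<lambda>x. \<phi> x * \<bar>f x\<bar>)"
    using integrable_abs[OF int] nonneg by (simp add: abs_mult)
  have R: "?R = (\<integral>\<^sup>+x. ennreal (\<phi> x * \<bar>f x\<bar> powr p) \<partial>lborel)"
    using nonneg by (simp add: ennreal_mult)
  have ip: "integrable lborel (\<lambda>x. \<phi> x * \<bar>f x\<bar> powr p)"
    using False nonneg by (intro integrableI_nonneg) (auto simp: R[symmetric] less_top)
  define a where "a = (\<integral>x. \<phi> x * \<bar>f x\<bar> \<partial>lborel)"
  have a0: "0 \<le> a"
    unfolding a_def using nonneg by (intro Bochner_Integration.integral_nonneg) auto
  have "a powr p = (\<integral>x. \<phi> x * (a powr p + p * a powr (p - 1) * (\<bar>f x\<bar> - a)) \<partial>lborel)"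
  proof -
    have "(\<integral>x. \<phi> x * (a powr p + p * a powr (p - 1) * (\<bar>f x\<bar> - a)) \<partial>lborel)
        = (\<integral>x. (a powr p - p * a powr (p - 1) * a) * \<phi> x + p * a powr (p - 1) * (\<phi> x * \<bar>f x\<bar>) \<partial>lborel)"
      by (intro Bochner_Integration.integral_cong) (auto simp: algebra_simps)
    also have "\<dots> = (a powr p - p * a powr (p - 1) * a) + p * a powr (p - 1) * a"
      using i\<phi> ia by (simp add: one' a_def[symmetric])
    finally show ?thesis by simp
  qed
  also have "\<dots> \<le> (\<integral>x. \<phi> x * \<bar>f x\<bar> powr p \<partial>lborel)"
  proof (rule integral_mono)
    have "integrable lborel (\<lambda>x. (a powr p - p * a powr (p - 1) * a) * \<phi> x + p * a powr (p - 1) * (\<phi> x * \<bar>f x\<bar>))"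
      using i\<phi> ia by simp
    then show "integrable lborel (\<lambda>x. \<phi> x * (a powr p + p * a powr (p - 1) * (\<bar>f x\<bar> - a)))"
      by (rule Bochner_Integration.integrable_cong[THEN iffD1, rotated 2]) (auto simp: algebra_simps)
    show "\<phi> x * (a powr p + p * a powr (p - 1) * (\<bar>f x\<bar> - a)) \<le> \<phi> x * \<bar>f x\<bar> powr p" for x
      using nonneg p a0 by (intro mult_left_mono powr_above_tangent) auto
  qed (rule ip)
  finally have *: "a powr p \<le> (\<integral>x. \<phi> x * \<bar>f x\<bar> powr p \<partial>lborel)" .
  have "\<bar>\<integral>x. \<phi> x * f x \<partial>lborel\<bar> \<le> a"
    unfolding a_def using nonneg by (intro integral_abs_bound_integral int ia) (simp add: abs_mult)
  then have "\<bar>\<integral>x. \<phi> x * f x \<partial>lborel\<bar> powr p \<le> a powr p"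
    using p by (intro powr_mono2) auto
  also note *
  finally have "ennreal (\<bar>\<integral>x. \<phi> x * f x \<partial>lborel\<bar> powr p) \<le> ennreal (\<integral>x. \<phi> x * \<bar>f x\<bar> powr p \<partial>lborel)"
    by (rule ennreal_leI)
  also have "\<dots> = ?R"
    unfolding R using nonneg ip by (intro nn_integral_eq_integral[symmetric]) auto
  finally show ?thesis .
qed simp

text \<open>For the square Jensen's inequality is the Cauchy-Schwarz inequality for \<open>sqrt \<phi>\<close> and \<open>sqrt \<phi> * F\<close>.
  In this form \<open>F\<close> may take the value \<open>\<infinity>\<close>, as potentials do.\<close>

lemma Jensen_square:
  fixes \<phi> :: "real ^ 'n \<Rightarrow> real" and F :: "real ^ 'n \<Rightarrow> ennreal"
  assumes [measurable]: "\<phi> \<in> borel_measurable borel" "F \<in> borel_measurable borel"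
    and nonneg: "\<And>x. 0 \<le> \<phi> x" and one: "(\<integral>\<^sup>+x. ennreal (\<phi> x) \<partial>lborel) = 1"
  shows "(\<integral>\<^sup>+x. ennreal (\<phi> x) * F x \<partial>lborel)\<^sup>2 \<le> (\<integral>\<^sup>+x. ennreal (\<phi> x) * (F x)\<^sup>2 \<partial>lborel)"
proof -
  have sq: "ennreal (sqrt (\<phi> x)) * ennreal (sqrt (\<phi> x)) = ennreal (\<phi> x)" for x
    using nonneg[of x] by (simp add: ennreal_mult[symmetric])
  have "(\<integral>\<^sup>+x. ennreal (\<phi> x) * F x \<partial>lborel)\<^sup>2
     = (\<integral>\<^sup>+x. ennreal (sqrt (\<phi> x)) * (ennreal (sqrt (\<phi> x)) * F x) \<partial>lborel)\<^sup>2"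
    by (simp only: mult.assoc[symmetric] sq)
  also have "\<dots> \<le> (\<integral>\<^sup>+x. (ennreal (sqrt (\<phi> x)))\<^sup>2 \<partial>lborel)
      * (\<integral>\<^sup>+x. (ennreal (sqrt (\<phi> x)) * F x)\<^sup>2 \<partial>lborel)"
    by (rule Cauchy_Schwarz_nn_integral) auto
  also have "\<dots> = (\<integral>\<^sup>+x. ennreal (\<phi> x) * (F x)\<^sup>2 \<partial>lborel)"
    by (simp only: power_mult_distrib power2_eq_square[of "ennreal (sqrt _)"] sq one mult_1_left)
  finally show ?thesis .
qed

section \<open>Pointwise mollification of continuous functions\<close>

lemma loc_int_continuous:
  fixes h :: "real ^ 'n \<Rightarrow> real"
  shows "continuous_on UNIV h \<Longrightarrow> loc_int h"
  by (intro locally_integrable_loc_int locally_integrable_continuous borel_measurable_continuous_onI)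

lemma conv_moll_tendsto:
  fixes h :: "real ^ 'n \<Rightarrow> real"
  assumes h: "continuous_on UNIV h"
  shows "(\<lambda>n. conv (moll n) h x) \<longlonglongrightarrow> h x"
proof (rule LIMSEQ_I)
  fix e :: real assume e: "0 < e"
  then obtain d where d: "0 < d" "\<And>y. norm (y - x) < d \<Longrightarrow> \<bar>h y - h x\<bar> < e / 2"
    using h unfolding continuous_on_iff dist_norm real_norm_def by (metis UNIV_I half_gt_zero)
  obtain n0 where n0: "1 / real (Suc n0) < d" using d(1) nat_approx_posE by blast
  have "\<bar>conv (moll n) h x - h x\<bar> < e" if "n0 \<le> n" for n
  proof -
    have nd: "1 / real (Suc n) < d"
      using that n0 by (meson frac_le le_less_trans nat_le_real_less of_nat_0_less_iff of_nat_mono Suc_le_mono zero_le_one order_refl zero_less_Suc)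
    have i1: "integrable lborel (\<lambda>y. moll n (x - y) * h y)"
      by (rule conv_integrable[OF moll_test loc_int_continuous[OF h]])
    note i0 = moll_translate(1)[of n x] and e0 = moll_translate(2)[of n x]
    have "conv (moll n) h x - h x = (\<integral>y. moll n (x - y) * (h y - h x) \<partial>lborel)"
      using i1 i0 e0 by (simp add: conv_def right_diff_distrib)
    also have "\<bar>\<dots>\<bar> \<le> (\<integral>y. e / 2 * moll n (x - y) \<partial>lborel)"
    proof (rule integral_abs_bound_integral[THEN order_trans, OF _ _ _ order_refl])
      show "integrable lborel (\<lambda>y. moll n (x - y) * (h y - h x))"
        using i1 i0 by (simp add: right_diff_distrib)
      show "integrable lborel (\<lambda>y. e / 2 * moll n (x - y))" using i0 by simp
      fix y
      show "\<bar>moll n (x - y) * (h y - h x)\<bar> \<le> e / 2 * moll n (x - y)"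
      proof (cases "norm (x - y) < 1 / real (Suc n)")
        case True
        then have "\<bar>h y - h x\<bar> < e / 2" using d(2)[of y] nd by (simp add: norm_minus_commute)
        then show ?thesis
          using mult_left_mono[of "\<bar>h y - h x\<bar>" "e / 2" "moll n (x - y)"] moll_nonneg[of n "x - y"]
          by (simp add: abs_mult mult.commute)
      next
        case False
        then show ?thesis by (simp add: moll_zero del: of_nat_Suc)
      qed
    qed
    also have "\<dots> = e / 2" using e0 by simp
    finally show ?thesis using e by simp
  qed
  then show "\<exists>n0. \<forall>n\<ge>n0. norm (conv (moll n) h x - h x) < e" by auto
qed

lemma conv_moll_bound:
  fixes h :: "real ^ 'n \<Rightarrow> real"
  assumes h: "loc_int h" and B: "\<And>x. \<bar>h x\<bar> \<le> B"
  shows "\<bar>conv (moll n) h x\<bar> \<le> B"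
proof -
  have i1: "integrable lborel (\<lambda>y. moll n (x - y) * h y)"
    by (rule conv_integrable[OF moll_test h])
  note i0 = moll_translate(1)[of n x] and e0 = moll_translate(2)[of n x]
  have "\<bar>conv (moll n) h x\<bar> \<le> (\<integral>y. B * moll n (x - y) \<partial>lborel)"
    unfolding conv_def
  proof (rule integral_abs_bound_integral)
    show "integrable lborel (\<lambda>y. B * moll n (x - y))" using i0 by simp
    show "\<bar>moll n (x - y) * h y\<bar> \<le> B * moll n (x - y)" for y
      using mult_left_mono[OF B[of y] moll_nonneg[of n "x - y"]] by (simp add: abs_mult moll_nonneg mult.commute)
  qed (rule i1)
  then show ?thesis using e0 by simp
qed

lemma conv_moll_support:
  fixes h :: "real ^ 'n \<Rightarrow> real"
  assumes "\<And>x. r < norm x \<Longrightarrow> h x = 0" "r + 1 < norm x"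
  shows "conv (moll n) h x = 0"
proof -
  have "moll n (x - y) * h y = 0" for y
  proof (cases "r < norm y")
    case False
    have "norm x \<le> norm (x - y) + norm y" using norm_triangle_ineq[of "x - y" y] by simp
    then have "1 \<le> norm (x - y)" using assms(2) False by linarith
    moreover have "1 / real (Suc n) \<le> 1" by simp
    ultimately have "moll n (x - y) = 0" by (intro moll_zero) linarith
    then show ?thesis by simp
  qed (use assms in simp)
  then have "(\<lambda>y. moll n (x - y) * h y) = (\<lambda>y. 0)" by blast
  then show ?thesis by (simp only: conv_def Bochner_Integration.integral_zero)
qed

section \<open>Functionals that are continuous under mollification\<close>

lemma tendsto_0E:
  fixes X :: "nat \<Rightarrow> ennreal"
  assumes "X \<longlonglongrightarrow> 0" "0 < e"
  obtains n where "X n < ennreal e"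
proof -
  have "eventually (\<lambda>n. X n < ennreal e) sequentially"
    using assms by (intro order_tendstoD(2)) auto
  then show ?thesis using that by (auto simp: eventually_sequentially)
qed

lemma tendsto_0I_ennreal:
  fixes X :: "'a \<Rightarrow> ennreal"
  assumes "\<And>e. 0 < e \<Longrightarrow> eventually (\<lambda>n. X n < ennreal e) F"
  shows "(X \<longlongrightarrow> 0) F"
proof (rule order_tendstoI)
  fix a :: ennreal assume a: "0 < a"
  obtain e where e: "0 < e" "ennreal e \<le> a"
  proof (cases a)
    case (real r)
    then show ?thesis using that[of r] a by simp
  next
    case top
    then show ?thesis using that[of 1] by simp
  qed
  from assms[OF e(1)] show "eventually (\<lambda>n. X n < a) F"
    by eventually_elim (use e(2) less_le_trans in blast)
qed simp

text \<open>The integral of \<open>\<bar>f\<bar> powr p\<close> and the Coulomb energy need not be norms, but they share the following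
  properties, and these are all that convergence of mollifications depends on.\<close>

locale mollifiable =
  fixes Q :: "(real ^ 'n \<Rightarrow> real) \<Rightarrow> ennreal" and C :: real
  assumes C_ge_1: "1 \<le> C"
    and quasi_add: "\<And>f g. f \<in> borel_measurable borel \<Longrightarrow> g \<in> borel_measurable borel \<Longrightarrow>
      Q (\<lambda>x. f x + g x) \<le> ennreal C * (Q f + Q g)"
    and Q_minus: "\<And>f. Q (\<lambda>x. - f x) = Q f"
    and contraction: "\<And>f n. loc_int f \<Longrightarrow> Q (conv (moll n) f) \<le> Q f"
    and dominated: "\<And>f F. (\<And>n::nat. f n \<in> borel_measurable borel) \<Longrightarrow> F \<in> borel_measurable borel \<Longrightarrow>
      (\<And>n x. \<bar>f n x\<bar> \<le> \<bar>F x\<bar>) \<Longrightarrow> AE x in lborel. (\<lambda>n. f n x) \<longlonglongrightarrow> 0 \<Longrightarrow> Q F < \<infinity> \<Longrightarrow>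
      (\<lambda>n. Q (f n)) \<longlonglongrightarrow> 0"
    and Q_ball: "\<And>c r. Q (\<lambda>x. c * indicator (cball 0 r) x) < \<infinity>"
begin

lemma C_pos: "0 < C"
  using C_ge_1 by simp

lemma quasi_add_less:
  assumes "f \<in> borel_measurable borel" "g \<in> borel_measurable borel"
    and "Q f < ennreal (e / (2 * C))" "Q g < ennreal (e / (2 * C))" "0 < e"
  shows "Q (\<lambda>x. f x + g x) < ennreal e"
proof -
  have "Q f + Q g < ennreal (e / (2 * C)) + ennreal (e / (2 * C))"
    using assms by (intro add_strict_mono)
  also have "\<dots> = ennreal (e / C)"
    using assms C_pos by (simp add: ennreal_plus[symmetric] del: ennreal_plus)
  finally have "ennreal C * (Q f + Q g) < ennreal C * ennreal (e / C)"
    using C_pos by (intro ennreal_mult_strict_left_mono) auto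
  also have "\<dots> = ennreal e"
    using C_pos assms by (simp add: ennreal_mult[symmetric])
  finally show ?thesis
    using quasi_add[OF assms(1,2)] by (rule le_less_trans[rotated])
qed

lemma truncation_approx:
  assumes [measurable]: "f \<in> borel_measurable borel" and fin: "Q f < \<infinity>" and "0 < e"
  obtains k :: nat where "Q (\<lambda>x. f x - (if \<bar>f x\<bar> \<le> real k \<and> norm x \<le> real k then f x else 0)) < ennreal e"
proof -
  let ?g = "\<lambda>(k::nat) x. f x - (if \<bar>f x\<bar> \<le> real k \<and> norm x \<le> real k then f x else 0)"
  have "(\<lambda>k. Q (?g k)) \<longlonglongrightarrow> 0"
  proof (rule dominated[OF _ _ _ _ fin])
    have "(\<lambda>k. ?g k x) \<longlonglongrightarrow> 0" for x
    proof (rule tendsto_eventually)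
      obtain K :: nat where "max \<bar>f x\<bar> (norm x) \<le> real K" using real_arch_simple by blast
      then show "eventually (\<lambda>k. ?g k x = 0) sequentially"
        by (auto simp: eventually_sequentially intro!: exI[of _ K])
    qed
    then show "AE x in lborel. (\<lambda>k. ?g k x) \<longlonglongrightarrow> 0" by simp
  qed auto
  then obtain k where "Q (?g k) < ennreal e"
    using \<open>0 < e\<close> by (rule tendsto_0E)
  then show ?thesis by (rule that)
qed

text \<open>A measurable function is an almost everywhere limit of continuous functions. Clamping these to
  \<open>[-k, k]\<close> and multiplying them by a piecewise linear function of the norm does not affect the limit
  and provides a common bound supported in a ball.\<close>

lemma continuous_approx_bounded:
  assumes [measurable]: "f \<in> borel_measurable borel"
    and bd: "\<And>x. \<bar>f x\<bar> \<le> k" and supp: "\<And>x. k < norm x \<Longrightarrow> f x = 0" and "0 < e"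
  obtains h where "continuous_on UNIV h" "\<And>x. k + 1 < norm x \<Longrightarrow> h x = 0" "\<And>x. \<bar>h x\<bar> \<le> k"
    "Q (\<lambda>x. f x - h x) < ennreal e"
proof -
  have k0: "0 \<le> k" using bd[of 0] by linarith
  have "f measurable_on UNIV"
    by (intro lebesgue_measurable_imp_measurable_on) (auto intro: measurable_completion)
  then obtain N g where N: "negligible N" and g: "\<And>n. continuous_on UNIV (g n)"
      and lim: "\<And>x. x \<notin> N \<Longrightarrow> (\<lambda>n. g n x) \<longlonglongrightarrow> f x"
    unfolding measurable_on_def by auto
  define cut :: "real ^ 'n \<Rightarrow> real" where "cut x = max 0 (min 1 (k + 1 - norm x))" for x
  define h where "h n x = max (- k) (min k (g n x)) * cut x" for n :: nat and x
  have hc: "continuous_on UNIV (h n)" for n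
    unfolding h_def cut_def by (intro continuous_intros g)
  have cut01: "0 \<le> cut x" "cut x \<le> 1" for x by (auto simp: cut_def)
  have hb: "\<bar>h n x\<bar> \<le> k" for n x
  proof -
    have "\<bar>h n x\<bar> = \<bar>max (- k) (min k (g n x))\<bar> * cut x" using cut01 by (simp add: h_def abs_mult)
    also have "\<dots> \<le> k * 1" using cut01 k0 by (intro mult_mono) auto
    finally show ?thesis by simp
  qed
  have hs: "h n x = 0" if "k + 1 < norm x" for n x
    using that by (simp add: h_def cut_def)
  have "(\<lambda>n. Q (\<lambda>x. f x - h n x)) \<longlonglongrightarrow> 0"
  proof (rule dominated)
    show "(\<lambda>x. f x - h n x) \<in> borel_measurable borel" for n
      using borel_measurable_continuous_onI[OF hc] by measurable
    show "(\<lambda>x. 2 * k * indicator (cball 0 (k + 1)) x) \<in> borel_measurable borel"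
      by (intro borel_measurable_times borel_measurable_indicator) auto
    show "\<bar>f x - h n x\<bar> \<le> \<bar>2 * k * indicator (cball 0 (k + 1)) x\<bar>" for n x
    proof (cases "k + 1 < norm x")
      case True
      then show ?thesis using hs supp[of x] by simp
    next
      case False
      then show ?thesis using hb[of n x] bd[of x] k0 by (simp add: abs_le_iff)
    qed
    have "(\<lambda>n. f x - h n x) \<longlonglongrightarrow> 0" if "x \<notin> N" for x
    proof -
      have "(\<lambda>n. f x - h n x) \<longlonglongrightarrow> f x - max (- k) (min k (f x)) * cut x"
        unfolding h_def by (intro tendsto_intros lim that)
      also have "max (- k) (min k (f x)) = f x" using bd[of x] by (simp add: abs_le_iff)
      also have "f x * cut x = f x"
        using supp[of x] by (cases "k < norm x") (auto simp: cut_def)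
      finally show ?thesis by simp
    qed
    moreover have "AE x in lborel. x \<notin> N"
      using N by (metis AE_completion_iff AE_not_in negligible_iff_null_sets)
    ultimately show "AE x in lborel. (\<lambda>n. f x - h n x) \<longlonglongrightarrow> 0"
      by (auto elim: eventually_mono)
    show "Q (\<lambda>x. 2 * k * indicator (cball 0 (k + 1)) x) < \<infinity>" by (rule Q_ball)
  qed
  then obtain n where "Q (\<lambda>x. f x - h n x) < ennreal e"
    using \<open>0 < e\<close> by (rule tendsto_0E)
  with hc hs hb show ?thesis by (rule that)
qed

lemma continuous_approx:
  assumes [measurable]: "f \<in> borel_measurable borel" and fin: "Q f < \<infinity>" and e: "0 < e"
  obtains h r B where "continuous_on UNIV h" "\<And>x. r < norm x \<Longrightarrow> h x = 0" "\<And>x. \<bar>h x\<bar> \<le> B"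
    "Q (\<lambda>x. f x - h x) < ennreal e"
proof -
  have e': "0 < e / (2 * C)" using e C_pos by simp
  obtain k :: nat where k: "Q (\<lambda>x. f x - (if \<bar>f x\<bar> \<le> real k \<and> norm x \<le> real k then f x else 0)) < ennreal (e / (2 * C))"
    using truncation_approx[OF assms(1) fin e'] by blast
  define f' where "f' x = (if \<bar>f x\<bar> \<le> real k \<and> norm x \<le> real k then f x else 0)" for x
  have [measurable]: "f' \<in> borel_measurable borel" unfolding f'_def by measurable
  obtain h where h: "continuous_on UNIV h" "\<And>x. real k + 1 < norm x \<Longrightarrow> h x = 0" "\<And>x. \<bar>h x\<bar> \<le> real k"
    "Q (\<lambda>x. f' x - h x) < ennreal (e / (2 * C))"
    by (rule continuous_approx_bounded[of f' "real k", OF _ _ _ e']) (auto simp: f'_def)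
  have [measurable]: "h \<in> borel_measurable borel" using h(1) by (rule borel_measurable_continuous_onI)
  have "Q (\<lambda>x. (f x - f' x) + (f' x - h x)) < ennreal e"
    by (rule quasi_add_less) (use k h(4) e in \<open>simp_all add: f'_def\<close>)
  then show ?thesis using that[OF h(1-3)] by simp
qed

text \<open>Here the convergence is pointwise, and all mollifications are bounded by the same multiple of the
  indicator of a ball.\<close>

lemma mollification_continuous:
  assumes h: "continuous_on UNIV h" and r: "\<And>x. r < norm x \<Longrightarrow> h x = 0" and B: "\<And>x. \<bar>h x\<bar> \<le> B"
  shows "(\<lambda>n. Q (\<lambda>x. conv (moll n) h x - h x)) \<longlonglongrightarrow> 0"
proof (rule dominated)
  have [measurable]: "h \<in> borel_measurable borel" using h by (rule borel_measurable_continuous_onI)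
  note hl = loc_int_continuous[OF h]
  have [measurable]: "conv (moll n) h \<in> borel_measurable borel" for n
    by (intro smooth_measurable smooth_conv moll_test hl)
  show "(\<lambda>x. conv (moll n) h x - h x) \<in> borel_measurable borel" for n by measurable
  show "(\<lambda>x. 2 * B * indicator (cball 0 (r + 1)) x) \<in> borel_measurable borel"
    by (intro borel_measurable_times borel_measurable_indicator) auto
  show "\<bar>conv (moll n) h x - h x\<bar> \<le> \<bar>2 * B * indicator (cball 0 (r + 1)) x\<bar>" for n x
  proof (cases "r + 1 < norm x")
    case True
    then show ?thesis using conv_moll_support[OF r True] r[of x] by simp
  next
    case False
    then show ?thesis using conv_moll_bound[OF hl B, of n x] B[of x] by (simp add: abs_le_iff)
  qed
  show "AE x in lborel. (\<lambda>n. conv (moll n) h x - h x) \<longlonglongrightarrow> 0"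
    using conv_moll_tendsto[OF h] LIM_zero by blast
qed (rule Q_ball)

text \<open>With a continuous \<open>h\<close> close to \<open>f\<close>, the difference between \<open>f\<close> and its mollification splits into
  the mollification of \<open>f - h\<close>, which is no larger than \<open>f - h\<close>, the same difference for \<open>h\<close>, and
  \<open>h - f\<close>.\<close>

theorem mollification_tendsto:
  assumes f: "loc_int f" and fin: "Q f < \<infinity>"
  shows "(\<lambda>n. Q (\<lambda>x. conv (moll n) f x - f x)) \<longlonglongrightarrow> 0"
proof (rule tendsto_0I_ennreal)
  fix e :: real assume e: "0 < e"
  \<comment> \<open>The quasi-triangle inequality is used twice, and each use costs a factor \<open>2 * C\<close>.\<close>
  define e1 where "e1 = e / (2 * C)"
  define e2 where "e2 = e1 / (2 * C)"
  have e1: "0 < e1" and e2: "0 < e2" using e C_pos by (simp_all add: e1_def e2_def)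
  have "e2 \<le> e1" using e1 C_ge_1 by (simp add: e2_def field_simps)
  have [measurable]: "f \<in> borel_measurable borel" using f by (rule loc_int_measurable)
  obtain h r B where h: "continuous_on UNIV h" and r: "\<And>x. r < norm x \<Longrightarrow> h x = 0"
    and B: "\<And>x. \<bar>h x\<bar> \<le> B" and Qh: "Q (\<lambda>x. f x - h x) < ennreal e2"
    by (rule continuous_approx[OF _ fin e2]) auto
  have hl: "loc_int h" by (rule loc_int_continuous[OF h])
  have [measurable]: "h \<in> borel_measurable borel" using hl by (rule loc_int_measurable)
  let ?g = "\<lambda>x. f x - h x"
  have gl: "loc_int ?g"
    using f hl by (simp add: loc_int_def right_diff_distrib)
  have "eventually (\<lambda>n. Q (\<lambda>x. conv (moll n) h x - h x) < ennreal e2) sequentially"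
    using e2 by (intro order_tendstoD(2)[OF mollification_continuous[OF h r B]]) auto
  then show "eventually (\<lambda>n. Q (\<lambda>x. conv (moll n) f x - f x) < ennreal e) sequentially"
  proof eventually_elim
    case (elim n)
    note [measurable] = smooth_measurable[OF smooth_conv[OF moll_test[of n] hl]]
      smooth_measurable[OF smooth_conv[OF moll_test[of n] gl]]
    have lin: "conv (moll n) f x = conv (moll n) ?g x + conv (moll n) h x" for x
      using conv_integrable[OF moll_test[of n] f, of x] conv_integrable[OF moll_test[of n] hl, of x]
      by (simp add: conv_def right_diff_distrib)
    have "Q (\<lambda>x. (conv (moll n) h x - h x) + (- ?g x)) < ennreal e1"
      by (rule quasi_add_less) (use elim Qh e1 in \<open>simp_all add: e2_def Q_minus del: minus_diff_eq\<close>)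
    moreover have "Q (conv (moll n) ?g) < ennreal e1"
      using contraction[OF gl] Qh \<open>e2 \<le> e1\<close> by (meson ennreal_leI le_less_trans less_le_trans)
    ultimately have "Q (\<lambda>x. conv (moll n) ?g x + ((conv (moll n) h x - h x) + (- ?g x))) < ennreal e"
      using e by - (rule quasi_add_less, simp_all add: e1_def)
    also have "(\<lambda>x. conv (moll n) ?g x + ((conv (moll n) h x - h x) + (- ?g x))) = (\<lambda>x. conv (moll n) f x - f x)"
      by (simp add: lin algebra_simps)
    finally show ?case .
  qed
qed

end

section \<open>Instances: Lebesgue norms and kernel energies\<close>

text \<open>A convolution whose second factor takes values in \<open>[0, \<infinity>]\<close>, so that convolutions can be iterated
  without asking whether they are finite.\<close>

definition nnconv :: "(real ^ 'n \<Rightarrow> real) \<Rightarrow> (real ^ 'n \<Rightarrow> ennreal) \<Rightarrow> real ^ 'n \<Rightarrow> ennreal" where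
  "nnconv k F x = (\<integral>\<^sup>+y. ennreal (k (x - y)) * F y \<partial>lborel)"

lemma nnconv_measurable [measurable]:
  fixes k :: "real ^ 'n \<Rightarrow> real"
  assumes [measurable]: "k \<in> borel_measurable borel" "F \<in> borel_measurable borel"
  shows "nnconv k F \<in> borel_measurable borel"
  unfolding nnconv_def[abs_def] by measurable

lemma nn_integral_nnconv:
  fixes k :: "real ^ 'n \<Rightarrow> real"
  assumes [measurable]: "k \<in> borel_measurable borel" "F \<in> borel_measurable borel"
  shows "(\<integral>\<^sup>+x. nnconv k F x \<partial>lborel) = (\<integral>\<^sup>+x. ennreal (k x) \<partial>lborel) * (\<integral>\<^sup>+x. F x \<partial>lborel)"
proof -
  have "(\<integral>\<^sup>+x. nnconv k F x \<partial>lborel) = (\<integral>\<^sup>+y. (\<integral>\<^sup>+x. ennreal (k (x - y)) * F y \<partial>lborel) \<partial>lborel)"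
    unfolding nnconv_def by (rule lborel_pair.Fubini'[symmetric]) measurable
  also have "\<dots> = (\<integral>\<^sup>+y. (\<integral>\<^sup>+x. ennreal (k x) \<partial>lborel) * F y \<partial>lborel)"
    using nn_integral_lborel_translate[of "\<lambda>x. ennreal (k x)"] by (simp add: nn_integral_multc)
  also have "\<dots> = (\<integral>\<^sup>+x. ennreal (k x) \<partial>lborel) * (\<integral>\<^sup>+x. F x \<partial>lborel)"
    by (simp add: nn_integral_cmult)
  finally show ?thesis .
qed

text \<open>After an exchange of the integrals the two sides differ by the substitution \<open>y \<mapsto> x + z - y\<close>.\<close>

lemma nnconv_commute:
  fixes k l :: "real ^ 'n \<Rightarrow> real"
  assumes [measurable]: "k \<in> borel_measurable borel" "l \<in> borel_measurable borel" "F \<in> borel_measurable borel"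
  shows "nnconv k (nnconv l F) x = nnconv l (nnconv k F) x"
proof -
  have *: "nnconv k (nnconv l F) x
      = (\<integral>\<^sup>+z. (\<integral>\<^sup>+y. ennreal (k (x - y)) * ennreal (l (y - z)) \<partial>lborel) * F z \<partial>lborel)"
    if [measurable]: "k \<in> borel_measurable borel" "l \<in> borel_measurable borel"
    for k l :: "real ^ 'n \<Rightarrow> real"
  proof -
    have "nnconv k (nnconv l F) x
        = (\<integral>\<^sup>+y. (\<integral>\<^sup>+z. ennreal (k (x - y)) * (ennreal (l (y - z)) * F z) \<partial>lborel) \<partial>lborel)"
      unfolding nnconv_def by (intro nn_integral_cong nn_integral_cmult[symmetric]) measurable
    also have "\<dots> = (\<integral>\<^sup>+z. (\<integral>\<^sup>+y. ennreal (k (x - y)) * (ennreal (l (y - z)) * F z) \<partial>lborel) \<partial>lborel)"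
      by (rule lborel_pair.Fubini'[symmetric]) measurable
    also have "\<dots> = (\<integral>\<^sup>+z. (\<integral>\<^sup>+y. ennreal (k (x - y)) * ennreal (l (y - z)) \<partial>lborel) * F z \<partial>lborel)"
      by (intro nn_integral_cong, subst nn_integral_multc[symmetric]) (simp_all add: mult.assoc)
    finally show ?thesis .
  qed
  have "(\<integral>\<^sup>+y. ennreal (k (x - y)) * ennreal (l (y - z)) \<partial>lborel)
      = (\<integral>\<^sup>+y. ennreal (l (x - y)) * ennreal (k (y - z)) \<partial>lborel)" for z
    using nn_integral_lborel_reflect[of "\<lambda>y. ennreal (k (x - y)) * ennreal (l (y - z))" "x + z"]
    by (simp add: algebra_simps)
  then show ?thesis by (simp add: *)
qed

lemma nnconv_mono:
  "(\<And>x. F x \<le> G x) \<Longrightarrow> nnconv k F x \<le> nnconv k G x"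
  unfolding nnconv_def by (intro nn_integral_mono mult_left_mono) auto

lemma nnconv_add:
  fixes k :: "real ^ 'n \<Rightarrow> real"
  assumes [measurable]: "k \<in> borel_measurable borel" "F \<in> borel_measurable borel" "G \<in> borel_measurable borel"
  shows "nnconv k (\<lambda>x. F x + G x) x = nnconv k F x + nnconv k G x"
  unfolding nnconv_def by (simp add: distrib_left nn_integral_add)

lemma nnconv_cmult:
  fixes k :: "real ^ 'n \<Rightarrow> real"
  assumes [measurable]: "k \<in> borel_measurable borel" "F \<in> borel_measurable borel"
  shows "nnconv k (\<lambda>x. c * F x) x = c * nnconv k F x"
  unfolding nnconv_def by (simp add: nn_integral_cmult[symmetric] mult.left_commute)

lemma moll_reflect_nn_integral: "(\<integral>\<^sup>+y. ennreal (moll n (x - y)) \<partial>lborel) = 1"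
  using nn_integral_lborel_reflect[of "\<lambda>y. ennreal (moll n y)" x] by (simp add: moll_nn_integral)

lemma conv_moll_powr_le:
  assumes f: "loc_int f" and p: "1 \<le> p"
  shows "ennreal (\<bar>conv (moll n) f x\<bar> powr p) \<le> nnconv (moll n) (\<lambda>y. ennreal (\<bar>f y\<bar> powr p)) x"
proof -
  have [measurable]: "f \<in> borel_measurable borel" using f by (rule loc_int_measurable)
  show ?thesis
    unfolding conv_def nnconv_def
    by (rule Jensen_powr) (simp_all add: moll_nonneg moll_reflect_nn_integral conv_integrable moll_test f p)
qed

lemma powr_add_le:
  fixes a b p :: real
  assumes "0 \<le> p"
  shows "\<bar>a + b\<bar> powr p \<le> 2 powr p * (\<bar>a\<bar> powr p + \<bar>b\<bar> powr p)"
proof -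
  let ?m = "max \<bar>a\<bar> \<bar>b\<bar>"
  have "\<bar>a + b\<bar> powr p \<le> (2 * ?m) powr p"
    using assms by (intro powr_mono2) auto
  also have "\<dots> = 2 powr p * ?m powr p" by (simp add: powr_mult)
  also have "?m powr p \<le> \<bar>a\<bar> powr p + \<bar>b\<bar> powr p" by (simp add: max_def)
  finally show ?thesis by simp
qed

lemma powr_add_le_ennreal:
  fixes a b p :: real
  assumes "0 \<le> p"
  shows "ennreal (\<bar>a + b\<bar> powr p) \<le> ennreal (2 powr p) * (ennreal (\<bar>a\<bar> powr p) + ennreal (\<bar>b\<bar> powr p))"
  using powr_add_le[OF assms, of a b] by (simp add: ennreal_mult[symmetric] ennreal_plus[symmetric] del: ennreal_plus)

lemma tendsto_powr_abs_0:
  fixes f :: "nat \<Rightarrow> real"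
  assumes "f \<longlonglongrightarrow> 0" "0 < p"
  shows "(\<lambda>n. ennreal (\<bar>f n\<bar> powr p)) \<longlonglongrightarrow> 0"
proof -
  have "(\<lambda>n. \<bar>f n\<bar> powr p) \<longlonglongrightarrow> \<bar>0\<bar> powr p"
    using assms by (intro tendsto_powr' tendsto_rabs tendsto_const) auto
  then show ?thesis using tendsto_ennrealI by fastforce
qed

definition lp_energy :: "real \<Rightarrow> (real ^ 'n \<Rightarrow> real) \<Rightarrow> ennreal" where
  "lp_energy p f = (\<integral>\<^sup>+x. ennreal (\<bar>f x\<bar> powr p) \<partial>lborel)"

lemma mollifiable_lp_energy:
  assumes p: "1 \<le> p"
  shows "mollifiable (lp_energy p :: (real ^ 'n \<Rightarrow> real) \<Rightarrow> ennreal) (2 powr p)"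
proof
  show "1 \<le> 2 powr p" using p by (simp add: ge_one_powr_ge_zero)
  fix f g :: "real ^ 'n \<Rightarrow> real"
  assume [measurable]: "f \<in> borel_measurable borel" "g \<in> borel_measurable borel"
  have "lp_energy p (\<lambda>x. f x + g x)
      \<le> (\<integral>\<^sup>+x. ennreal (2 powr p) * (ennreal (\<bar>f x\<bar> powr p) + ennreal (\<bar>g x\<bar> powr p)) \<partial>lborel)"
    unfolding lp_energy_def using p by (intro nn_integral_mono powr_add_le_ennreal) simp
  also have "\<dots> = ennreal (2 powr p) * (lp_energy p f + lp_energy p g)"
    by (simp add: lp_energy_def nn_integral_cmult nn_integral_add)
  finally show "lp_energy p (\<lambda>x. f x + g x) \<le> ennreal (2 powr p) * (lp_energy p f + lp_energy p g)" .
next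
  fix f :: "real ^ 'n \<Rightarrow> real"
  show "lp_energy p (\<lambda>x. - f x) = lp_energy p f" by (simp add: lp_energy_def)
next
  fix f :: "real ^ 'n \<Rightarrow> real" and n
  assume f: "loc_int f"
  then have [measurable]: "f \<in> borel_measurable borel" by (rule loc_int_measurable)
  have "lp_energy p (conv (moll n) f) \<le> (\<integral>\<^sup>+x. nnconv (moll n) (\<lambda>y. ennreal (\<bar>f y\<bar> powr p)) x \<partial>lborel)"
    unfolding lp_energy_def by (intro nn_integral_mono conv_moll_powr_le f p)
  also have "\<dots> = lp_energy p f"
    by (simp add: nn_integral_nnconv moll_nn_integral lp_energy_def)
  finally show "lp_energy p (conv (moll n) f) \<le> lp_energy p f" .
next
  fix f :: "nat \<Rightarrow> real ^ 'n \<Rightarrow> real" and F :: "real ^ 'n \<Rightarrow> real"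
  assume [measurable]: "\<And>n. f n \<in> borel_measurable borel" "F \<in> borel_measurable borel"
    and le: "\<And>n x. \<bar>f n x\<bar> \<le> \<bar>F x\<bar>" and lim: "AE x in lborel. (\<lambda>n. f n x) \<longlonglongrightarrow> 0"
    and fin: "lp_energy p F < \<infinity>"
  have "(\<lambda>n. lp_energy p (f n)) \<longlonglongrightarrow> (\<integral>\<^sup>+(x::real ^ 'n). 0 \<partial>lborel)"
    unfolding lp_energy_def
  proof (rule nn_integral_dominated_convergence)
    show "AE x in lborel. ennreal (\<bar>f n x\<bar> powr p) \<le> ennreal (\<bar>F x\<bar> powr p)" for n
      using le p by (intro AE_I2 ennreal_leI powr_mono2) auto
    show "(\<integral>\<^sup>+x. ennreal (\<bar>F x\<bar> powr p) \<partial>lborel) < \<infinity>" using fin by (simp add: lp_energy_def)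
    show "AE x in lborel. (\<lambda>n. ennreal (\<bar>f n x\<bar> powr p)) \<longlonglongrightarrow> 0"
      using lim by eventually_elim (use p in \<open>auto intro!: tendsto_powr_abs_0\<close>)
  qed auto
  then show "(\<lambda>n. lp_energy p (f n)) \<longlonglongrightarrow> 0" by simp
next
  fix c r :: real
  have "lp_energy p (\<lambda>x::real ^ 'n. c * indicator (cball 0 r) x)
      = (\<integral>\<^sup>+(x::real ^ 'n). ennreal (\<bar>c\<bar> powr p) * indicator (cball 0 r) x \<partial>lborel)"
    unfolding lp_energy_def by (intro nn_integral_cong) (auto simp: indicator_def)
  also have "\<dots> = ennreal (\<bar>c\<bar> powr p) * emeasure lborel (cball (0 :: real ^ 'n) r)"
    by (simp add: nn_integral_cmult_indicator)
  also have "\<dots> < \<infinity>"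
    using emeasure_lborel_cball_finite[of "0 :: real ^ 'n" r] by (simp add: ennreal_mult_less_top)
  finally show "lp_energy p (\<lambda>x::real ^ 'n. c * indicator (cball 0 r) x) < \<infinity>" .
qed

definition kernel_energy :: "(real ^ 'n \<Rightarrow> real) \<Rightarrow> real \<Rightarrow> (real ^ 'n \<Rightarrow> real) \<Rightarrow> ennreal" where
  "kernel_energy k p f = (\<integral>\<^sup>+x. (nnconv k (\<lambda>y. ennreal (\<bar>f y\<bar> powr p)) x)\<^sup>2 \<partial>lborel)"

lemma add_square_le_ennreal:
  fixes a b :: ennreal
  shows "(a + b)\<^sup>2 \<le> 4 * (a\<^sup>2 + b\<^sup>2)"
proof -
  have "a + b \<le> 2 * max a b"
    by (simp add: mult_2 add_mono)
  then have "(a + b)\<^sup>2 \<le> (2 * max a b)\<^sup>2"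
    by (intro power_mono) auto
  also have "\<dots> = 4 * (max a b)\<^sup>2" by (simp add: power_mult_distrib)
  also have "\<dots> \<le> 4 * (a\<^sup>2 + b\<^sup>2)"
    by (intro mult_left_mono) (auto simp: max_def)
  finally show ?thesis .
qed

text \<open>For the contraction property, Jensen's inequality bounds \<open>\<bar>conv (moll n) f\<bar> powr p\<close> by an average of
  translates of \<open>\<bar>f\<bar> powr p\<close>. Averaging commutes with the convolution by \<open>k\<close>, and by Jensen's
  inequality for the square the averaged potential has at most the square integral of the original
  one. For dominated convergence, the theorem for integrals is applied first to the potential at
  almost every point and then to its square.\<close>

lemma mollifiable_kernel_energy:
  fixes k :: "real ^ 'n \<Rightarrow> real"
  assumes [measurable]: "k \<in> borel_measurable borel" and p: "1 \<le> p"
    and ball: "\<And>r. (\<integral>\<^sup>+x. (nnconv k (indicator (cball 0 r)) x)\<^sup>2 \<partial>lborel) < \<infinity>"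
  shows "mollifiable (kernel_energy k p) (4 * (2 powr p)\<^sup>2)"
proof
  have *: "1 \<le> 2 powr p" using p by (simp add: ge_one_powr_ge_zero)
  then have "1 \<le> (2 powr p)\<^sup>2" by (rule one_le_power)
  then show "1 \<le> 4 * (2 powr p)\<^sup>2" by linarith
  fix f g :: "real ^ 'n \<Rightarrow> real"
  assume [measurable]: "f \<in> borel_measurable borel" "g \<in> borel_measurable borel"
  let ?c = "ennreal (2 powr p)"
  let ?N = "\<lambda>f. nnconv k (\<lambda>y. ennreal (\<bar>f y\<bar> powr p))"
  have le: "(?N (\<lambda>x. f x + g x) x)\<^sup>2 \<le> ennreal (4 * (2 powr p)\<^sup>2) * ((?N f x)\<^sup>2 + (?N g x)\<^sup>2)" for x
  proof -
    have "?N (\<lambda>x. f x + g x) x \<le> nnconv k (\<lambda>y. ?c * (ennreal (\<bar>f y\<bar> powr p) + ennreal (\<bar>g y\<bar> powr p))) x"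
      using p by (intro nnconv_mono powr_add_le_ennreal) simp
    also have "\<dots> = ?c * (?N f x + ?N g x)"
      by (simp add: nnconv_cmult nnconv_add)
    finally have "(?N (\<lambda>x. f x + g x) x)\<^sup>2 \<le> (?c * (?N f x + ?N g x))\<^sup>2"
      by (intro power_mono) auto
    also have "\<dots> = ?c\<^sup>2 * (?N f x + ?N g x)\<^sup>2" by (simp add: power_mult_distrib)
    also have "\<dots> \<le> ?c\<^sup>2 * (4 * ((?N f x)\<^sup>2 + (?N g x)\<^sup>2))"
      by (intro mult_left_mono add_square_le_ennreal) simp
    also have "\<dots> = ennreal (4 * (2 powr p)\<^sup>2) * ((?N f x)\<^sup>2 + (?N g x)\<^sup>2)"
    proof -
      have "ennreal (4 * (2 powr p)\<^sup>2) = ?c\<^sup>2 * 4"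
        by (simp add: ennreal_mult ennreal_power mult.commute)
      then show ?thesis by (simp only: mult.assoc)
    qed
    finally show ?thesis .
  qed
  have "kernel_energy k p (\<lambda>x. f x + g x)
      \<le> (\<integral>\<^sup>+x. ennreal (4 * (2 powr p)\<^sup>2) * ((?N f x)\<^sup>2 + (?N g x)\<^sup>2) \<partial>lborel)"
    unfolding kernel_energy_def by (intro nn_integral_mono le)
  also have "\<dots> = ennreal (4 * (2 powr p)\<^sup>2) * (kernel_energy k p f + kernel_energy k p g)"
    by (simp add: kernel_energy_def nn_integral_cmult nn_integral_add)
  finally show "kernel_energy k p (\<lambda>x. f x + g x) \<le> ennreal (4 * (2 powr p)\<^sup>2) * (kernel_energy k p f + kernel_energy k p g)" .
next
  fix f :: "real ^ 'n \<Rightarrow> real"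
  show "kernel_energy k p (\<lambda>x. - f x) = kernel_energy k p f" by (simp add: kernel_energy_def)
next
  fix f :: "real ^ 'n \<Rightarrow> real" and n
  assume f: "loc_int f"
  then have [measurable]: "f \<in> borel_measurable borel" by (rule loc_int_measurable)
  let ?F = "\<lambda>y. ennreal (\<bar>f y\<bar> powr p)"
  have le: "(nnconv k (\<lambda>y. ennreal (\<bar>conv (moll n) f y\<bar> powr p)) x)\<^sup>2
      \<le> nnconv (moll n) (\<lambda>y. (nnconv k ?F y)\<^sup>2) x" for x
  proof -
    have "nnconv k (\<lambda>y. ennreal (\<bar>conv (moll n) f y\<bar> powr p)) x \<le> nnconv k (nnconv (moll n) ?F) x"
      by (intro nnconv_mono conv_moll_powr_le f p)
    also have "\<dots> = nnconv (moll n) (nnconv k ?F) x"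
      by (rule nnconv_commute) measurable
    finally have "(nnconv k (\<lambda>y. ennreal (\<bar>conv (moll n) f y\<bar> powr p)) x)\<^sup>2 \<le> (nnconv (moll n) (nnconv k ?F) x)\<^sup>2"
      by (intro power_mono) auto
    also have "\<dots> \<le> nnconv (moll n) (\<lambda>y. (nnconv k ?F y)\<^sup>2) x"
      unfolding nnconv_def[of "moll n"]
      by (rule Jensen_square) (simp_all add: moll_nonneg moll_reflect_nn_integral)
    finally show ?thesis .
  qed
  have "kernel_energy k p (conv (moll n) f) \<le> (\<integral>\<^sup>+x. nnconv (moll n) (\<lambda>y. (nnconv k ?F y)\<^sup>2) x \<partial>lborel)"
    unfolding kernel_energy_def by (intro nn_integral_mono le)
  also have "\<dots> = kernel_energy k p f"
    by (simp add: nn_integral_nnconv moll_nn_integral kernel_energy_def)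
  finally show "kernel_energy k p (conv (moll n) f) \<le> kernel_energy k p f" .
next
  fix f :: "nat \<Rightarrow> real ^ 'n \<Rightarrow> real" and F :: "real ^ 'n \<Rightarrow> real"
  assume [measurable]: "\<And>n. f n \<in> borel_measurable borel" "F \<in> borel_measurable borel"
    and le: "\<And>n x. \<bar>f n x\<bar> \<le> \<bar>F x\<bar>" and lim: "AE x in lborel. (\<lambda>n. f n x) \<longlonglongrightarrow> 0"
    and fin: "kernel_energy k p F < \<infinity>"
  let ?N = "\<lambda>f. nnconv k (\<lambda>y. ennreal (\<bar>f y\<bar> powr p))"
  have fin': "AE x in lborel. ?N F x < \<infinity>"
  proof -
    have "AE x in lborel. (?N F x)\<^sup>2 \<noteq> \<infinity>"
      using fin by (intro nn_integral_noteq_infinite) (auto simp: kernel_energy_def)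
    then show ?thesis
      by eventually_elim (auto simp: power2_eq_square ennreal_mult_eq_top_iff less_top)
  qed
  have pw: "ennreal (\<bar>f n x\<bar> powr p) \<le> ennreal (\<bar>F x\<bar> powr p)" for n x
    using le p by (intro ennreal_leI powr_mono2) auto
  have inner: "(\<lambda>n. ?N (f n) x) \<longlonglongrightarrow> 0" if "?N F x < \<infinity>" for x
  proof -
    have "(\<lambda>n. ?N (f n) x) \<longlonglongrightarrow> (\<integral>\<^sup>+(y::real ^ 'n). 0 \<partial>lborel)"
      unfolding nnconv_def
    proof (rule nn_integral_dominated_convergence)
      show "AE y in lborel. ennreal (k (x - y)) * ennreal (\<bar>f n y\<bar> powr p)
          \<le> ennreal (k (x - y)) * ennreal (\<bar>F y\<bar> powr p)" for n
        by (intro AE_I2 mult_left_mono pw) simp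
      show "(\<integral>\<^sup>+y. ennreal (k (x - y)) * ennreal (\<bar>F y\<bar> powr p) \<partial>lborel) < \<infinity>"
        using that by (simp add: nnconv_def)
      show "AE y in lborel. (\<lambda>n. ennreal (k (x - y)) * ennreal (\<bar>f n y\<bar> powr p)) \<longlonglongrightarrow> 0"
        using lim
      proof eventually_elim
        case (elim y)
        have "(\<lambda>n. ennreal (k (x - y)) * ennreal (\<bar>f n y\<bar> powr p)) \<longlonglongrightarrow> ennreal (k (x - y)) * 0"
          using p by (intro ennreal_tendsto_cmult tendsto_powr_abs_0 elim) auto
        then show ?case by simp
      qed
    qed auto
    then show ?thesis by simp
  qed
  have "(\<lambda>n. kernel_energy k p (f n)) \<longlonglongrightarrow> (\<integral>\<^sup>+(x::real ^ 'n). 0 \<partial>lborel)"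
    unfolding kernel_energy_def
  proof (rule nn_integral_dominated_convergence)
    show "AE x in lborel. (?N (f n) x)\<^sup>2 \<le> (?N F x)\<^sup>2" for n
      by (intro AE_I2 power_mono nnconv_mono pw) simp
    show "(\<integral>\<^sup>+x. (?N F x)\<^sup>2 \<partial>lborel) < \<infinity>" using fin by (simp add: kernel_energy_def)
    show "AE x in lborel. (\<lambda>n. (?N (f n) x)\<^sup>2) \<longlonglongrightarrow> 0"
      using fin'
    proof eventually_elim
      case (elim x)
      have "eventually (\<lambda>n. ?N (f n) x < 1) sequentially"
        by (intro order_tendstoD(2)[OF inner[OF elim]]) simp
      then have "eventually (\<lambda>n. (?N (f n) x)\<^sup>2 \<le> ?N (f n) x) sequentially"
      proof eventually_elim
        case (elim n)
        then show ?case using mult_left_mono[of "?N (f n) x" 1 "?N (f n) x"] by (simp add: power2_eq_square)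
      qed
      then show ?case
        by (intro tendsto_sandwich[OF _ _ tendsto_const inner[OF elim]]) auto
    qed
  qed auto
  then show "(\<lambda>n. kernel_energy k p (f n)) \<longlonglongrightarrow> 0" by simp
next
  fix c r :: real
  let ?I = "indicator (cball 0 r) :: real ^ 'n \<Rightarrow> ennreal"
  have [measurable]: "?I \<in> borel_measurable borel" by (intro borel_measurable_indicator) auto
  have "(\<lambda>y::real ^ 'n. ennreal (\<bar>c * indicator (cball 0 r) y\<bar> powr p)) = (\<lambda>y. ennreal (\<bar>c\<bar> powr p) * ?I y)"
    by (auto simp: indicator_def)
  then have "kernel_energy k p (\<lambda>x. c * indicator (cball 0 r) x)
      = (\<integral>\<^sup>+x. (ennreal (\<bar>c\<bar> powr p))\<^sup>2 * (nnconv k ?I x)\<^sup>2 \<partial>lborel)"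
    by (simp add: kernel_energy_def nnconv_cmult power_mult_distrib)
  also have "\<dots> = (ennreal (\<bar>c\<bar> powr p))\<^sup>2 * (\<integral>\<^sup>+x. (nnconv k ?I x)\<^sup>2 \<partial>lborel)"
    by (intro nn_integral_cmult) measurable
  also have "\<dots> < \<infinity>"
    using ball[of r] by (simp add: ennreal_mult_less_top ennreal_power)
  finally show "kernel_energy k p (\<lambda>x. c * indicator (cball 0 r) x) < \<infinity>" .
qed

section \<open>Uniqueness of weak gradients\<close>

text \<open>If \<open>g\<close> annihilates all test functions, then the mollifications of its restriction to a ball vanish
  well inside that ball, while they converge to the restriction in the sense of the integral of the
  absolute value.\<close>

lemma loc_int_eq_0:
  fixes g :: "real ^ 'n \<Rightarrow> real"
  assumes g: "loc_int g" and zero: "\<And>f. f \<in> test_functions \<Longrightarrow> (\<integral>x. g x * f x \<partial>lborel) = 0"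
  shows "AE x in lborel. g x = 0"
proof -
  interpret L: mollifiable "lp_energy 1 :: (real ^ 'n \<Rightarrow> real) \<Rightarrow> ennreal" "2 powr 1"
    by (rule mollifiable_lp_energy) simp
  have [measurable]: "g \<in> borel_measurable borel" using g by (rule loc_int_measurable)
  have ball: "AE x in lborel. norm x < real R \<longrightarrow> g x = 0" for R :: nat
  proof -
    let ?f = "\<lambda>x. indicator (cball 0 (real R + 1)) x * g x"
    have int: "integrable lborel ?f" by (rule loc_intD[OF g])
    have [measurable]: "?f \<in> borel_measurable borel"
      by (intro borel_measurable_times borel_measurable_indicator) auto
    have f: "loc_int ?f"
      unfolding loc_int_def
    proof (intro conjI allI)
      fix r
      show "integrable lborel (\<lambda>x. indicator (cball 0 r) x * ?f x)"
        by (rule Bochner_Integration.integrable_bound[OF int])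
          (auto intro!: borel_measurable_times borel_measurable_indicator simp: indicator_def)
    qed measurable
    have fin: "lp_energy 1 ?f < \<infinity>"
      using int by (simp add: lp_energy_def integrable_iff_bounded)
    have conv0: "conv (moll n) ?f x = 0" if x: "norm x < real R" for n x
    proof -
      have "moll n (x - y) * ?f y = g y * moll n (x + (-1) *\<^sub>R y)" for y
      proof (cases "norm y \<le> real R + 1")
        case False
        then have "1 \<le> norm (x - y)" using x norm_triangle_ineq3[of y x] by (simp add: norm_minus_commute abs_le_iff)
        moreover have "1 / real (Suc n) \<le> 1" by simp
        ultimately have "moll n (x - y) = 0" by (intro moll_zero) linarith
        then show ?thesis by simp
      qed simp
      then have "conv (moll n) ?f x = (\<integral>y. g y * moll n (x + (-1) *\<^sub>R y) \<partial>lborel)"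
        unfolding conv_def by (intro Bochner_Integration.integral_cong refl)
      also have "\<dots> = 0"
        by (intro zero test_function_affine moll_test) simp
      finally show ?thesis .
    qed
    have "(\<integral>\<^sup>+x. ennreal \<bar>g x\<bar> * indicator (ball 0 (real R)) x \<partial>lborel)
        \<le> lp_energy 1 (\<lambda>x. conv (moll n) ?f x - ?f x)" for n
      unfolding lp_energy_def
    proof (rule nn_integral_mono)
      fix x
      show "ennreal \<bar>g x\<bar> * indicator (ball 0 (real R)) x \<le> ennreal (\<bar>conv (moll n) ?f x - ?f x\<bar> powr 1)"
      proof (cases "norm x < real R")
        case True
        then show ?thesis
          unfolding conv0[OF True] by (simp add: indicator_def)
      qed simp
    qed
    then have "(\<integral>\<^sup>+x. ennreal \<bar>g x\<bar> * indicator (ball 0 (real R)) x \<partial>lborel) \<le> 0"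
      by (intro tendsto_lowerbound[OF L.mollification_tendsto[OF f fin]]) auto
    then have "AE x in lborel. ennreal \<bar>g x\<bar> * indicator (ball 0 (real R)) x = 0"
      by (subst (asm) le_zero_eq, subst (asm) nn_integral_0_iff_AE)
        (auto intro!: borel_measurable_times borel_measurable_indicator)
    then show ?thesis
      by eventually_elim (auto simp: indicator_def)
  qed
  have "AE x in lborel. \<forall>R::nat. norm x < real R \<longrightarrow> g x = 0"
    unfolding AE_all_countable using ball by blast
  then show ?thesis
  proof eventually_elim
    case (elim x)
    obtain R :: nat where "norm x < real R" using reals_Archimedean2 by blast
    then show ?case using elim by blast
  qed
qed

lemma locally_integrable_measurable:
  fixes f :: "real ^ 'n \<Rightarrow> real"
  assumes "locally_integrable f"
  shows "f \<in> borel_measurable lebesgue"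
proof (rule borel_measurable_LIMSEQ_real)
  show "(\<lambda>x. indicator (cball 0 (real n)) x *\<^sub>R f x) \<in> borel_measurable lebesgue" for n
    using assms by (intro borel_measurable_integrable) (auto simp: locally_integrable_def set_integrable_def)
  show "(\<lambda>n. indicator (cball 0 (real n)) x *\<^sub>R f x) \<longlonglongrightarrow> f x" for x
  proof (rule tendsto_eventually)
    obtain K :: nat where "norm x \<le> real K" using real_arch_simple by blast
    then show "eventually (\<lambda>n. indicator (cball 0 (real n)) x *\<^sub>R f x = f x) sequentially"
      by (auto simp: eventually_sequentially intro!: exI[of _ K])
  qed
qed

lemma locally_integrable_cong_AE:
  fixes f h :: "real ^ 'n \<Rightarrow> 'b::euclidean_space"
  assumes "AE x in lebesgue. f x = h x"
  shows "locally_integrable f \<longleftrightarrow> locally_integrable h"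
  unfolding locally_integrable_def set_integrable_def
  by (intro all_cong lebesgue_integrable_cong_AE) (use assms in eventually_elim, simp)

lemma locally_integrable_diff:
  fixes f h :: "real ^ 'n \<Rightarrow> 'b::euclidean_space"
  assumes "locally_integrable f" "locally_integrable h"
  shows "locally_integrable (\<lambda>x. f x - h x)"
  using assms unfolding locally_integrable_def set_integrable_def by (simp add: scaleR_diff_right)

lemma locally_integrable_borel_rep:
  fixes f :: "real ^ 'n \<Rightarrow> real"
  assumes "locally_integrable f"
  obtains f' where "loc_int f'" "AE x in lebesgue. f x = f' x"
proof -
  obtain f' where f': "f' \<in> borel_measurable lborel" "AE x in lborel. f x = f' x"
    using completion_ex_borel_measurable_real[OF locally_integrable_measurable[OF assms]] by blast
  then have AE: "AE x in lebesgue. f x = f' x" by (simp add: AE_completion_iff)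
  then have "loc_int f'"
    using assms f'(1) locally_integrable_cong_AE[OF AE] by (intro locally_integrable_loc_int) auto
  with AE that show ?thesis by blast
qed

lemma loc_int_mult_test:
  assumes f: "f \<in> test_functions" and u: "loc_int u"
  shows "integrable lborel (\<lambda>y. u y * f y)"
proof -
  obtain B where B: "\<And>x. \<bar>f x\<bar> \<le> B" using test_function_bounded[OF f] by blast
  obtain r where r: "\<And>x. r < norm x \<Longrightarrow> f x = 0" using test_function_supportE[OF f] by blast
  have "f \<in> borel_measurable borel"
    using smooth_measurable[OF test_function_smooth[OF f]] .
  from integrable_mult_loc_int[OF u this B r] show ?thesis by (simp add: mult.commute)
qed

lemma locally_integrable_mult_test:
  fixes u :: "real ^ 'n \<Rightarrow> real"
  assumes f: "f \<in> test_functions" and u: "locally_integrable u"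
  shows "integrable lebesgue (\<lambda>y. u y * f y)"
proof -
  obtain u' where u': "loc_int u'" "AE x in lebesgue. u x = u' x"
    using locally_integrable_borel_rep[OF u] by blast
  have [measurable]: "u' \<in> borel_measurable borel" "f \<in> borel_measurable borel"
    using u'(1) smooth_measurable[OF test_function_smooth[OF f]] by (simp_all add: loc_int_measurable)
  have "integrable lebesgue (\<lambda>y. u' y * f y)"
    using loc_int_mult_test[OF f u'(1)] by (subst integrable_completion) simp_all
  moreover have "AE y in lebesgue. u y * f y = u' y * f y"
    using u'(2) by eventually_elim simp
  ultimately show ?thesis
    by (simp only: lebesgue_integrable_cong_AE(1))
qed

lemma weak_gradient_unique:
  fixes u :: "real ^ 'n \<Rightarrow> real"
  assumes g: "has_weak_gradient u g" and h: "has_weak_gradient u h"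
  shows "AE x in lebesgue. g x = h x"
proof -
  have "AE x in lebesgue. g x $ i = h x $ i" for i
  proof -
    have li: "locally_integrable (\<lambda>x. g x $ i)" "locally_integrable (\<lambda>x. h x $ i)"
      using g h by (auto simp: has_weak_gradient_def intro: locally_integrable_component)
    obtain d where d: "loc_int d" "AE x in lebesgue. g x $ i - h x $ i = d x"
      using locally_integrable_borel_rep[OF locally_integrable_diff[OF li]] by blast
    have "AE x in lborel. d x = 0"
    proof (rule loc_int_eq_0[OF d(1)])
      fix f :: "real ^ 'n \<Rightarrow> real" assume f: "f \<in> test_functions"
      have [measurable]: "d \<in> borel_measurable borel" "f \<in> borel_measurable borel"
        using d(1) smooth_measurable[OF test_function_smooth[OF f]] by (simp_all add: loc_int_measurable)
      have "(\<integral>x. d x * f x \<partial>lborel) = (\<integral>x. d x * f x \<partial>lebesgue)"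
        by (subst integral_completion) simp_all
      also have "\<dots> = (\<integral>x. g x $ i * f x - h x $ i * f x \<partial>lebesgue)"
        by (rule lebesgue_integrable_cong_AE(2)) (use d(2) in eventually_elim, simp add: left_diff_distrib[symmetric])
      also have "\<dots> = (\<integral>x. g x $ i * f x \<partial>lebesgue) - (\<integral>x. h x $ i * f x \<partial>lebesgue)"
        by (intro Bochner_Integration.integral_diff locally_integrable_mult_test f li)
      also have "\<dots> = 0"
      proof -
        have "(\<integral>x. u x * partial_deriv i f x \<partial>lebesgue) = - (\<integral>x. g x $ i * f x \<partial>lebesgue)"
          "(\<integral>x. u x * partial_deriv i f x \<partial>lebesgue) = - (\<integral>x. h x $ i * f x \<partial>lebesgue)"
          using g h f unfolding has_weak_gradient_def by blast+
        then show ?thesis by simp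
      qed
      finally show "(\<integral>x. d x * f x \<partial>lborel) = 0" .
    qed
    then have "AE x in lebesgue. d x = 0" by (rule AE_completion)
    with d(2) show ?thesis by eventually_elim simp
  qed
  then have "AE x in lebesgue. \<forall>i. g x $ i = h x $ i"
    by (simp add: AE_all_countable)
  then show ?thesis by eventually_elim (simp add: vec_eq_iff)
qed

text \<open>The gradient chosen in the definition of the energy may be replaced by any weak gradient, by
  uniqueness.\<close>

lemma dirichlet_energy_eq:
  assumes "has_weak_gradient u g"
  shows "dirichlet_energy u = (\<integral>\<^sup>+x. ennreal ((norm (g x))\<^sup>2) \<partial>lebesgue)"
proof -
  have "has_weak_gradient u (weak_gradient u)"
    unfolding weak_gradient_def by (rule someI[of "has_weak_gradient u", OF assms])
  note ae = weak_gradient_unique[OF this assms]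
  show ?thesis
    unfolding dirichlet_energy_def by (rule nn_integral_cong_AE) (use ae in eventually_elim, simp)
qed

lemma has_weak_gradient_diff:
  fixes u v :: "real ^ 'n \<Rightarrow> real"
  assumes g: "has_weak_gradient u g" and h: "has_weak_gradient v h"
  shows "has_weak_gradient (\<lambda>x. u x - v x) (\<lambda>x. g x - h x)"
  unfolding has_weak_gradient_def
proof (intro conjI ballI allI)
  have li: "locally_integrable u" "locally_integrable v" "locally_integrable g" "locally_integrable h"
    using g h by (auto simp: has_weak_gradient_def)
  then show "locally_integrable (\<lambda>x. u x - v x)" "locally_integrable (\<lambda>x. g x - h x)"
    by (auto intro: locally_integrable_diff)
  fix f :: "real ^ 'n \<Rightarrow> real" and i assume f: "f \<in> test_functions"
  have "(\<integral>x. u x * partial_deriv i f x \<partial>lebesgue) = - (\<integral>x. g x $ i * f x \<partial>lebesgue)"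
    "(\<integral>x. v x * partial_deriv i f x \<partial>lebesgue) = - (\<integral>x. h x $ i * f x \<partial>lebesgue)"
    using g h f unfolding has_weak_gradient_def by blast+
  moreover note locally_integrable_mult_test[OF test_function_partial_deriv[OF f] li(1), of i]
    locally_integrable_mult_test[OF test_function_partial_deriv[OF f] li(2), of i]
    locally_integrable_mult_test[OF f locally_integrable_component[OF li(3), of i]]
    locally_integrable_mult_test[OF f locally_integrable_component[OF li(4), of i]]
  ultimately show "(\<integral>x. (u x - v x) * partial_deriv i f x \<partial>lebesgue)
      = - (\<integral>x. (g x - h x) $ i * f x \<partial>lebesgue)"
    by (simp add: left_diff_distrib)
qed

section \<open>The Riesz kernel\<close>

lemma dyadic_ex:
  fixes t :: real
  assumes "1 \<le> t"
  obtains j :: nat where "2 ^ j \<le> t" "t \<le> 2 * 2 ^ j"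
proof -
  have ex: "\<exists>j::nat. t \<le> 2 * 2 ^ j"
  proof -
    obtain n :: nat where "t < 2 ^ n" using real_arch_pow[of 2 t] by auto
    moreover have "0 \<le> (2 :: real) ^ n" by simp
    ultimately show ?thesis by (intro exI[of _ n]) linarith
  qed
  define j where "j = (LEAST j::nat. t \<le> 2 * 2 ^ j)"
  have 1: "t \<le> 2 * 2 ^ j" unfolding j_def using ex by (rule LeastI_ex)
  have "2 ^ j \<le> t"
  proof (cases j)
    case (Suc i)
    then have "\<not> t \<le> 2 * 2 ^ i"
      using not_less_Least[of i "\<lambda>j. t \<le> 2 * 2 ^ j"] by (simp add: j_def)
    then show ?thesis by (simp add: Suc)
  qed (use assms in simp)
  with 1 show ?thesis by (rule that[rotated])
qed

text \<open>Rescaling a shell by the factor \<open>b\<close> multiplies the integral of \<open>\<bar>x\<bar> powr (- s)\<close> over it by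
  \<open>b powr (N - s)\<close>, so the integral over any region that is covered by the rescaled shells is
  dominated by a geometric series. The factors \<open>b = 1/2\<close> and \<open>b = 2\<close> give integrability near the
  origin and near infinity.\<close>

lemma nn_integral_norm_powr_shells:
  fixes A :: "(real ^ 'n) set"
  assumes b: "0 < b" and conv: "b powr (real CARD('n) - s) < 1" and r: "0 < r" and s: "0 \<le> s"
    and cover: "\<And>x. x \<in> A \<Longrightarrow> x \<noteq> 0 \<Longrightarrow> \<exists>j::nat. r \<le> norm x / b ^ j \<and> norm x / b ^ j \<le> 2 * r"
  shows "(\<integral>\<^sup>+x. ennreal (norm x powr (- s)) * indicator A x \<partial>lborel) < \<infinity>"
proof -
  let ?S = "cball 0 (2 * r) - ball 0 r :: (real ^ 'n) set"
  let ?f = "\<lambda>x :: real ^ 'n. ennreal (norm x powr (- s))"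
  define I0 where "I0 = (\<integral>\<^sup>+x. ?f x * indicator ?S x \<partial>lborel)"
  have [measurable]: "?S \<in> sets borel" by auto
  have "I0 \<le> (\<integral>\<^sup>+x. ennreal (r powr (- s)) * indicator (cball 0 (2 * r) :: (real ^ 'n) set) x \<partial>lborel)"
    unfolding I0_def using r s
    by (intro nn_integral_mono) (auto simp: indicator_def intro!: ennreal_leI powr_mono2')
  also have "\<dots> < \<infinity>"
    using emeasure_lborel_cball_finite[of "0 :: real ^ 'n" "2 * r"]
    by (simp add: nn_integral_cmult_indicator ennreal_mult_less_top)
  finally have I0: "I0 < \<infinity>" .
  define q where "q = b powr (real CARD('n) - s)"
  have shell: "(\<integral>\<^sup>+x. ?f x * indicator ?S ((1 / b ^ j) *\<^sub>R x) \<partial>lborel) = ennreal (q ^ j) * I0" for j :: nat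
  proof -
    have bj: "0 < b ^ j" using b by simp
    have "(\<integral>\<^sup>+x. ?f x * indicator ?S ((1 / b ^ j) *\<^sub>R x) \<partial>lborel)
      = ennreal (\<bar>b ^ j\<bar> ^ CARD('n)) *
        (\<integral>\<^sup>+x. ?f (0 + (b ^ j) *\<^sub>R x) * indicator ?S ((1 / b ^ j) *\<^sub>R (0 + (b ^ j) *\<^sub>R x)) \<partial>lborel)"
      by (rule nn_integral_lborel_affine) (use b in auto)
    also have "(\<integral>\<^sup>+x. ?f (0 + (b ^ j) *\<^sub>R x) * indicator ?S ((1 / b ^ j) *\<^sub>R (0 + (b ^ j) *\<^sub>R x)) \<partial>lborel)
      = (\<integral>\<^sup>+x. ennreal ((b ^ j) powr (- s)) * (?f x * indicator ?S x) \<partial>lborel)"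
      using bj b by (intro nn_integral_cong) (simp add: powr_mult ennreal_mult mult.assoc)
    also have "\<dots> = ennreal ((b ^ j) powr (- s)) * I0"
      unfolding I0_def by (rule nn_integral_cmult) measurable
    also have "ennreal (\<bar>b ^ j\<bar> ^ CARD('n)) * (ennreal ((b ^ j) powr (- s)) * I0)
      = ennreal (\<bar>b ^ j\<bar> ^ CARD('n) * (b ^ j) powr (- s)) * I0"
      by (simp add: ennreal_mult mult.assoc)
    also have "\<bar>b ^ j\<bar> ^ CARD('n) * (b ^ j) powr (- s) = q ^ j"
    proof -
      have "\<bar>b ^ j\<bar> ^ CARD('n) = (b ^ j) powr real CARD('n)"
        using bj by (simp add: powr_realpow)
      then have "\<bar>b ^ j\<bar> ^ CARD('n) * (b ^ j) powr (- s) = (b ^ j) powr (real CARD('n) - s)"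
        by (simp add: powr_add[symmetric])
      also have "\<dots> = q ^ j"
        using b unfolding q_def by (simp add: powr_realpow[symmetric] powr_powr mult.commute)
      finally show ?thesis .
    qed
    finally show ?thesis .
  qed
  have "(\<integral>\<^sup>+x. ?f x * indicator A x \<partial>lborel)
      \<le> (\<integral>\<^sup>+x. (\<Sum>j. ?f x * indicator ?S ((1 / b ^ j) *\<^sub>R x)) \<partial>lborel)"
  proof (rule nn_integral_mono)
    fix x :: "real ^ 'n"
    show "?f x * indicator A x \<le> (\<Sum>j. ?f x * indicator ?S ((1 / b ^ j) *\<^sub>R x))"
    proof (cases "x \<in> A \<and> x \<noteq> 0")
      case True
      then obtain j :: nat where j: "r \<le> norm x / b ^ j" "norm x / b ^ j \<le> 2 * r"
        using cover by blast
      then have "(1 / b ^ j) *\<^sub>R x \<in> ?S" using b by simp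
      then have "?f x * indicator A x = ?f x * indicator ?S ((1 / b ^ j) *\<^sub>R x)"
        using True by simp
      also have "\<dots> \<le> (\<Sum>j. ?f x * indicator ?S ((1 / b ^ j) *\<^sub>R x))"
      proof -
        define g where "g i = ?f x * indicator ?S ((1 / b ^ i) *\<^sub>R x)" for i :: nat
        have "g j \<le> suminf g" using sum_le_suminf[of g "{j}"] by simp
        then show ?thesis unfolding g_def .
      qed
      finally show ?thesis .
    next
      case False
      then have "?f x * indicator A x = 0" by auto
      then show ?thesis by (simp only: zero_le)
    qed
  qed
  also have "\<dots> = (\<Sum>j. \<integral>\<^sup>+x. ?f x * indicator ?S ((1 / b ^ j) *\<^sub>R x) \<partial>lborel)"
    by (rule nn_integral_suminf) measurable
  also have "\<dots> = (\<Sum>j. ennreal (q ^ j)) * I0"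
    by (simp add: shell)
  also have "\<dots> < \<infinity>"
  proof -
    have "0 \<le> q" "q < 1" using conv by (auto simp: q_def)
    then have "(\<Sum>j. ennreal (q ^ j)) < \<infinity>"
      by (subst suminf_ennreal2) (auto simp: summable_geometric)
    with I0 show ?thesis by (simp add: ennreal_mult_less_top)
  qed
  finally show ?thesis .
qed

lemma nn_integral_norm_powr_ball:
  assumes "0 \<le> s" "s < real CARD('n)" "0 < r"
  shows "(\<integral>\<^sup>+(x::real ^ 'n). ennreal (norm x powr (- s)) * indicator (cball 0 r) x \<partial>lborel) < \<infinity>"
proof (rule nn_integral_norm_powr_shells)
  show "(1 / 2) powr (real CARD('n) - s) < 1"
    using assms powr_less_mono2[of "real CARD('n) - s" "1 / 2" 1] by simp
  fix x :: "real ^ 'n" assume x: "x \<in> cball 0 r" "x \<noteq> 0"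
  then have "1 \<le> r / norm x" by simp
  then obtain j :: nat where j: "2 ^ j \<le> r / norm x" "r / norm x \<le> 2 * 2 ^ j"
    by (rule dyadic_ex)
  then have "r / 2 \<le> norm x * 2 ^ j" "norm x * 2 ^ j \<le> 2 * (r / 2)"
    using x by (simp_all add: field_simps)
  then show "\<exists>j::nat. r / 2 \<le> norm x / (1 / 2) ^ j \<and> norm x / (1 / 2) ^ j \<le> 2 * (r / 2)"
    by (intro exI[of _ j]) (simp add: power_one_over)
qed (use assms in auto)

lemma nn_integral_norm_powr_outside:
  assumes "real CARD('n) < s" "0 < r"
  shows "(\<integral>\<^sup>+(x::real ^ 'n). ennreal (norm x powr (- s)) * indicator (- ball 0 r) x \<partial>lborel) < \<infinity>"
proof (rule nn_integral_norm_powr_shells)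
  show "2 powr (real CARD('n) - s) < 1"
    using assms powr_less_mono[of "real CARD('n) - s" 0 2] by simp
  show "0 \<le> s" using assms(1) of_nat_0_le_iff[of "CARD('n)", where 'a=real] by linarith
  fix x :: "real ^ 'n" assume x: "x \<in> - ball 0 r"
  then have "1 \<le> norm x / r" using assms by simp
  then obtain j :: nat where j: "2 ^ j \<le> norm x / r" "norm x / r \<le> 2 * 2 ^ j"
    by (rule dyadic_ex)
  then show "\<exists>j::nat. r \<le> norm x / 2 ^ j \<and> norm x / 2 ^ j \<le> 2 * r"
    using assms by (intro exI[of _ j]) (simp add: field_simps)
qed (use assms in auto)

lemma riesz_const_pos:
  assumes "0 < a" "a < real CARD('n)"
  shows "0 < riesz_const TYPE('n::finite) a"
  using assms unfolding riesz_const_def by (intro divide_pos_pos mult_pos_pos Gamma_real_pos) auto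

lemma riesz_potential_measurable [measurable]: "riesz_potential a \<in> borel_measurable borel"
  unfolding riesz_potential_def[abs_def] by measurable

lemma coulomb_energy_eq:
  "coulomb_energy \<alpha> p u = kernel_energy (riesz_potential (\<alpha> / 2)) p u"
  unfolding coulomb_energy_def kernel_energy_def nn_convolution_def nnconv_def
  by (simp add: nn_integral_completion)

lemma kernel_energy_mono:
  assumes "\<And>x. \<bar>f x\<bar> \<le> \<bar>g x\<bar>" "0 \<le> p"
  shows "kernel_energy k p f \<le> kernel_energy k p g"
  unfolding kernel_energy_def using assms
  by (intro nn_integral_mono power_mono nnconv_mono ennreal_leI powr_mono2) auto

text \<open>Near the ball, the potential of its indicator is bounded because the singularity \<open>\<bar>x\<bar> powr (\<alpha>/2 - N)\<close> of the
  kernel is integrable. Far away the potential is comparable with the kernel itself, whose square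
  \<open>\<bar>x\<bar> powr (\<alpha> - 2 N)\<close> is integrable at infinity because \<open>\<alpha> < N\<close>.\<close>

lemma riesz_ball_finite:
  fixes \<alpha> :: real
  assumes \<alpha>: "0 < \<alpha>" "\<alpha> < real CARD('n)"
  shows "(\<integral>\<^sup>+x. (nnconv (riesz_potential (\<alpha> / 2)) (indicator (cball 0 r)) (x :: real ^ 'n))\<^sup>2 \<partial>lborel) < \<infinity>"
proof -
  define s where "s = real CARD('n) - \<alpha> / 2"
  define c where "c = riesz_const TYPE('n) (\<alpha> / 2)"
  define \<rho> where "\<rho> = max r 1"
  let ?k = "riesz_potential (\<alpha> / 2) :: real ^ 'n \<Rightarrow> real"
  have c: "0 < c" unfolding c_def using \<alpha> by (intro riesz_const_pos) auto
  have s: "0 < s" "s < real CARD('n)" "real CARD('n) < 2 * s" using \<alpha> by (auto simp: s_def)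
  have \<rho>: "0 < \<rho>" by (simp add: \<rho>_def)
  have k: "?k x = c * norm x powr (- s)" for x by (simp add: riesz_potential_def s_def c_def)
  let ?N = "nnconv ?k (indicator (cball 0 r))"
  define M where "M = (\<integral>\<^sup>+(x::real ^ 'n). ennreal (?k x) * indicator (cball 0 (3 * \<rho>)) x \<partial>lborel)"
  have "M = (\<integral>\<^sup>+(x::real ^ 'n). ennreal c * (ennreal (norm x powr (- s)) * indicator (cball 0 (3 * \<rho>)) x) \<partial>lborel)"
    unfolding M_def using c by (intro nn_integral_cong) (simp add: k ennreal_mult mult.assoc)
  also have "\<dots> = ennreal c * (\<integral>\<^sup>+(x::real ^ 'n). ennreal (norm x powr (- s)) * indicator (cball 0 (3 * \<rho>)) x \<partial>lborel)"
    by (rule nn_integral_cmult) measurable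
  also have "\<dots> < \<infinity>"
    using nn_integral_norm_powr_ball[of s "3 * \<rho>", where 'n='n] s \<rho> by (simp add: ennreal_mult_less_top)
  finally have M: "M < \<infinity>" .
  define V where "V = ennreal (c * 2 powr s) * emeasure lborel (cball (0 :: real ^ 'n) r)"
  have V: "V < \<infinity>"
    using emeasure_lborel_cball_finite[of "0 :: real ^ 'n" r] by (simp add: V_def ennreal_mult_less_top)
  have near: "?N x \<le> M" if x: "norm x \<le> 2 * \<rho>" for x
  proof -
    have "?N x \<le> (\<integral>\<^sup>+y. ennreal (?k (x - y)) * indicator (cball 0 (3 * \<rho>)) (x - y) \<partial>lborel)"
      unfolding nnconv_def
    proof (intro nn_integral_mono mult_left_mono)
      fix y
      show "(indicator (cball 0 r) y :: ennreal) \<le> indicator (cball 0 (3 * \<rho>)) (x - y)"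
        using x norm_triangle_ineq4[of x y] by (auto simp: indicator_def \<rho>_def)
    qed simp
    also have "\<dots> = M"
      unfolding M_def by (rule nn_integral_lborel_reflect[of "\<lambda>z. ennreal (?k z) * indicator (cball 0 (3 * \<rho>)) z"]) measurable
    finally show ?thesis .
  qed
  have far: "?N x \<le> V * ennreal (norm x powr (- s))" if x: "2 * \<rho> < norm x" for x
  proof -
    have "?N x \<le> (\<integral>\<^sup>+(y::real ^ 'n). ennreal (c * 2 powr s * norm x powr (- s)) * indicator (cball 0 r) y \<partial>lborel)"
      unfolding nnconv_def
    proof (intro nn_integral_mono)
      fix y
      show "ennreal (?k (x - y)) * indicator (cball 0 r) y
          \<le> ennreal (c * 2 powr s * norm x powr (- s)) * indicator (cball 0 r) y"
      proof (cases "norm y \<le> r")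
        case True
        have "norm x / 2 \<le> norm (x - y)"
          using True x norm_triangle_ineq2[of x y] by (simp add: \<rho>_def)
        then have "norm (x - y) powr (- s) \<le> (norm x / 2) powr (- s)"
          using x \<rho> s by (intro powr_mono2') auto
        also have "\<dots> = 2 powr s * norm x powr (- s)"
          by (simp add: powr_divide powr_minus field_simps)
        finally have "?k (x - y) \<le> c * 2 powr s * norm x powr (- s)"
          using c by (simp add: k)
        then show ?thesis using True by (simp add: ennreal_leI)
      qed simp
    qed
    also have "\<dots> = ennreal (c * 2 powr s * norm x powr (- s)) * emeasure lborel (cball (0 :: real ^ 'n) r)"
      by (simp add: nn_integral_cmult_indicator)
    also have "\<dots> = V * ennreal (norm x powr (- s))"
      using c by (simp add: V_def ennreal_mult mult_ac)
    finally show ?thesis .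
  qed
  have "(\<integral>\<^sup>+x. (?N x)\<^sup>2 \<partial>lborel)
      \<le> (\<integral>\<^sup>+(x::real ^ 'n). M\<^sup>2 * indicator (cball 0 (2 * \<rho>)) x
          + V\<^sup>2 * (ennreal (norm x powr (- (2 * s))) * indicator (- ball 0 (2 * \<rho>)) x) \<partial>lborel)"
  proof (rule nn_integral_mono)
    fix x :: "real ^ 'n"
    show "(?N x)\<^sup>2 \<le> M\<^sup>2 * indicator (cball 0 (2 * \<rho>)) x
          + V\<^sup>2 * (ennreal (norm x powr (- (2 * s))) * indicator (- ball 0 (2 * \<rho>)) x)"
    proof (cases "norm x \<le> 2 * \<rho>")
      case True
      have "(?N x)\<^sup>2 \<le> M\<^sup>2" using near[OF True] by (intro power_mono) auto
      also have "\<dots> \<le> M\<^sup>2 + V\<^sup>2 * (ennreal (norm x powr (- (2 * s))) * indicator (- ball 0 (2 * \<rho>)) x)"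
        by simp
      finally show ?thesis using True by simp
    next
      case False
      then have "(?N x)\<^sup>2 \<le> (V * ennreal (norm x powr (- s)))\<^sup>2"
        using far[of x] by (intro power_mono) auto
      also have "\<dots> = V\<^sup>2 * ennreal (norm x powr (- (2 * s)))"
      proof -
        have "(norm x powr (- s))\<^sup>2 = norm x powr (- (2 * s))"
          by (simp add: power2_eq_square powr_add[symmetric])
        then show ?thesis by (simp add: power_mult_distrib ennreal_power)
      qed
      finally show ?thesis using False by simp
    qed
  qed
  also have "\<dots> = M\<^sup>2 * emeasure lborel (cball (0 :: real ^ 'n) (2 * \<rho>))
      + V\<^sup>2 * (\<integral>\<^sup>+(x::real ^ 'n). ennreal (norm x powr (- (2 * s))) * indicator (- ball 0 (2 * \<rho>)) x \<partial>lborel)"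
    by (subst nn_integral_add) (auto simp: nn_integral_cmult nn_integral_cmult_indicator)
  also have "\<dots> < \<infinity>"
    using M V emeasure_lborel_cball_finite[of "0 :: real ^ 'n" "2 * \<rho>"]
      nn_integral_norm_powr_outside[of "2 * s" "2 * \<rho>", where 'n='n] s \<rho>
    by (simp add: ennreal_mult_less_top power2_eq_square)
  finally show ?thesis .
qed

lemma mollifiable_riesz:
  assumes "0 < \<alpha>" "\<alpha> < real CARD('n::finite)" "1 \<le> p"
  shows "mollifiable (kernel_energy (riesz_potential (\<alpha> / 2) :: real ^ 'n \<Rightarrow> real) p) (4 * (2 powr p)\<^sup>2)"
  using assms by (intro mollifiable_kernel_energy riesz_ball_finite) auto

section \<open>Decay of means\<close>

abbreviation ball_mean :: "(real ^ 'n \<Rightarrow> ennreal) \<Rightarrow> real \<Rightarrow> ennreal" where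
  "ball_mean F R \<equiv> ennreal (1 / R ^ CARD('n)) * (\<integral>\<^sup>+x. F x * indicator (cball 0 R) x \<partial>lborel)"

lemma ball_volume:
  obtains \<omega> where "0 < \<omega>" "\<And>R. 0 \<le> R \<Longrightarrow> emeasure lborel (cball (0 :: real ^ 'n) R) = ennreal (\<omega> * R ^ CARD('n))"
proof -
  show ?thesis
    by (rule that[of "unit_ball_vol (real CARD('n))"]) (auto simp: emeasure_cball)
qed

lemma ennreal_le_of_square_le:
  fixes X :: ennreal
  assumes "X\<^sup>2 \<le> ennreal q" "0 \<le> q"
  shows "X \<le> ennreal (sqrt q)"
proof (cases X)
  case (real r)
  then have "r\<^sup>2 \<le> q" using assms by (simp add: ennreal_power)
  then show ?thesis using real by (simp add: real_le_rsqrt ennreal_leI)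
next
  case top
  then show ?thesis using assms by (simp add: power2_eq_square top_unique)
qed

text \<open>On the ball of radius \<open>R\<close> the potential of \<open>\<bar>f\<bar>\<^sup>p\<close> is at least \<open>R powr (\<alpha>/2 - N)\<close> times the mass of
  \<open>\<bar>f\<bar>\<^sup>p\<close> in that ball, up to a constant. Squaring and integrating over the ball bounds this mass by
  a multiple of \<open>R powr ((N - \<alpha>) / 2)\<close>, which is of lower order than the volume.\<close>

lemma mean_powr_tendsto_0:
  fixes f :: "real ^ 'n \<Rightarrow> real"
  assumes \<alpha>: "0 < \<alpha>" "\<alpha> < real CARD('n)" and [measurable]: "f \<in> borel_measurable borel"
    and fin: "kernel_energy (riesz_potential (\<alpha> / 2)) p f < \<infinity>"
  shows "(ball_mean (\<lambda>x. ennreal (\<bar>f x\<bar> powr p)) \<longlongrightarrow> 0) at_top"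
proof -
  define N where "N = real CARD('n)"
  define s where "s = N - \<alpha> / 2"
  define c where "c = riesz_const TYPE('n) (\<alpha> / 2)"
  let ?k = "riesz_potential (\<alpha> / 2) :: real ^ 'n \<Rightarrow> real"
  let ?F = "\<lambda>x. ennreal (\<bar>f x\<bar> powr p)"
  have c: "0 < c" unfolding c_def using \<alpha> by (intro riesz_const_pos) auto
  have s: "0 < s" using \<alpha> by (auto simp: s_def N_def)
  have k: "?k x = c * norm x powr (- s)" for x by (simp add: riesz_potential_def s_def c_def N_def)
  obtain \<omega> where \<omega>: "0 < \<omega>" "\<And>R. 0 \<le> R \<Longrightarrow> emeasure lborel (cball (0 :: real ^ 'n) R) = ennreal (\<omega> * R ^ CARD('n))"
    by (rule ball_volume) blast
  obtain e where e: "0 \<le> e" "kernel_energy ?k p f = ennreal e"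
    using fin by (cases "kernel_energy ?k p f") auto
  define J where "J R = (\<integral>\<^sup>+x. ?F x * indicator (cball 0 R) x \<partial>lborel)" for R
  define K where "K = e * 2 powr (2 * s) / (\<omega> * c\<^sup>2)"
  have K0: "0 \<le> K" using e \<omega> by (simp add: K_def)
  have bound: "ennreal (1 / R ^ CARD('n)) * J R \<le> ennreal (sqrt (K * R powr (- (N + \<alpha>))))" if R: "0 < R" for R
  proof -
    define m where "m = c * (2 * R) powr (- s)"
    have m: "0 < m" using c R by (simp add: m_def)
    have low: "ennreal m * J R \<le> nnconv ?k ?F x" if x: "norm x \<le> R" for x
    proof -
      have "ennreal m * J R = (\<integral>\<^sup>+y. ennreal m * (?F y * indicator (cball 0 R) y) \<partial>lborel)"
        unfolding J_def by (rule nn_integral_cmult[symmetric]) measurable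
      also have "\<dots> \<le> nnconv ?k ?F x"
        unfolding nnconv_def
      proof (rule nn_integral_mono_AE)
        \<comment> \<open>The kernel has the value \<open>0\<close> at the origin, so the lower bound fails at the single point \<open>y = x\<close>.\<close>
        have "AE y in lborel. y \<noteq> x" by (rule AE_lborel_singleton)
        then show "AE y in lborel. ennreal m * (?F y * indicator (cball 0 R) y) \<le> ennreal (?k (x - y)) * ?F y"
        proof eventually_elim
          case (elim y)
          show ?case
          proof (cases "norm y \<le> R")
            case True
            have "norm (x - y) \<le> 2 * R" using True x norm_triangle_ineq4[of x y] by simp
            then have "(2 * R) powr (- s) \<le> norm (x - y) powr (- s)"
              using elim s by (intro powr_mono2') auto
            then have "m \<le> ?k (x - y)" using c by (simp add: m_def k)
            then show ?thesis using True by (auto intro!: mult_right_mono ennreal_leI)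
          qed simp
        qed
      qed
      finally show ?thesis .
    qed
    have "ennreal (\<omega> * R ^ CARD('n)) * (ennreal m * J R)\<^sup>2
        = (\<integral>\<^sup>+x. (ennreal m * J R)\<^sup>2 * indicator (cball (0 :: real ^ 'n) R) x \<partial>lborel)"
      using R by (subst nn_integral_cmult_indicator) (simp_all add: \<omega>(2) mult.commute)
    also have "\<dots> \<le> kernel_energy ?k p f"
      unfolding kernel_energy_def
    proof (rule nn_integral_mono)
      fix x :: "real ^ 'n"
      show "(ennreal m * J R)\<^sup>2 * indicator (cball 0 R) x \<le> (nnconv ?k ?F x)\<^sup>2"
        using low[of x] by (auto simp: indicator_def intro!: power_mono)
    qed
    finally have le: "ennreal (\<omega> * R ^ CARD('n)) * (ennreal m * J R)\<^sup>2 \<le> ennreal e" by (simp add: e)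
    define X where "X = ennreal (1 / R ^ CARD('n)) * J R"
    define a where "a = (\<omega> * R ^ CARD('n)) * (m * R ^ CARD('n))\<^sup>2"
    have a: "0 < a" using \<omega> R m by (simp add: a_def)
    have JX: "J R = ennreal (R ^ CARD('n)) * X"
      using R by (simp add: X_def mult.assoc[symmetric] ennreal_mult[symmetric])
    have "ennreal a * X\<^sup>2 \<le> ennreal e"
    proof -
      have "ennreal (\<omega> * R ^ CARD('n)) * (ennreal m * J R)\<^sup>2 = ennreal a * X\<^sup>2"
        unfolding JX a_def using \<omega> R m
        by (simp add: ennreal_mult power_mult_distrib ennreal_power[symmetric] mult_ac)
      with le show ?thesis by simp
    qed
    then have "ennreal (1 / a) * (ennreal a * X\<^sup>2) \<le> ennreal (1 / a) * ennreal e"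
      by (rule mult_left_mono) simp
    then have "X\<^sup>2 \<le> ennreal (e / a)"
      using a e by (simp add: mult.assoc[symmetric] ennreal_mult[symmetric])
    also have "e / a = K * R powr (- (N + \<alpha>))"
    proof -
      have Rn: "R ^ CARD('n) = R powr N" using R by (simp add: N_def powr_realpow)
      have "a = \<omega> * c\<^sup>2 * (R powr N * (2 * R) powr (- s) * (2 * R) powr (- s) * R powr N * R powr N)"
        by (simp add: a_def m_def Rn power2_eq_square mult_ac)
      also have "R powr N * (2 * R) powr (- s) * (2 * R) powr (- s) * R powr N * R powr N
          = 2 powr (- (2 * s)) * R powr (N + \<alpha>)"
      proof -
        have "R powr N * (2 * R) powr (- s) * (2 * R) powr (- s) * R powr N * R powr N
            = (2 powr (- s) * 2 powr (- s)) * (R powr N * R powr (- s) * R powr (- s) * R powr N * R powr N)"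
          using R by (simp only: powr_mult) (simp only: mult_ac)
        also have "2 powr (- s) * 2 powr (- s) = (2::real) powr (- (2 * s))"
          by (simp add: powr_add[symmetric])
        also have "R powr N * R powr (- s) * R powr (- s) * R powr N * R powr N = R powr (N + \<alpha>)"
          by (simp add: powr_add[symmetric] s_def add.commute)
        finally show ?thesis .
      qed
      finally have aeq: "a = \<omega> * c\<^sup>2 * (2 powr (- (2 * s)) * R powr (N + \<alpha>))" .
      show ?thesis
        unfolding aeq K_def powr_minus using \<omega>(1) c R by (simp add: divide_inverse)
    qed
    finally show ?thesis
      unfolding X_def[symmetric] using K0 by (intro ennreal_le_of_square_le) auto
  qed
  have "((\<lambda>R. K * R powr (- (N + \<alpha>))) \<longlongrightarrow> K * 0) at_top"
    using \<alpha> by (intro tendsto_intros tendsto_neg_powr filterlim_ident) (auto simp: N_def)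
  then have "((\<lambda>R. ennreal (sqrt (K * R powr (- (N + \<alpha>))))) \<longlongrightarrow> ennreal (sqrt 0)) at_top"
    by (intro tendsto_ennrealI tendsto_real_sqrt) simp
  then have lim: "((\<lambda>R. ennreal (sqrt (K * R powr (- (N + \<alpha>))))) \<longlongrightarrow> 0) at_top" by simp
  show ?thesis
    unfolding J_def[symmetric]
  proof (rule tendsto_sandwich[OF _ _ tendsto_const lim])
    show "\<forall>\<^sub>F R in at_top. ennreal (1 / R ^ CARD('n)) * J R \<le> ennreal (sqrt (K * R powr (- (N + \<alpha>))))"
      using eventually_gt_at_top[of 0] by eventually_elim (rule bound)
  qed simp
qed

text \<open>For a bounded function the decay passes from the means of the \<open>p\<close>-th powers to those of the
  squares, whatever \<open>p\<close> is: where \<open>\<bar>w\<bar> \<le> \<epsilon>\<close> the square is small, and elsewhere it is at most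
  \<open>K\<^sup>2 (\<bar>w\<bar> / \<epsilon>)\<^sup>p\<close>.\<close>

lemma mean_square_tendsto_0:
  fixes w :: "real ^ 'n \<Rightarrow> real"
  assumes \<alpha>: "0 < \<alpha>" "\<alpha> < real CARD('n)" and p: "1 \<le> p"
    and [measurable]: "w \<in> borel_measurable borel" and K: "\<And>x. \<bar>w x\<bar> \<le> K"
    and fin: "kernel_energy (riesz_potential (\<alpha> / 2)) p w < \<infinity>"
  shows "(ball_mean (\<lambda>x. ennreal ((w x)\<^sup>2)) \<longlongrightarrow> 0) at_top"
proof (rule tendsto_0I_ennreal)
  fix e :: real assume e: "0 < e"
  obtain \<omega> where \<omega>: "0 < \<omega>" "\<And>R. 0 \<le> R \<Longrightarrow> emeasure lborel (cball (0 :: real ^ 'n) R) = ennreal (\<omega> * R ^ CARD('n))"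
    by (rule ball_volume) blast
  define d where "d = sqrt (e / (2 * \<omega>))"
  have d: "0 < d" "d\<^sup>2 * \<omega> = e / 2" using e \<omega> by (auto simp: d_def)
  \<comment> \<open>The summand \<open>1\<close> keeps \<open>B\<close> positive when \<open>K = 0\<close>.\<close>
  define B where "B = K\<^sup>2 / d powr p + 1"
  have B: "0 < B" using d by (simp add: B_def add_nonneg_pos)
  have pw: "(w x)\<^sup>2 \<le> d\<^sup>2 + B * \<bar>w x\<bar> powr p" for x
  proof (cases "\<bar>w x\<bar> \<le> d")
    case True
    then have "(w x)\<^sup>2 \<le> d\<^sup>2" using power_mono[of "\<bar>w x\<bar>" d 2] by simp
    then show ?thesis using B by (simp add: add_increasing2)
  next
    case False
    have "(w x)\<^sup>2 \<le> K\<^sup>2" using K[of x] power_mono[of "\<bar>w x\<bar>" K 2] by simp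
    also have "\<dots> = K\<^sup>2 / d powr p * d powr p" using d by simp
    also have "\<dots> \<le> B * \<bar>w x\<bar> powr p"
      using False d p by (intro mult_mono powr_mono2) (auto simp: B_def)
    finally show ?thesis by (simp add: add_increasing)
  qed
  let ?M = "\<lambda>R. ball_mean (\<lambda>x. ennreal (\<bar>w x\<bar> powr p)) R"
  have bound: "ball_mean (\<lambda>x. ennreal ((w x)\<^sup>2)) R
      \<le> ennreal (e / 2) + ennreal B * ?M R" if R: "0 < R" for R
  proof -
    have "(\<integral>\<^sup>+x. ennreal ((w x)\<^sup>2) * indicator (cball 0 R) x \<partial>lborel)
        \<le> (\<integral>\<^sup>+x. ennreal (d\<^sup>2) * indicator (cball 0 R) x
            + ennreal B * (ennreal (\<bar>w x\<bar> powr p) * indicator (cball 0 R) x) \<partial>lborel)"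
    proof (rule nn_integral_mono)
      fix x
      show "ennreal ((w x)\<^sup>2) * indicator (cball 0 R) x \<le> ennreal (d\<^sup>2) * indicator (cball 0 R) x
            + ennreal B * (ennreal (\<bar>w x\<bar> powr p) * indicator (cball 0 R) x)"
        using ennreal_leI[OF pw[of x]] B
        by (auto simp: indicator_def ennreal_mult[symmetric] ennreal_plus[symmetric] simp del: ennreal_plus)
    qed
    also have "\<dots> = ennreal (d\<^sup>2) * emeasure lborel (cball (0 :: real ^ 'n) R)
        + ennreal B * (\<integral>\<^sup>+x. ennreal (\<bar>w x\<bar> powr p) * indicator (cball 0 R) x \<partial>lborel)"
      by (subst nn_integral_add) (auto simp: nn_integral_cmult nn_integral_cmult_indicator)
    finally have "ball_mean (\<lambda>x. ennreal ((w x)\<^sup>2)) R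
      \<le> ennreal (1 / R ^ CARD('n)) * (ennreal (d\<^sup>2) * emeasure lborel (cball (0 :: real ^ 'n) R)
        + ennreal B * (\<integral>\<^sup>+x. ennreal (\<bar>w x\<bar> powr p) * indicator (cball 0 R) x \<partial>lborel))"
      by (rule mult_left_mono) simp
    also have "\<dots> = ennreal (1 / R ^ CARD('n)) * (ennreal (d\<^sup>2) * ennreal (\<omega> * R ^ CARD('n))) + ennreal B * ?M R"
      using R by (simp add: \<omega>(2) distrib_left mult.left_commute)
    also have "ennreal (1 / R ^ CARD('n)) * (ennreal (d\<^sup>2) * ennreal (\<omega> * R ^ CARD('n))) = ennreal (e / 2)"
      using R \<omega>(1) by (simp add: ennreal_mult[symmetric] mult.assoc[symmetric] flip: d(2))
    finally show ?thesis .
  qed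
  have "((\<lambda>R. ennreal B * ?M R) \<longlongrightarrow> ennreal B * 0) at_top"
    by (intro ennreal_tendsto_cmult mean_powr_tendsto_0[OF \<alpha> _ fin]) auto
  then have "eventually (\<lambda>R. ennreal B * ?M R < ennreal (e / 2)) at_top"
    using e by (intro order_tendstoD(2)) auto
  then show "\<forall>\<^sub>F R in at_top. ball_mean (\<lambda>x. ennreal ((w x)\<^sup>2)) R < ennreal e"
    using eventually_gt_at_top[of 0]
  proof eventually_elim
    case (elim R)
    note bound[OF elim(2)]
    also have "ennreal (e / 2) + ennreal B * ?M R < ennreal (e / 2) + ennreal (e / 2)"
      using elim(1) by (simp add: ennreal_add_left_cancel_less)
    also have "\<dots> = ennreal e"
      using e by (simp add: ennreal_plus[symmetric] del: ennreal_plus)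
    finally show ?case .
  qed
qed

section \<open>Square means over large annuli\<close>

abbreviation annulus :: "real \<Rightarrow> (real ^ 'n) set" where
  "annulus R \<equiv> cball 0 (3 * R) - ball 0 R"

lemma nn_integral_powr_tail:
  assumes R: "0 < R"
  shows "(\<integral>\<^sup>+s. ennreal (s powr (- 3 / 2)) * indicator {R..} s \<partial>lborel) = ennreal (2 * R powr (- 1 / 2))"
proof -
  have "(\<integral>\<^sup>+s. ennreal (s powr (- 3 / 2)) * indicator {R..} s \<partial>lborel)
      = ennreal (0 - (- 2 * R powr (- 1 / 2)))"
  proof (rule nn_integral_FTC_atLeast)
    fix s :: real assume s: "R \<le> s"
    then show "((\<lambda>s. - 2 * s powr (- 1 / 2)) has_real_derivative s powr (- 3 / 2)) (at s)"
      using R by (auto intro!: derivative_eq_intros)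
  next
    have "((\<lambda>s::real. - 2 * s powr (- 1 / 2)) \<longlongrightarrow> - 2 * 0) at_top"
      by (intro tendsto_intros tendsto_neg_powr filterlim_ident) simp
    then show "((\<lambda>s::real. - 2 * s powr (- 1 / 2)) \<longlongrightarrow> 0) at_top" by simp
  qed auto
  then show ?thesis by simp
qed

text \<open>The fundamental theorem of calculus along the ray through \<open>x\<close>, followed by the
  Cauchy-Schwarz inequality with weight \<open>s powr (3/2)\<close>. This weight grows fast enough for its
  reciprocal to be integrable at infinity, and slowly enough for \<open>s powr (3/2 - N)\<close> to be
  integrable there as soon as \<open>N \<ge> 3\<close>.\<close>

lemma ray_estimate:
  fixes w :: "real ^ 'n \<Rightarrow> real"
  assumes w: "smooth w" and R: "0 < R" "R \<le> L" and x: "norm x \<le> 3"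
  shows "ennreal ((w (R *\<^sub>R x) - w (L *\<^sub>R x))\<^sup>2) \<le> ennreal (2 * R powr (- 1 / 2)) *
    (\<integral>\<^sup>+s. ennreal (9 * s powr (3 / 2)) * ennreal ((norm (gradient w (s *\<^sub>R x)))\<^sup>2) * indicator {R..} s \<partial>lborel)"
proof -
  have [measurable]: "gradient w \<in> borel_measurable borel" using w by (rule measurable_gradient)
  define h' where "h' s = gradient w (s *\<^sub>R x) \<bullet> x" for s
  have [measurable]: "h' \<in> borel_measurable borel" unfolding h'_def[abs_def] by measurable
  have hd: "((\<lambda>s. w (s *\<^sub>R x)) has_vector_derivative h' s) (at s within S)" for s S
  proof -
    have "((\<lambda>s. w (s *\<^sub>R x)) has_derivative (\<lambda>d. gradient w (s *\<^sub>R x) \<bullet> (d *\<^sub>R x))) (at s within S)"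
      by (rule has_derivative_compose[where f="\<lambda>s. s *\<^sub>R x" and g=w, OF _ smooth_has_derivative[OF w]])
        (auto intro!: derivative_eq_intros)
    then show ?thesis by (simp add: has_vector_derivative_def h'_def)
  qed
  have hc: "continuous_on {R..L} h'"
    unfolding h'_def
    by (intro continuous_intros continuous_on_compose2[OF continuous_gradient[OF w]]) auto
  have hi: "integrable lborel (\<lambda>s. indicator {R..L} s *\<^sub>R h' s)"
    using hc by (intro borel_integrable_compact) auto
  have "(\<integral>s. indicator {R..L} s *\<^sub>R h' s \<partial>lborel) = w (L *\<^sub>R x) - w (R *\<^sub>R x)"
    by (rule integral_FTC_atLeastAtMost[OF R(2) hd hc])
  then have "ennreal \<bar>w (R *\<^sub>R x) - w (L *\<^sub>R x)\<bar> = ennreal (norm (\<integral>s. indicator {R..L} s *\<^sub>R h' s \<partial>lborel))"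
    by (simp add: abs_minus_commute)
  also have "\<dots> \<le> (\<integral>\<^sup>+s. ennreal (norm (indicator {R..L} s *\<^sub>R h' s)) \<partial>lborel)"
    by (rule integral_norm_bound_ennreal[OF hi])
  also have "\<dots> \<le> (\<integral>\<^sup>+s. (ennreal (s powr (- 3 / 4)) * indicator {R..} s)
      * (ennreal (s powr (3 / 4) * \<bar>h' s\<bar>) * indicator {R..} s) \<partial>lborel)"
  proof (rule nn_integral_mono)
    fix s :: real
    show "ennreal (norm (indicator {R..L} s *\<^sub>R h' s)) \<le> (ennreal (s powr (- 3 / 4)) * indicator {R..} s)
      * (ennreal (s powr (3 / 4) * \<bar>h' s\<bar>) * indicator {R..} s)"
    proof (cases "s \<in> {R..L}")
      case True
      then have s: "0 < s" using R by simp
      have "s powr (- 3 / 4) * (s powr (3 / 4) * \<bar>h' s\<bar>) = \<bar>h' s\<bar>"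
        using s by (simp add: mult.assoc[symmetric] powr_add[symmetric])
      then have "ennreal (s powr (- 3 / 4)) * ennreal (s powr (3 / 4) * \<bar>h' s\<bar>) = ennreal \<bar>h' s\<bar>"
        by (simp add: ennreal_mult[symmetric])
      then show ?thesis using True by simp
    qed simp
  qed
  finally have "(ennreal \<bar>w (R *\<^sub>R x) - w (L *\<^sub>R x)\<bar>)\<^sup>2 \<le> (\<integral>\<^sup>+s. (ennreal (s powr (- 3 / 4)) * indicator {R..} s)
      * (ennreal (s powr (3 / 4) * \<bar>h' s\<bar>) * indicator {R..} s) \<partial>lborel)\<^sup>2"
    by (intro power_mono) auto
  also have "\<dots> \<le> (\<integral>\<^sup>+s. (ennreal (s powr (- 3 / 4)) * indicator {R..} s)\<^sup>2 \<partial>lborel)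
      * (\<integral>\<^sup>+s. (ennreal (s powr (3 / 4) * \<bar>h' s\<bar>) * indicator {R..} s)\<^sup>2 \<partial>lborel)"
    by (rule Cauchy_Schwarz_nn_integral) measurable
  also have "(\<integral>\<^sup>+s. (ennreal (s powr (- 3 / 4)) * indicator {R..} s)\<^sup>2 \<partial>lborel) = ennreal (2 * R powr (- 1 / 2))"
  proof -
    have "(ennreal (s powr (- 3 / 4)) * indicator {R..} s)\<^sup>2 = ennreal (s powr (- 3 / 2)) * indicator {R..} s" for s :: real
      by (auto simp: indicator_def power2_eq_square powr_add[symmetric] ennreal_mult[symmetric])
    then show ?thesis using nn_integral_powr_tail[OF R(1)] by simp
  qed
  also have "(\<integral>\<^sup>+s. (ennreal (s powr (3 / 4) * \<bar>h' s\<bar>) * indicator {R..} s)\<^sup>2 \<partial>lborel)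
      \<le> (\<integral>\<^sup>+s. ennreal (9 * s powr (3 / 2)) * ennreal ((norm (gradient w (s *\<^sub>R x)))\<^sup>2) * indicator {R..} s \<partial>lborel)"
  proof (rule nn_integral_mono)
    fix s :: real
    have "\<bar>h' s\<bar> \<le> norm (gradient w (s *\<^sub>R x)) * norm x"
      unfolding h'_def by (rule Cauchy_Schwarz_ineq2)
    also have "\<dots> \<le> norm (gradient w (s *\<^sub>R x)) * 3"
      using x by (intro mult_left_mono) auto
    finally have "\<bar>h' s\<bar>\<^sup>2 \<le> (norm (gradient w (s *\<^sub>R x)) * 3)\<^sup>2"
      by (intro power_mono) auto
    then have "s powr (3 / 2) * \<bar>h' s\<bar>\<^sup>2 \<le> s powr (3 / 2) * (norm (gradient w (s *\<^sub>R x)) * 3)\<^sup>2"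
      by (intro mult_left_mono) auto
    moreover have "(s powr (3 / 4) * \<bar>h' s\<bar>)\<^sup>2 = s powr (3 / 2) * \<bar>h' s\<bar>\<^sup>2"
      by (simp add: power_mult_distrib) (simp add: power2_eq_square powr_add[symmetric])
    moreover have "s powr (3 / 2) * (norm (gradient w (s *\<^sub>R x)) * 3)\<^sup>2
        = 9 * s powr (3 / 2) * (norm (gradient w (s *\<^sub>R x)))\<^sup>2"
      by (simp add: power_mult_distrib)
    ultimately have "(s powr (3 / 4) * \<bar>h' s\<bar>)\<^sup>2 \<le> 9 * s powr (3 / 2) * (norm (gradient w (s *\<^sub>R x)))\<^sup>2"
      by linarith
    then have "ennreal ((s powr (3 / 4) * \<bar>h' s\<bar>)\<^sup>2) \<le> ennreal (9 * s powr (3 / 2)) * ennreal ((norm (gradient w (s *\<^sub>R x)))\<^sup>2)"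
      by (simp add: ennreal_mult[symmetric] ennreal_leI)
    then show "(ennreal (s powr (3 / 4) * \<bar>h' s\<bar>) * indicator {R..} s)\<^sup>2
      \<le> ennreal (9 * s powr (3 / 2)) * ennreal ((norm (gradient w (s *\<^sub>R x)))\<^sup>2) * indicator {R..} s"
      by (simp add: indicator_def ennreal_power)
  qed
  finally show ?thesis
    by (simp add: ennreal_power mult_left_mono)
qed

lemma nn_integral_annulus_scale:
  fixes F :: "real ^ 'n \<Rightarrow> ennreal"
  assumes [measurable]: "F \<in> borel_measurable borel" and r: "0 < r"
  shows "(\<integral>\<^sup>+x. F (r *\<^sub>R x) * indicator (annulus 1) x \<partial>lborel)
    = ennreal (1 / r ^ CARD('n)) * (\<integral>\<^sup>+x. F x * indicator (annulus r) x \<partial>lborel)"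
proof -
  have "(\<integral>\<^sup>+x. F x * indicator (annulus r) x \<partial>lborel)
    = ennreal (\<bar>r\<bar> ^ CARD('n)) * (\<integral>\<^sup>+x. F (0 + r *\<^sub>R x) * indicator (annulus r) (0 + r *\<^sub>R x) \<partial>lborel)"
    by (rule nn_integral_lborel_affine) (use r in auto)
  also have "(\<lambda>x. F (0 + r *\<^sub>R x) * indicator (annulus r) (0 + r *\<^sub>R x)) = (\<lambda>x. F (r *\<^sub>R x) * indicator (annulus 1) x)"
    using r by (intro ext) (auto simp: indicator_def)
  finally show ?thesis
    using r by (simp add: mult.assoc[symmetric] ennreal_mult[symmetric])
qed

text \<open>The ray estimate is integrated over the annulus \<open>1 \<le> \<bar>x\<bar> \<le> 3\<close>. Rescaling the inner integral by \<open>s\<close>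
  produces a factor \<open>s powr (- N)\<close> and an integral over a region outside the ball of radius \<open>R\<close>. The
  resulting bound does not depend on \<open>L\<close>, so the term with \<open>w (L x)\<close> can be removed by letting
  \<open>L \<rightarrow> \<infinity>\<close>.\<close>

lemma annulus_estimate:
  fixes w :: "real ^ 'n \<Rightarrow> real"
  assumes w: "smooth w" and N: "3 \<le> CARD('n)" and R: "0 < R"
    and mean: "(ball_mean (\<lambda>x. ennreal ((w x)\<^sup>2)) \<longlongrightarrow> 0) at_top"
  shows "(\<integral>\<^sup>+x. ennreal ((w x)\<^sup>2) * indicator (annulus R) x \<partial>lborel)
    \<le> ennreal (72 * R\<^sup>2) * (\<integral>\<^sup>+x. ennreal ((norm (gradient w x))\<^sup>2) * indicator (- ball 0 R) x \<partial>lborel)"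
proof -
  note [measurable] = smooth_measurable[OF w] measurable_gradient[OF w]
  define D where "D = (\<integral>\<^sup>+x. ennreal ((norm (gradient w x))\<^sup>2) * indicator (- ball 0 R) x \<partial>lborel)"
  define P where "P r = (\<integral>\<^sup>+x. ennreal ((w (r *\<^sub>R x))\<^sup>2) * indicator (annulus 1) x \<partial>lborel)" for r
  have P: "P r = ennreal (1 / r ^ CARD('n)) * (\<integral>\<^sup>+x. ennreal ((w x)\<^sup>2) * indicator (annulus r) x \<partial>lborel)"
    if "0 < r" for r
    unfolding P_def by (rule nn_integral_annulus_scale[OF _ that]) measurable
  define c where "c = 2 * R powr (- 1 / 2)"
  have c: "0 < c" using R by (simp add: c_def)
  let ?G = "\<lambda>s x. ennreal ((norm (gradient w (s *\<^sub>R x)))\<^sup>2)"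
  define H where "H = (\<integral>\<^sup>+x. (\<integral>\<^sup>+s. ennreal (9 * s powr (3 / 2)) * ?G s x * indicator {R..} s \<partial>lborel)
      * indicator (annulus 1) x \<partial>lborel)"
  have H: "H \<le> ennreal (9 * R powr (3 - real CARD('n)) * c) * D"
  proof -
    have "H = (\<integral>\<^sup>+x. (\<integral>\<^sup>+s. ennreal (9 * s powr (3 / 2)) * ?G s x * indicator {R..} s
        * indicator (annulus 1) x \<partial>lborel) \<partial>lborel)"
      unfolding H_def by (intro nn_integral_cong nn_integral_multc[symmetric]) measurable
    also have "\<dots> = (\<integral>\<^sup>+s. (\<integral>\<^sup>+x. ennreal (9 * s powr (3 / 2)) * ?G s x * indicator {R..} s
        * indicator (annulus 1) x \<partial>lborel) \<partial>lborel)"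
      by (rule lborel_pair.Fubini'[symmetric]) measurable
    also have "\<dots> \<le> (\<integral>\<^sup>+s. ennreal (9 * R powr (3 - real CARD('n))) * D
        * (ennreal (s powr (- 3 / 2)) * indicator {R..} s) \<partial>lborel)"
    proof (rule nn_integral_mono)
      fix s :: real
      show "(\<integral>\<^sup>+x. ennreal (9 * s powr (3 / 2)) * ?G s x * indicator {R..} s * indicator (annulus 1) x \<partial>lborel)
        \<le> ennreal (9 * R powr (3 - real CARD('n))) * D * (ennreal (s powr (- 3 / 2)) * indicator {R..} s)"
      proof (cases "R \<le> s")
        case True
        then have s: "0 < s" using R by simp
        have "(\<integral>\<^sup>+x. ennreal (9 * s powr (3 / 2)) * ?G s x * indicator {R..} s * indicator (annulus 1) x \<partial>lborel)
          = ennreal (9 * s powr (3 / 2)) * (\<integral>\<^sup>+x. ?G s x * indicator (annulus 1) x \<partial>lborel)"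
          using True by (simp add: mult.assoc nn_integral_cmult)
        also have "(\<integral>\<^sup>+x. ?G s x * indicator (annulus 1) x \<partial>lborel)
          = ennreal (1 / s ^ CARD('n)) * (\<integral>\<^sup>+x. ennreal ((norm (gradient w x))\<^sup>2) * indicator (annulus s) x \<partial>lborel)"
          by (rule nn_integral_annulus_scale[OF _ s, of "\<lambda>x. ennreal ((norm (gradient w x))\<^sup>2)"]) measurable
        also have "(\<integral>\<^sup>+x. ennreal ((norm (gradient w x))\<^sup>2) * indicator (annulus s) x \<partial>lborel) \<le> D"
          unfolding D_def using True by (intro nn_integral_mono) (auto simp: indicator_def)
        also have "ennreal (9 * s powr (3 / 2)) * (ennreal (1 / s ^ CARD('n)) * D)
          = ennreal (9 * s powr (3 / 2) * (1 / s ^ CARD('n))) * D"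
        proof -
          have "ennreal (9 * s powr (3 / 2) * (1 / s ^ CARD('n))) = ennreal (9 * s powr (3 / 2)) * ennreal (1 / s ^ CARD('n))"
            using s by (intro ennreal_mult) auto
          then show ?thesis by (simp only: mult.assoc)
        qed
        also have "9 * s powr (3 / 2) * (1 / s ^ CARD('n)) = 9 * s powr (3 - real CARD('n)) * s powr (- 3 / 2)"
        proof -
          have "1 / s ^ CARD('n) = s powr (- real CARD('n))"
            using s by (simp add: powr_minus powr_realpow divide_inverse)
          then show ?thesis by (simp add: powr_add[symmetric] mult.assoc)
        qed
        also have "ennreal (9 * s powr (3 - real CARD('n)) * s powr (- 3 / 2)) * D
          \<le> ennreal (9 * R powr (3 - real CARD('n)) * s powr (- 3 / 2)) * D"
          using True R N by (intro mult_right_mono ennreal_leI mult_left_mono powr_mono2') auto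
        also have "\<dots> = ennreal (9 * R powr (3 - real CARD('n))) * D * (ennreal (s powr (- 3 / 2)) * indicator {R..} s)"
          using True by (simp add: ennreal_mult mult_ac)
        finally show ?thesis by (simp add: mult_left_mono)
      qed simp
    qed
    also have "\<dots> = ennreal (9 * R powr (3 - real CARD('n))) * D * ennreal c"
      unfolding c_def nn_integral_powr_tail[OF R, symmetric] by (rule nn_integral_cmult) measurable
    also have "\<dots> = ennreal (9 * R powr (3 - real CARD('n)) * c) * D"
      using c by (simp add: ennreal_mult mult_ac)
    finally show ?thesis .
  qed
  have step: "P R \<le> 2 * P L + ennreal (72 * R\<^sup>2 / R ^ CARD('n)) * D" if L: "R \<le> L" for L
  proof -
    have "P R \<le> (\<integral>\<^sup>+x. 2 * (ennreal ((w (L *\<^sub>R x))\<^sup>2) * indicator (annulus 1) x)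
        + 2 * (ennreal c * ((\<integral>\<^sup>+s. ennreal (9 * s powr (3 / 2)) * ?G s x * indicator {R..} s \<partial>lborel)
      * indicator (annulus 1) x)) \<partial>lborel)"
      unfolding P_def
    proof (rule nn_integral_mono)
      fix x :: "real ^ 'n"
      show "ennreal ((w (R *\<^sub>R x))\<^sup>2) * indicator (annulus 1) x
        \<le> 2 * (ennreal ((w (L *\<^sub>R x))\<^sup>2) * indicator (annulus 1) x)
        + 2 * (ennreal c * ((\<integral>\<^sup>+s. ennreal (9 * s powr (3 / 2)) * ?G s x * indicator {R..} s \<partial>lborel)
          * indicator (annulus 1) x))"
      proof (cases "x \<in> annulus 1")
        case True
        then have x: "norm x \<le> 3" by simp
        let ?a = "w (R *\<^sub>R x)" and ?b = "w (L *\<^sub>R x)"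
        have "?a\<^sup>2 \<le> 2 * ?b\<^sup>2 + 2 * (?a - ?b)\<^sup>2"
          using sum_squares_ge_zero[of "?a - 2 * ?b" 0] by (simp add: power2_eq_square algebra_simps)
        then have "ennreal (?a\<^sup>2) \<le> ennreal (2 * ?b\<^sup>2 + 2 * (?a - ?b)\<^sup>2)"
          by (rule ennreal_leI)
        also have "\<dots> = 2 * ennreal (?b\<^sup>2) + 2 * ennreal ((?a - ?b)\<^sup>2)"
          by (simp add: ennreal_mult)
        also have "\<dots> \<le> 2 * ennreal (?b\<^sup>2) + 2 * (ennreal c *
            (\<integral>\<^sup>+s. ennreal (9 * s powr (3 / 2)) * ?G s x * indicator {R..} s \<partial>lborel))"
          unfolding c_def by (intro add_left_mono mult_left_mono ray_estimate w R L x) simp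
        finally show ?thesis using True by simp
      qed simp
    qed
    also have "\<dots> = 2 * P L + 2 * (ennreal c * H)"
      unfolding P_def H_def
      by (subst nn_integral_add) (simp_all add: nn_integral_cmult)
    also have "\<dots> \<le> 2 * P L + 2 * (ennreal c * (ennreal (9 * R powr (3 - real CARD('n)) * c) * D))"
      by (intro add_left_mono mult_left_mono H) auto
    also have "2 * (ennreal c * (ennreal (9 * R powr (3 - real CARD('n)) * c) * D))
        = ennreal (2 * (c * (9 * R powr (3 - real CARD('n)) * c))) * D"
    proof -
      have *: "ennreal (2 * (c * B)) = 2 * (ennreal c * ennreal B)" if "0 \<le> B" for B
        using c that by (simp add: ennreal_mult)
      have B: "0 \<le> 9 * R powr (3 - real CARD('n)) * c" using c by simp
      show ?thesis
        unfolding *[OF B] by (simp only: mult.assoc)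
    qed
    also have "2 * (c * (9 * R powr (3 - real CARD('n)) * c)) = 72 * R\<^sup>2 / R ^ CARD('n)"
    proof -
      have "2 * (c * (9 * R powr (3 - real CARD('n)) * c))
        = 72 * (R powr (- 1 / 2) * R powr (- 1 / 2) * R powr (3 - real CARD('n)))"
        by (simp add: c_def mult_ac)
      also have "R powr (- 1 / 2) * R powr (- 1 / 2) * R powr (3 - real CARD('n)) = R powr (2 - real CARD('n))"
        by (simp only: powr_add[symmetric]) simp
      also have "\<dots> = R\<^sup>2 / R ^ CARD('n)"
        using R by (simp add: powr_diff powr_realpow)
      finally show ?thesis by simp
    qed
    finally show ?thesis .
  qed
  have "((\<lambda>L. 2 * P L + ennreal (72 * R\<^sup>2 / R ^ CARD('n)) * D)
      \<longlongrightarrow> 2 * 0 + ennreal (72 * R\<^sup>2 / R ^ CARD('n)) * D) at_top"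
  proof (intro tendsto_add tendsto_const ennreal_tendsto_cmult)
    let ?M = "\<lambda>R. ball_mean (\<lambda>x. ennreal ((w x)\<^sup>2)) R"
    have "filterlim (\<lambda>L::real. 3 * L) at_top at_top"
      by (rule filterlim_tendsto_pos_mult_at_top[OF tendsto_const _ filterlim_ident]) simp
    then have "((\<lambda>L. ?M (3 * L)) \<longlongrightarrow> 0) at_top"
      by (rule filterlim_compose[OF mean])
    then have lim: "((\<lambda>L. ennreal (3 ^ CARD('n)) * ?M (3 * L)) \<longlongrightarrow> ennreal (3 ^ CARD('n)) * 0) at_top"
      by (intro ennreal_tendsto_cmult) auto
    show "(P \<longlongrightarrow> 0) at_top"
    proof (rule tendsto_sandwich[OF _ _ tendsto_const lim[unfolded mult_zero_right]])
      show "\<forall>\<^sub>F L in at_top. P L \<le> ennreal (3 ^ CARD('n)) * ?M (3 * L)"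
        using eventually_gt_at_top[of 0]
      proof eventually_elim
        case (elim L)
        have "P L \<le> ennreal (1 / L ^ CARD('n)) * (\<integral>\<^sup>+x. ennreal ((w x)\<^sup>2) * indicator (cball 0 (3 * L)) x \<partial>lborel)"
          unfolding P[OF elim] by (intro mult_left_mono nn_integral_mono) (auto simp: indicator_def)
        also have "ennreal (1 / L ^ CARD('n)) = ennreal (3 ^ CARD('n)) * ennreal (1 / (3 * L) ^ CARD('n))"
          using elim by (simp add: ennreal_mult[symmetric] power_mult_distrib)
        finally show ?case by (simp only: mult.assoc)
      qed
    qed simp
  qed simp
  then have "P R \<le> 2 * 0 + ennreal (72 * R\<^sup>2 / R ^ CARD('n)) * D"
    by (rule tendsto_lowerbound[OF _ eventually_mono[OF eventually_ge_at_top step] trivial_limit_at_top_linorder])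
  then have "ennreal (R ^ CARD('n)) * P R \<le> ennreal (R ^ CARD('n)) * (ennreal (72 * R\<^sup>2 / R ^ CARD('n)) * D)"
    by (intro mult_left_mono) auto
  then show ?thesis
    using R by (simp add: P[OF R] D_def[symmetric] mult.assoc[symmetric] ennreal_mult[symmetric])
qed

lemma nn_integral_tail_tendsto_0:
  fixes F :: "real ^ 'n \<Rightarrow> ennreal"
  assumes [measurable]: "F \<in> borel_measurable borel" and fin: "(\<integral>\<^sup>+x. F x \<partial>lborel) < \<infinity>"
  shows "(\<lambda>n. \<integral>\<^sup>+x. F x * indicator (- ball 0 (real n)) x \<partial>lborel) \<longlonglongrightarrow> 0"
proof -
  have "(\<lambda>n. \<integral>\<^sup>+x. F x * indicator (- ball 0 (real n)) x \<partial>lborel) \<longlonglongrightarrow> (\<integral>\<^sup>+(x::real ^ 'n). 0 \<partial>lborel)"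
  proof (rule nn_integral_dominated_convergence[OF _ _ _ _ fin])
    show "AE x in lborel. F x * indicator (- ball 0 (real n)) x \<le> F x" for n
      by (auto simp: indicator_def)
    have "(\<lambda>n. F x * indicator (- ball 0 (real n)) x) \<longlonglongrightarrow> 0" for x
    proof (rule tendsto_eventually)
      obtain K :: nat where "norm x < real K" using reals_Archimedean2 by blast
      then show "eventually (\<lambda>n. F x * indicator (- ball 0 (real n)) x = 0) sequentially"
        by (auto simp: eventually_sequentially intro!: exI[of _ K])
    qed
    then show "AE x in lborel. (\<lambda>n. F x * indicator (- ball 0 (real n)) x) \<longlonglongrightarrow> 0" by simp
  qed auto
  then show ?thesis by simp
qed

text \<open>In dimension at least \<open>3\<close> the previous estimate applies, and the Dirichlet energy outside a large
  ball is small. In lower dimension \<open>1 / R\<^sup>2\<close> is at most a multiple of \<open>1 / R ^ N\<close>, and the decay of the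
  means over balls suffices.\<close>

lemma annulus_tendsto_0:
  fixes w :: "real ^ 'n \<Rightarrow> real"
  assumes w: "smooth w"
    and mean: "(ball_mean (\<lambda>x. ennreal ((w x)\<^sup>2)) \<longlongrightarrow> 0) at_top"
    and fin: "(\<integral>\<^sup>+x. ennreal ((norm (gradient w x))\<^sup>2) \<partial>lborel) < \<infinity>"
  shows "(\<lambda>n. ennreal (1 / (real n)\<^sup>2) *
      (\<integral>\<^sup>+x. ennreal ((w x)\<^sup>2) * indicator (annulus (real n)) x \<partial>lborel)) \<longlonglongrightarrow> 0" (is "?X \<longlonglongrightarrow> 0")
proof (cases "3 \<le> CARD('n)")
  case True
  note [measurable] = smooth_measurable[OF w] measurable_gradient[OF w]
  let ?D = "\<lambda>n. \<integral>\<^sup>+x. ennreal ((norm (gradient w x))\<^sup>2) * indicator (- ball 0 (real n)) x \<partial>lborel"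
  have "(\<lambda>n. ennreal 72 * ?D n) \<longlonglongrightarrow> ennreal 72 * 0"
    by (intro ennreal_tendsto_cmult nn_integral_tail_tendsto_0 fin) auto
  then have lim: "(\<lambda>n. ennreal 72 * ?D n) \<longlonglongrightarrow> 0" by simp
  show ?thesis
  proof (rule tendsto_sandwich[OF _ _ tendsto_const lim])
    show "\<forall>\<^sub>F n in sequentially. ?X n \<le> ennreal 72 * ?D n"
      using eventually_gt_at_top[of 0]
    proof eventually_elim
      case (elim n)
      have "?X n \<le> ennreal (1 / (real n)\<^sup>2) * (ennreal (72 * (real n)\<^sup>2) * ?D n)"
        using elim by (intro mult_left_mono annulus_estimate[OF w True _ mean]) auto
      also have "\<dots> = ennreal 72 * ?D n"
        using elim by (simp add: mult.assoc[symmetric] ennreal_mult[symmetric] del: ennreal_numeral)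
      finally show ?case .
    qed
  qed simp
next
  case False
  let ?M = "\<lambda>R. ball_mean (\<lambda>x. ennreal ((w x)\<^sup>2)) R"
  have "filterlim (\<lambda>n::nat. 3 * real n) at_top sequentially"
    by (rule filterlim_tendsto_pos_mult_at_top[OF tendsto_const _ filterlim_real_sequentially]) simp
  then have "(\<lambda>n. ?M (3 * real n)) \<longlonglongrightarrow> 0"
    by (rule filterlim_compose[OF mean])
  then have "(\<lambda>n. ennreal 9 * ?M (3 * real n)) \<longlonglongrightarrow> ennreal 9 * 0"
    by (intro ennreal_tendsto_cmult) auto
  then have lim: "(\<lambda>n. ennreal 9 * ?M (3 * real n)) \<longlonglongrightarrow> 0" by simp
  show ?thesis
  proof (rule tendsto_sandwich[OF _ _ tendsto_const lim])
    show "\<forall>\<^sub>F n in sequentially. ?X n \<le> ennreal 9 * ?M (3 * real n)"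
      using eventually_gt_at_top[of 0]
    proof eventually_elim
      case (elim n)
      have n: "1 \<le> real n" using elim by simp
      have "1 / (real n)\<^sup>2 \<le> 9 * (1 / (3 * real n) ^ CARD('n))"
      proof -
        have "(3 * real n) ^ CARD('n) \<le> (3 * real n)\<^sup>2"
          using n False by (intro power_increasing) auto
        then have "(3 * real n) ^ CARD('n) \<le> 9 * (real n)\<^sup>2" by (simp add: power_mult_distrib)
        then show ?thesis using n by (simp add: field_simps)
      qed
      then have "ennreal (1 / (real n)\<^sup>2) \<le> ennreal (9 * (1 / (3 * real n) ^ CARD('n)))"
        by (rule ennreal_leI)
      also have "\<dots> = ennreal 9 * ennreal (1 / (3 * real n) ^ CARD('n))"
        by (intro ennreal_mult) auto
      finally have "?X n \<le> (ennreal 9 * ennreal (1 / (3 * real n) ^ CARD('n))) *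
          (\<integral>\<^sup>+x. ennreal ((w x)\<^sup>2) * indicator (cball 0 (3 * real n)) x \<partial>lborel)"
        by (intro mult_mono nn_integral_mono) (auto simp: indicator_def)
      then show ?case by (simp only: mult.assoc)
    qed
  qed simp
qed

section \<open>Cutting off\<close>

text \<open>The mollifier lives in the unit ball, so averaging the indicator of the ball of radius \<open>2\<close> leaves
  the value \<open>1\<close> on the unit ball and the value \<open>0\<close> outside the ball of radius \<open>3\<close>.\<close>

definition cutoff :: "real ^ 'n \<Rightarrow> real" where
  "cutoff = conv (moll 0) (indicator (cball 0 2))"

lemma loc_int_indicator_ball: "loc_int (indicator (cball 0 r) :: real ^ 'n \<Rightarrow> real)"
  unfolding loc_int_def
proof (intro conjI allI)
  show "(indicator (cball 0 r) :: real ^ 'n \<Rightarrow> real) \<in> borel_measurable borel"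
    by (intro borel_measurable_indicator) simp
  fix q
  have "integrable lborel (indicator (cball 0 q \<inter> cball 0 r) :: real ^ 'n \<Rightarrow> real)"
    by (intro integrable_real_indicator emeasure_bounded_finite bounded_Int) auto
  then show "integrable lborel (\<lambda>x::real ^ 'n. indicator (cball 0 q) x * indicator (cball 0 r) x :: real)"
    by (simp only: indicator_inter_arith[abs_def])
qed

lemma smooth_cutoff: "smooth cutoff"
  unfolding cutoff_def by (rule smooth_conv[OF moll_test loc_int_indicator_ball])

lemma cutoff_le: "\<bar>cutoff x\<bar> \<le> 1"
  unfolding cutoff_def by (rule conv_moll_bound[OF loc_int_indicator_ball]) (simp add: indicator_def)

lemma cutoff_outside: "3 < norm x \<Longrightarrow> cutoff x = 0"
  unfolding cutoff_def by (rule conv_moll_support[where r=2]) (auto simp: indicator_def)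

lemma cutoff_inside:
  assumes "norm x \<le> 1"
  shows "cutoff x = 1"
proof -
  have "moll 0 (x - y) * indicator (cball 0 2) y = moll 0 (x - y)" for y
  proof (cases "norm y \<le> 2")
    case False
    then have "1 \<le> norm (x - y)"
      using assms norm_diff_gt[of x 1 y] by simp
    then have "moll 0 (x - y) = 0" by (intro moll_zero) simp
    then show ?thesis by simp
  qed simp
  then have "cutoff x = (\<integral>y. moll 0 (x - y) \<partial>lborel)"
    by (simp only: cutoff_def conv_def)
  also have "\<dots> = 1"
    by (rule moll_translate)
  finally show ?thesis .
qed

lemma cutoff_test: "cutoff \<in> test_functions"
  unfolding test_functions_iff using smooth_cutoff cutoff_outside by blast

lemma gradient_mult:
  assumes "smooth f" "smooth g"
  shows "gradient (\<lambda>x. f x * g x) x = f x *\<^sub>R gradient g x + g x *\<^sub>R gradient f x"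
  using assms by (simp add: vec_eq_iff gradient_def partial_deriv_mult smooth_differentiable mult.commute)

lemma gradient_scaled:
  assumes "smooth f"
  shows "gradient (\<lambda>x. f (c *\<^sub>R x)) x = c *\<^sub>R gradient f (c *\<^sub>R x)"
  using partial_deriv_affine[of f 0 c x] smooth_differentiable[OF assms]
  by (simp add: vec_eq_iff gradient_def)

lemma gradient_cutoff_inside:
  fixes x :: "real ^ 'n"
  assumes "norm x < 1"
  shows "gradient cutoff x = 0"
proof (rule gradient_eqI)
  have "(cutoff has_derivative (\<lambda>h. 0)) (at x)"
  proof (rule has_derivative_transform_within_open)
    show "((\<lambda>x. 1) has_derivative (\<lambda>h. 0)) (at x)" by simp
    show "open (ball (0 :: real ^ 'n) 1)" by simp
  qed (use assms in \<open>auto simp: cutoff_inside\<close>)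
  then show "(cutoff has_derivative (\<lambda>h. 0 \<bullet> h)) (at x)" by simp
qed

lemma gradient_cutoff_outside: "3 < norm x \<Longrightarrow> gradient cutoff x = 0"
  by (simp add: vec_eq_iff gradient_def partial_deriv_zero_outside[OF cutoff_outside])

definition l2_energy :: "(real ^ 'n \<Rightarrow> real ^ 'n) \<Rightarrow> ennreal" where
  "l2_energy g = (\<integral>\<^sup>+x. ennreal ((norm (g x))\<^sup>2) \<partial>lborel)"

lemma norm_add_square_le: "(norm (a + b))\<^sup>2 \<le> 2 * (norm a)\<^sup>2 + 2 * (norm b)\<^sup>2"
proof -
  have "(norm (a + b))\<^sup>2 \<le> (norm a + norm b)\<^sup>2"
    by (intro power_mono norm_triangle_ineq) simp
  also have "\<dots> \<le> 2 * (norm a)\<^sup>2 + 2 * (norm b)\<^sup>2"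
    using sum_squares_ge_zero[of "norm a - norm b" 0] by (simp add: power2_eq_square algebra_simps)
  finally show ?thesis .
qed

lemma norm_add_square_le_ennreal:
  "ennreal ((norm (a + b))\<^sup>2) \<le> 2 * ennreal ((norm a)\<^sup>2) + 2 * ennreal ((norm b)\<^sup>2)"
proof -
  have "ennreal ((norm (a + b))\<^sup>2) \<le> ennreal (2 * (norm a)\<^sup>2 + 2 * (norm b)\<^sup>2)"
    by (rule ennreal_leI[OF norm_add_square_le])
  then show ?thesis by (simp add: ennreal_plus ennreal_mult)
qed

lemma l2_energy_add:
  fixes f g :: "real ^ 'n \<Rightarrow> real ^ 'n"
  assumes [measurable]: "f \<in> borel_measurable borel" "g \<in> borel_measurable borel"
  shows "l2_energy (\<lambda>x. f x + g x) \<le> 2 * (l2_energy f + l2_energy g)"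
proof -
  have "l2_energy (\<lambda>x. f x + g x) \<le> (\<integral>\<^sup>+x. 2 * ennreal ((norm (f x))\<^sup>2) + 2 * ennreal ((norm (g x))\<^sup>2) \<partial>lborel)"
    unfolding l2_energy_def by (intro nn_integral_mono norm_add_square_le_ennreal)
  also have "\<dots> = 2 * (l2_energy f + l2_energy g)"
    by (simp add: l2_energy_def nn_integral_add nn_integral_cmult distrib_left)
  finally show ?thesis .
qed

text \<open>The error is \<open>(\<eta> - 1) \<nabla>w + w \<nabla>\<eta>\<close> for the rescaled cutoff \<open>\<eta>\<close>. The first part lives outside the ball
  of radius \<open>n\<close>. In the second part \<open>\<nabla>\<eta>\<close> is of size \<open>1 / n\<close> and lives in the annulus
  \<open>n \<le> \<bar>x\<bar> \<le> 3 n\<close>.\<close>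

lemma cutoff_gradient_tendsto:
  fixes w :: "real ^ 'n \<Rightarrow> real"
  assumes w: "smooth w" and fin: "l2_energy (gradient w) < \<infinity>"
    and mean: "(ball_mean (\<lambda>x. ennreal ((w x)\<^sup>2)) \<longlongrightarrow> 0) at_top"
  shows "(\<lambda>n. l2_energy (\<lambda>x. gradient (\<lambda>x. cutoff ((1 / real n) *\<^sub>R x) * w x) x - gradient w x)) \<longlonglongrightarrow> 0"
proof -
  note [measurable] = smooth_measurable[OF w] measurable_gradient[OF w]
  obtain B where B: "0 < B" "\<And>x y :: real ^ 'n. \<bar>cutoff x - cutoff y\<bar> \<le> B * norm (x - y)"
      "\<And>x :: real ^ 'n. norm (gradient cutoff x) \<le> B"
    by (rule test_function_Lipschitz[OF cutoff_test]) (rule that)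
  let ?D = "\<lambda>n. \<integral>\<^sup>+x. ennreal ((norm (gradient w x))\<^sup>2) * indicator (- ball 0 (real n)) x \<partial>lborel"
  let ?A = "\<lambda>n. ennreal (1 / (real n)\<^sup>2) * (\<integral>\<^sup>+x. ennreal ((w x)\<^sup>2) * indicator (annulus (real n)) x \<partial>lborel)"
  have D: "?D \<longlonglongrightarrow> 0"
    using fin by (intro nn_integral_tail_tendsto_0) (auto simp: l2_energy_def)
  have A: "?A \<longlonglongrightarrow> 0"
    using fin by (intro annulus_tendsto_0 w mean) (simp add: l2_energy_def)
  have "(\<lambda>n. ennreal 8 * ?D n + ennreal (2 * B\<^sup>2) * ?A n) \<longlonglongrightarrow> ennreal 8 * 0 + ennreal (2 * B\<^sup>2) * 0"
    by (intro tendsto_add ennreal_tendsto_cmult A D) auto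
  then have lim: "(\<lambda>n. ennreal 8 * ?D n + ennreal (2 * B\<^sup>2) * ?A n) \<longlonglongrightarrow> 0" by simp
  show ?thesis
  proof (rule tendsto_sandwich[OF _ _ tendsto_const lim])
    show "\<forall>\<^sub>F n in sequentially. l2_energy (\<lambda>x. gradient (\<lambda>x. cutoff ((1 / real n) *\<^sub>R x) * w x) x - gradient w x)
      \<le> ennreal 8 * ?D n + ennreal (2 * B\<^sup>2) * ?A n"
      using eventually_gt_at_top[of 0]
    proof eventually_elim
      case (elim n)
      define \<eta> where "\<eta> x = cutoff ((1 / real n) *\<^sub>R x)" for x :: "real ^ 'n"
      have sm: "smooth \<eta>"
        using smooth_affine[OF smooth_cutoff, of 0 "1 / real n"] by (simp add: \<eta>_def[abs_def])
      have g\<eta>: "gradient \<eta> x = (1 / real n) *\<^sub>R gradient cutoff ((1 / real n) *\<^sub>R x)" for x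
        unfolding \<eta>_def[abs_def] by (rule gradient_scaled[OF smooth_cutoff])
      have b1: "(norm ((\<eta> x - 1) *\<^sub>R gradient w x))\<^sup>2 \<le> 4 * (norm (gradient w x))\<^sup>2 * indicator (- ball 0 (real n)) x" for x
      proof (cases "norm x < real n")
        case True
        then have "\<eta> x = 1" unfolding \<eta>_def using elim by (intro cutoff_inside) (simp add: field_simps)
        then show ?thesis by simp
      next
        case False
        have "\<bar>\<eta> x - 1\<bar> \<le> 2" using cutoff_le[of "(1 / real n) *\<^sub>R x"] by (simp add: \<eta>_def abs_le_iff)
        then have "(\<bar>\<eta> x - 1\<bar> * norm (gradient w x))\<^sup>2 \<le> (2 * norm (gradient w x))\<^sup>2"
          by (intro power_mono mult_right_mono) auto
        then show ?thesis using False by (simp add: power_mult_distrib)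
      qed
      have b2: "(norm (w x *\<^sub>R gradient \<eta> x))\<^sup>2 \<le> B\<^sup>2 * (1 / (real n)\<^sup>2) * (w x)\<^sup>2 * indicator (annulus (real n)) x" for x
      proof (cases "x \<in> annulus (real n)")
        case True
        have "norm (gradient \<eta> x) \<le> (1 / real n) * B"
          using B(3)[of "(1 / real n) *\<^sub>R x"] by (simp add: g\<eta> divide_right_mono)
        then have "(\<bar>w x\<bar> * norm (gradient \<eta> x))\<^sup>2 \<le> (\<bar>w x\<bar> * ((1 / real n) * B))\<^sup>2"
          by (intro power_mono mult_left_mono) auto
        then show ?thesis using True by (simp add: power_mult_distrib power_divide mult_ac)
      next
        case False
        then consider "norm x < real n" | "3 * real n < norm x" by force
        then have "gradient cutoff ((1 / real n) *\<^sub>R x) = 0"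
        proof cases
          case 1
          then show ?thesis using elim by (intro gradient_cutoff_inside) (simp add: field_simps)
        next
          case 2
          then show ?thesis using elim by (intro gradient_cutoff_outside) (simp add: field_simps)
        qed
        then show ?thesis by (simp add: g\<eta>)
      qed
      have "l2_energy (\<lambda>x. gradient (\<lambda>x. \<eta> x * w x) x - gradient w x)
        \<le> (\<integral>\<^sup>+x. ennreal 8 * (ennreal ((norm (gradient w x))\<^sup>2) * indicator (- ball 0 (real n)) x)
          + ennreal (2 * B\<^sup>2) * (ennreal (1 / (real n)\<^sup>2) * (ennreal ((w x)\<^sup>2) * indicator (annulus (real n)) x)) \<partial>lborel)"
        unfolding l2_energy_def
      proof (rule nn_integral_mono)
        fix x
        have eq: "gradient (\<lambda>x. \<eta> x * w x) x - gradient w x = (\<eta> x - 1) *\<^sub>R gradient w x + w x *\<^sub>R gradient \<eta> x"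
          by (simp add: gradient_mult[OF sm w] scaleR_diff_left)
        have "ennreal ((norm (gradient (\<lambda>x. \<eta> x * w x) x - gradient w x))\<^sup>2)
          \<le> ennreal (8 * (norm (gradient w x))\<^sup>2 * indicator (- ball 0 (real n)) x
            + 2 * B\<^sup>2 * (1 / (real n)\<^sup>2) * (w x)\<^sup>2 * indicator (annulus (real n)) x)"
          unfolding eq using norm_add_square_le[of "(\<eta> x - 1) *\<^sub>R gradient w x" "w x *\<^sub>R gradient \<eta> x"] b1[of x] b2[of x]
          by (intro ennreal_leI) linarith
        also have "\<dots> = ennreal 8 * (ennreal ((norm (gradient w x))\<^sup>2) * indicator (- ball 0 (real n)) x)
          + ennreal (2 * B\<^sup>2) * (ennreal (1 / (real n)\<^sup>2) * (ennreal ((w x)\<^sup>2) * indicator (annulus (real n)) x))"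
        proof -
          have ind: "ennreal (a * indicator S x + b * indicator T x) = ennreal a * indicator S x + ennreal b * indicator T x"
            if "0 \<le> a" "0 \<le> b" for a b and S T :: "(real ^ 'n) set"
            using that by (simp add: indicator_def)
          have e1: "ennreal (8 * (norm (gradient w x))\<^sup>2) = ennreal 8 * ennreal ((norm (gradient w x))\<^sup>2)"
            by (intro ennreal_mult) auto
          have e2: "ennreal (2 * B\<^sup>2 * (1 / (real n)\<^sup>2) * (w x)\<^sup>2)
              = ennreal (2 * B\<^sup>2) * ennreal (1 / (real n)\<^sup>2) * ennreal ((w x)\<^sup>2)"
            by (subst ennreal_mult, simp, simp, subst ennreal_mult, simp, simp, rule refl)
          have p1: "0 \<le> 8 * (norm (gradient w x))\<^sup>2"
            and p2: "0 \<le> 2 * B\<^sup>2 * (1 / (real n)\<^sup>2) * (w x)\<^sup>2" by simp_all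
          show ?thesis
            unfolding ind[OF p1 p2] e1 e2 by (simp only: mult.assoc)
        qed
        finally show "ennreal ((norm (gradient (\<lambda>x. \<eta> x * w x) x - gradient w x))\<^sup>2)
          \<le> ennreal 8 * (ennreal ((norm (gradient w x))\<^sup>2) * indicator (- ball 0 (real n)) x)
          + ennreal (2 * B\<^sup>2) * (ennreal (1 / (real n)\<^sup>2) * (ennreal ((w x)\<^sup>2) * indicator (annulus (real n)) x))" .
      qed
      also have "\<dots> = ennreal 8 * ?D n + ennreal (2 * B\<^sup>2) * ?A n"
        by (subst nn_integral_add) (simp_all add: nn_integral_cmult del: ennreal_numeral)
      finally show ?case by (simp add: \<eta>_def)
    qed
  qed simp
qed

lemma cutoff_pointwise:
  fixes w :: "real ^ 'n \<Rightarrow> real"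
  shows "(\<lambda>n. cutoff ((1 / real n) *\<^sub>R x) * w x - w x) \<longlonglongrightarrow> 0"
proof (rule tendsto_eventually)
  obtain K :: nat where "max 1 (norm x) \<le> real K" using real_arch_simple by blast
  then have "cutoff ((1 / real n) *\<^sub>R x) * w x - w x = 0" if "K \<le> n" for n
    using that by (subst cutoff_inside) (auto simp: field_simps)
  then show "eventually (\<lambda>n. cutoff ((1 / real n) *\<^sub>R x) * w x - w x = 0) sequentially"
    by (auto simp: eventually_sequentially)
qed

section \<open>Truncating the range\<close>

text \<open>A rational function bounded by \<open>k + 1\<close>, with derivative in \<open>[-1, 1]\<close>; smoothness of its composition
  with a smooth function only involves products and inverses. As \<open>k \<rightarrow> \<infinity>\<close> it converges to the
  identity together with its derivative.\<close>

definition trunc :: "nat \<Rightarrow> real \<Rightarrow> real" where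
  "trunc k t = t * inverse (1 + (t / real (Suc k))\<^sup>2)"

definition trunc_deriv :: "nat \<Rightarrow> real \<Rightarrow> real" where
  "trunc_deriv k t = (1 - (t / real (Suc k))\<^sup>2) / (1 + (t / real (Suc k))\<^sup>2)\<^sup>2"

lemma one_plus_square_pos: "0 < 1 + (t :: real)\<^sup>2"
  by (simp add: add_pos_nonneg)

lemma trunc_has_derivative: "(trunc k has_real_derivative trunc_deriv k t) (at t)"
proof -
  define a where "a = real (Suc k)"
  have a: "a \<noteq> 0" by (simp add: a_def)
  have nz: "1 + (t / a)\<^sup>2 \<noteq> 0" using one_plus_square_pos[of "t / a"] by simp
  have d1: "((\<lambda>t. 1 + (t / a)\<^sup>2) has_real_derivative 2 * (t / a) * (1 / a)) (at t)"
    by (auto intro!: derivative_eq_intros simp: power2_eq_square a)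
  have "((\<lambda>t. t * inverse (1 + (t / a)\<^sup>2)) has_real_derivative
      1 * inverse (1 + (t / a)\<^sup>2) + - (2 * (t / a) * (1 / a) * inverse ((1 + (t / a)\<^sup>2)\<^sup>2)) * t) (at t)"
    using DERIV_mult[OF DERIV_ident DERIV_inverse_fun[OF d1 nz]] by (simp add: numeral_2_eq_2)
  moreover have "1 * inverse (1 + (t / a)\<^sup>2) + - (2 * (t / a) * (1 / a) * inverse ((1 + (t / a)\<^sup>2)\<^sup>2)) * t
      = (1 - (t / a)\<^sup>2) / (1 + (t / a)\<^sup>2)\<^sup>2"
  proof -
    define q where "q = (t / a)\<^sup>2"
    have q: "1 + q \<noteq> 0" using nz by (simp add: q_def)
    have "2 * (t / a) * (1 / a) * inverse ((1 + q)\<^sup>2) * t = 2 * q / (1 + q)\<^sup>2"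
      by (simp add: q_def power2_eq_square divide_inverse mult_ac)
    moreover have "inverse (1 + q) = (1 + q) / (1 + q)\<^sup>2"
      using q by (simp add: power2_eq_square divide_inverse)
    ultimately show ?thesis
      unfolding q_def[symmetric] by (simp add: diff_divide_distrib[symmetric])
  qed
  ultimately show ?thesis
    by (simp only: trunc_def[abs_def] trunc_deriv_def a_def[symmetric])
qed

lemma trunc_abs_le: "\<bar>trunc k t\<bar> \<le> real (Suc k)"
proof -
  define a where "a = real (Suc k)"
  have a: "0 < a" by (simp add: a_def)
  have "\<bar>t\<bar> / a \<le> 1 + (t / a)\<^sup>2"
    using sum_squares_ge_zero[of "\<bar>t\<bar> / a - 1 / 2" 0]
    by (simp add: power2_eq_square algebra_simps)
  then have "\<bar>t\<bar> / (1 + (t / a)\<^sup>2) \<le> a"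
    using a one_plus_square_pos[of "t / a"] by (simp add: divide_le_eq pos_divide_le_eq mult.commute)
  then show ?thesis
    using one_plus_square_pos[of "t / a"]
    by (simp add: trunc_def a_def[symmetric] abs_mult divide_inverse del: of_nat_Suc)
qed

lemma trunc_diff_le: "\<bar>trunc k t - t\<bar> \<le> \<bar>t\<bar>"
proof -
  define i where "i = inverse (1 + (t / real (Suc k))\<^sup>2)"
  have "0 \<le> i" "i \<le> 1"
    using one_plus_square_pos[of "t / real (Suc k)"] by (auto simp: i_def inverse_le_1_iff)
  then have "\<bar>t\<bar> * \<bar>i - 1\<bar> \<le> \<bar>t\<bar> * 1" by (intro mult_left_mono) auto
  moreover have "trunc k t - t = t * (i - 1)" by (simp add: trunc_def i_def algebra_simps)
  ultimately show ?thesis by (simp add: abs_mult)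
qed

lemma trunc_le: "\<bar>trunc k t\<bar> \<le> \<bar>t\<bar>"
proof -
  define i where "i = inverse (1 + (t / real (Suc k))\<^sup>2)"
  have "0 \<le> i" "i \<le> 1"
    using one_plus_square_pos[of "t / real (Suc k)"] by (auto simp: i_def inverse_le_1_iff)
  then have "\<bar>t\<bar> * \<bar>i\<bar> \<le> \<bar>t\<bar> * 1" by (intro mult_left_mono) auto
  then show ?thesis by (simp add: trunc_def i_def abs_mult)
qed

lemma trunc_deriv_le: "\<bar>trunc_deriv k t\<bar> \<le> 1"
proof -
  define a where "a = (t / real (Suc k))\<^sup>2"
  have a: "0 \<le> a" by (simp add: a_def)
  have "\<bar>1 - a\<bar> \<le> (1 + a)\<^sup>2"
    using a by (auto simp: power2_eq_square algebra_simps abs_le_iff)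
  moreover have "0 < (1 + a)\<^sup>2" using a by simp
  ultimately show ?thesis
    by (simp add: trunc_deriv_def a_def[symmetric] abs_divide divide_le_eq del: of_nat_Suc)
qed

lemma div_Suc_tendsto_0: "(\<lambda>k. (t / real (Suc k))\<^sup>2) \<longlonglongrightarrow> 0"
  using tendsto_power[OF LIMSEQ_Suc[OF lim_const_over_n[of t]], of 2] by simp

lemma trunc_tendsto: "(\<lambda>k. trunc k t - t) \<longlonglongrightarrow> 0"
proof -
  have "(\<lambda>k. trunc k t - t) \<longlonglongrightarrow> t * inverse (1 + 0) - t"
    unfolding trunc_def by (intro tendsto_intros div_Suc_tendsto_0) simp
  then show ?thesis by simp
qed

lemma trunc_deriv_tendsto: "(\<lambda>k. trunc_deriv k t - 1) \<longlonglongrightarrow> 0"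
proof -
  have "(\<lambda>k. trunc_deriv k t - 1) \<longlonglongrightarrow> (1 - 0) / (1 + 0)\<^sup>2 - 1"
    unfolding trunc_deriv_def by (intro tendsto_intros div_Suc_tendsto_0) simp
  then show ?thesis by simp
qed

lemma smooth_trunc:
  assumes v: "smooth v"
  shows "smooth (\<lambda>x. trunc k (v x))"
proof -
  have "smooth (\<lambda>x. v x * inverse (1 + ((1 / real (Suc k)) * v x) * ((1 / real (Suc k)) * v x)))"
  proof (intro smooth_mult smooth_inverse smooth_add smooth_const v)
    fix x
    show "1 + ((1 / real (Suc k)) * v x) * ((1 / real (Suc k)) * v x) \<noteq> 0"
      using one_plus_square_pos[of "(1 / real (Suc k)) * v x"] by (simp only: power2_eq_square)
  qed
  then show ?thesis by (simp add: trunc_def power2_eq_square)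
qed

lemma gradient_trunc:
  assumes "smooth v"
  shows "gradient (\<lambda>x. trunc k (v x)) x = trunc_deriv k (v x) *\<^sub>R gradient v x"
  using partial_deriv_chain_real(1)[OF smooth_differentiable[OF assms] trunc_has_derivative]
  by (simp add: vec_eq_iff gradient_def)

lemma trunc_gradient_tendsto:
  fixes v :: "real ^ 'n \<Rightarrow> real"
  assumes v: "smooth v" and fin: "l2_energy (gradient v) < \<infinity>"
  shows "(\<lambda>k. l2_energy (\<lambda>x. gradient (\<lambda>x. trunc k (v x)) x - gradient v x)) \<longlonglongrightarrow> 0"
proof -
  note [measurable] = measurable_gradient[OF v] smooth_measurable[OF v]
  have eq: "gradient (\<lambda>x. trunc k (v x)) x - gradient v x = (trunc_deriv k (v x) - 1) *\<^sub>R gradient v x" for k x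
    by (simp add: gradient_trunc[OF v] scaleR_diff_left)
  have [measurable]: "(\<lambda>x. trunc_deriv k (v x)) \<in> borel_measurable borel" for k
    unfolding trunc_deriv_def by measurable
  have "(\<lambda>k. \<integral>\<^sup>+x. ennreal ((norm ((trunc_deriv k (v x) - 1) *\<^sub>R gradient v x))\<^sup>2) \<partial>lborel)
      \<longlonglongrightarrow> (\<integral>\<^sup>+(x::real ^ 'n). 0 \<partial>lborel)"
  proof (rule nn_integral_dominated_convergence)
    have "(norm ((trunc_deriv k (v x) - 1) *\<^sub>R gradient v x))\<^sup>2 \<le> 4 * (norm (gradient v x))\<^sup>2" for k x
    proof -
      have "\<bar>trunc_deriv k (v x) - 1\<bar> \<le> 2" using trunc_deriv_le[of k "v x"] by (simp add: abs_le_iff)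
      then have "(\<bar>trunc_deriv k (v x) - 1\<bar> * norm (gradient v x))\<^sup>2 \<le> (2 * norm (gradient v x))\<^sup>2"
        by (intro power_mono mult_right_mono) auto
      then show ?thesis by (simp add: power_mult_distrib)
    qed
    then show "AE x in lborel. ennreal ((norm ((trunc_deriv k (v x) - 1) *\<^sub>R gradient v x))\<^sup>2)
        \<le> ennreal (4 * (norm (gradient v x))\<^sup>2)" for k
      by (intro AE_I2 ennreal_leI)
    have "(\<integral>\<^sup>+x. ennreal (4 * (norm (gradient v x))\<^sup>2) \<partial>lborel) = 4 * l2_energy (gradient v)"
      by (simp add: l2_energy_def ennreal_mult nn_integral_cmult)
    then show "(\<integral>\<^sup>+x. ennreal (4 * (norm (gradient v x))\<^sup>2) \<partial>lborel) < \<infinity>"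
      using fin by (simp add: ennreal_mult_less_top)
    have "(\<lambda>k. ennreal ((norm ((trunc_deriv k (v x) - 1) *\<^sub>R gradient v x))\<^sup>2)) \<longlonglongrightarrow> ennreal ((norm (0 *\<^sub>R gradient v x))\<^sup>2)" for x
      by (intro tendsto_ennrealI tendsto_intros trunc_deriv_tendsto)
    then show "AE x in lborel. (\<lambda>k. ennreal ((norm ((trunc_deriv k (v x) - 1) *\<^sub>R gradient v x))\<^sup>2)) \<longlonglongrightarrow> 0"
      by simp
  qed measurable
  then show ?thesis by (simp add: eq l2_energy_def)
qed

section \<open>Approximation of smooth functions by test functions\<close>

lemma l2_energy_add_less:
  fixes f g :: "real ^ 'n \<Rightarrow> real ^ 'n"
  assumes "f \<in> borel_measurable borel" "g \<in> borel_measurable borel"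
    and "l2_energy f < ennreal (e / (2 * C))" "l2_energy g < ennreal (e / (2 * C))" "0 < e" "2 \<le> C"
  shows "l2_energy (\<lambda>x. f x + g x) < ennreal e"
proof -
  have "l2_energy f + l2_energy g < ennreal (e / (2 * C)) + ennreal (e / (2 * C))"
    using assms by (intro add_strict_mono)
  also have "\<dots> = ennreal (e / C)"
    using assms by (simp add: ennreal_plus[symmetric] del: ennreal_plus)
  also have "\<dots> \<le> ennreal (e / 2)"
    using assms by (intro ennreal_leI divide_left_mono) auto
  finally have "ennreal 2 * (l2_energy f + l2_energy g) < ennreal 2 * ennreal (e / 2)"
    by (intro ennreal_mult_strict_left_mono) auto
  also have "\<dots> = ennreal e"
    using assms by (simp add: ennreal_mult[symmetric] del: ennreal_numeral)
  finally show ?thesis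
    using l2_energy_add[OF assms(1,2)] by (simp add: le_less_trans)
qed

text \<open>The truncation level is fixed first: the cutoff radius that is needed depends on the bound on the
  truncated function.\<close>

lemma smooth_approx:
  fixes v :: "real ^ 'n \<Rightarrow> real"
  assumes \<alpha>: "0 < \<alpha>" "\<alpha> < real CARD('n)" and p: "1 \<le> p"
    and v: "smooth v" and D: "l2_energy (gradient v) < \<infinity>"
    and E: "kernel_energy (riesz_potential (\<alpha> / 2)) p v < \<infinity>" and e: "0 < e"
  obtains \<phi> where "\<phi> \<in> test_functions" "l2_energy (\<lambda>x. gradient \<phi> x - gradient v x) < ennreal e"
    "kernel_energy (riesz_potential (\<alpha> / 2)) p (\<lambda>x. \<phi> x - v x) < ennreal e"
proof -
  let ?Q = "kernel_energy (riesz_potential (\<alpha> / 2) :: real ^ 'n \<Rightarrow> real) p"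
  define C :: real where "C = 4 * (2 powr p)\<^sup>2"
  interpret Q: mollifiable ?Q C
    unfolding C_def by (rule mollifiable_riesz[OF \<alpha> p])
  have C2: "2 \<le> C"
  proof -
    have "1 \<le> (2 :: real) powr p" using p by (simp add: ge_one_powr_ge_zero)
    then have "1 \<le> ((2 :: real) powr p)\<^sup>2" by (rule one_le_power)
    then show ?thesis unfolding C_def by linarith
  qed
  define d where "d = e / (2 * C)"
  have d: "0 < d" using e C2 by (simp add: d_def)
  note [measurable] = smooth_measurable[OF v] measurable_gradient[OF v]
  have "eventually (\<lambda>k. l2_energy (\<lambda>x. gradient (\<lambda>x. trunc k (v x)) x - gradient v x) < ennreal d) sequentially"
    using d by (intro order_tendstoD(2)[OF trunc_gradient_tendsto[OF v D]]) auto
  moreover have "(\<lambda>k. ?Q (\<lambda>x. trunc k (v x) - v x)) \<longlonglongrightarrow> 0"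
    by (rule Q.dominated[OF _ _ _ _ E])
      (auto intro: trunc_diff_le trunc_tendsto borel_measurable_diff smooth_measurable[OF smooth_trunc[OF v]] smooth_measurable[OF v])
  then have "eventually (\<lambda>k. ?Q (\<lambda>x. trunc k (v x) - v x) < ennreal d) sequentially"
    using d by (intro order_tendstoD(2)) auto
  ultimately have "eventually (\<lambda>k. l2_energy (\<lambda>x. gradient (\<lambda>x. trunc k (v x)) x - gradient v x) < ennreal d
      \<and> ?Q (\<lambda>x. trunc k (v x) - v x) < ennreal d) sequentially"
    by eventually_elim simp
  then obtain k where k: "l2_energy (\<lambda>x. gradient (\<lambda>x. trunc k (v x)) x - gradient v x) < ennreal d"
      "?Q (\<lambda>x. trunc k (v x) - v x) < ennreal d"
    using eventually_happens'[OF sequentially_bot] by blast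
  define w where "w x = trunc k (v x)" for x
  have w: "smooth w" unfolding w_def by (rule smooth_trunc[OF v])
  note [measurable] = smooth_measurable[OF w] measurable_gradient[OF w]
  have wD: "l2_energy (gradient w) < \<infinity>"
  proof -
    have "l2_energy (gradient w) \<le> l2_energy (gradient v)"
      unfolding l2_energy_def w_def[abs_def] gradient_trunc[OF v]
    proof (intro nn_integral_mono ennreal_leI power_mono)
      fix x
      show "norm (trunc_deriv k (v x) *\<^sub>R gradient v x) \<le> norm (gradient v x)"
        using trunc_deriv_le[of k "v x"] by (simp add: mult_left_le_one_le)
    qed simp
    then show ?thesis using D by (rule le_less_trans)
  qed
  have wE: "?Q w < \<infinity>"
  proof -
    have "?Q w \<le> ?Q v"
      unfolding w_def by (rule kernel_energy_mono) (use p trunc_le in auto)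
    then show ?thesis using E by (rule le_less_trans)
  qed
  have mean: "(ball_mean (\<lambda>x. ennreal ((w x)\<^sup>2)) \<longlongrightarrow> 0) at_top"
    by (rule mean_square_tendsto_0[OF \<alpha> p _ _ wE, where K="real (Suc k)"]) (measurable, unfold w_def, rule trunc_abs_le)
  let ?\<phi> = "\<lambda>n x. cutoff ((1 / real n) *\<^sub>R x) * w x"
  have sm\<eta>: "smooth (\<lambda>x :: real ^ 'n. cutoff ((1 / real n) *\<^sub>R x))" for n
    using smooth_affine[OF smooth_cutoff, of 0 "1 / real n"] by simp
  have "eventually (\<lambda>n. l2_energy (\<lambda>x. gradient (?\<phi> n) x - gradient w x) < ennreal d) sequentially"
    using d by (intro order_tendstoD(2)[OF cutoff_gradient_tendsto[OF w wD mean]]) auto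
  moreover have "(\<lambda>n. ?Q (\<lambda>x. ?\<phi> n x - w x)) \<longlonglongrightarrow> 0"
  proof (rule Q.dominated)
    show "(\<lambda>x. ?\<phi> n x - w x) \<in> borel_measurable borel" for n
      by (intro borel_measurable_diff smooth_measurable smooth_mult sm\<eta> w)
    show "(\<lambda>x. 2 * w x) \<in> borel_measurable borel" by measurable
    show "\<bar>?\<phi> n x - w x\<bar> \<le> \<bar>2 * w x\<bar>" for n x
    proof -
      have "\<bar>cutoff ((1 / real n) *\<^sub>R x) - 1\<bar> \<le> 2" using cutoff_le[of "(1 / real n) *\<^sub>R x"] by (simp add: abs_le_iff)
      then have "\<bar>cutoff ((1 / real n) *\<^sub>R x) - 1\<bar> * \<bar>w x\<bar> \<le> 2 * \<bar>w x\<bar>" by (intro mult_right_mono) auto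
      then show ?thesis by (simp add: abs_mult[symmetric] left_diff_distrib)
    qed
    show "AE x in lborel. (\<lambda>n. ?\<phi> n x - w x) \<longlonglongrightarrow> 0" by (simp add: cutoff_pointwise)
    have "?Q (\<lambda>x. w x + w x) \<le> ennreal C * (?Q w + ?Q w)"
      by (rule Q.quasi_add) measurable
    also have "\<dots> < \<infinity>" using wE by (simp add: ennreal_mult_less_top)
    finally show "?Q (\<lambda>x. 2 * w x) < \<infinity>" by (simp only: mult_2)
  qed
  then have "eventually (\<lambda>n. ?Q (\<lambda>x. ?\<phi> n x - w x) < ennreal d) sequentially"
    using d by (intro order_tendstoD(2)) auto
  moreover have "eventually (\<lambda>n. 0 < n) sequentially" by (rule eventually_gt_at_top)
  ultimately have "eventually (\<lambda>n. 0 < n \<and> l2_energy (\<lambda>x. gradient (?\<phi> n) x - gradient w x) < ennreal d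
      \<and> ?Q (\<lambda>x. ?\<phi> n x - w x) < ennreal d) sequentially"
    by eventually_elim simp
  then obtain n where n: "0 < n" "l2_energy (\<lambda>x. gradient (?\<phi> n) x - gradient w x) < ennreal d"
      "?Q (\<lambda>x. ?\<phi> n x - w x) < ennreal d"
    using eventually_happens'[OF sequentially_bot] by blast
  have test: "?\<phi> n \<in> test_functions"
  proof -
    have "(\<lambda>x :: real ^ 'n. cutoff ((1 / real n) *\<^sub>R x)) \<in> test_functions"
      using test_function_affine[OF cutoff_test, of "1 / real n" 0] n(1) by simp
    from test_function_mult_left[OF w this] show ?thesis by (simp add: mult.commute)
  qed
  note [measurable] = smooth_measurable[OF test_function_smooth[OF test]]
    measurable_gradient[OF test_function_smooth[OF test]]
  have kw: "l2_energy (\<lambda>x. gradient w x - gradient v x) < ennreal (e / (2 * C))"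
    "?Q (\<lambda>x. w x - v x) < ennreal (e / (2 * C))"
    using k by (simp_all add: w_def[abs_def] d_def)
  have "l2_energy (\<lambda>x. (gradient (?\<phi> n) x - gradient w x) + (gradient w x - gradient v x)) < ennreal e"
    by (rule l2_energy_add_less[OF _ _ n(2)[unfolded d_def] kw(1) e C2]) measurable
  moreover have "?Q (\<lambda>x. (?\<phi> n x - w x) + (w x - v x)) < ennreal e"
    by (rule Q.quasi_add_less[OF _ _ n(3)[unfolded d_def] kw(2) e]) measurable
  ultimately show ?thesis
    using that[OF test] by simp
qed

section \<open>Mollification in the Coulomb-Sobolev space\<close>

lemma l2_energy_components:
  fixes f :: "real ^ 'n \<Rightarrow> real ^ 'n"
  assumes [measurable]: "f \<in> borel_measurable borel"
  shows "l2_energy f = (\<Sum>i\<in>UNIV. lp_energy 2 (\<lambda>x. f x $ i))"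
proof -
  have "l2_energy f = (\<integral>\<^sup>+x. (\<Sum>i\<in>UNIV. ennreal (\<bar>f x $ i\<bar> powr 2)) \<partial>lborel)"
    unfolding l2_energy_def
  proof (rule nn_integral_cong)
    fix x
    have "(norm (f x))\<^sup>2 = (\<Sum>i\<in>UNIV. \<bar>f x $ i\<bar> powr 2)"
      by (simp add: power2_norm_eq_inner inner_vec_def powr_numeral flip: power2_eq_square)
    then show "ennreal ((norm (f x))\<^sup>2) = (\<Sum>i\<in>UNIV. ennreal (\<bar>f x $ i\<bar> powr 2))"
      by (simp add: sum_ennreal)
  qed
  also have "\<dots> = (\<Sum>i\<in>UNIV. lp_energy 2 (\<lambda>x. f x $ i))"
    unfolding lp_energy_def by (rule nn_integral_sum) measurable
  finally show ?thesis .
qed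

lemma weak_gradient_components:
  assumes "has_weak_gradient u g" "g \<in> borel_measurable borel"
  shows "loc_int (\<lambda>x. g x $ i)"
proof (rule locally_integrable_loc_int)
  show "(\<lambda>x. g x $ i) \<in> borel_measurable borel" using assms(2) by measurable
  show "locally_integrable (\<lambda>x. g x $ i)"
    using assms(1) by (auto simp: has_weak_gradient_def intro: locally_integrable_component)
qed

text \<open>The gradient of a mollification is the mollification of the weak gradient, componentwise, so the
  square integral of each component is subject to the general convergence result.\<close>

lemma mollify_gradient:
  fixes u :: "real ^ 'n \<Rightarrow> real"
  assumes g: "has_weak_gradient u g"
    and u [measurable]: "u \<in> borel_measurable borel" and gm [measurable]: "g \<in> borel_measurable borel"
    and fin: "l2_energy g < \<infinity>"
  shows "(\<lambda>n. l2_energy (\<lambda>x. gradient (conv (moll n) u) x - g x)) \<longlonglongrightarrow> 0"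
    "l2_energy (gradient (conv (moll n) u)) < \<infinity>"
proof -
  interpret L: mollifiable "lp_energy 2 :: (real ^ 'n \<Rightarrow> real) \<Rightarrow> ennreal" "2 powr 2"
    by (rule mollifiable_lp_energy) simp
  have gi: "loc_int (\<lambda>x. g x $ i)" for i
    by (rule weak_gradient_components[OF g gm])
  have u': "loc_int u"
    using g by (intro locally_integrable_loc_int u) (simp add: has_weak_gradient_def)
  have gc: "gradient (conv (moll n) u) x $ i = conv (moll n) (\<lambda>y. g y $ i) x" for n x i
    by (simp add: gradient_conv_weak[OF g moll_test u gm])
  note [measurable] = measurable_gradient[OF smooth_conv[OF moll_test u']]
  have fini: "lp_energy 2 (\<lambda>x. g x $ i) < \<infinity>" for i
  proof -
    have "lp_energy 2 (\<lambda>x. g x $ i) \<le> l2_energy g"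
      unfolding l2_energy_components[OF gm] by (rule member_le_sum) auto
    then show ?thesis using fin by (rule le_less_trans)
  qed
  have "(\<lambda>n. \<Sum>i\<in>UNIV. lp_energy 2 (\<lambda>x. conv (moll n) (\<lambda>y. g y $ i) x - g x $ i)) \<longlonglongrightarrow> (\<Sum>i\<in>(UNIV :: 'n set). 0)"
    by (intro tendsto_sum L.mollification_tendsto gi fini)
  then show "(\<lambda>n. l2_energy (\<lambda>x. gradient (conv (moll n) u) x - g x)) \<longlonglongrightarrow> 0"
    by (simp add: l2_energy_components gc)
  have "l2_energy (gradient (conv (moll n) u)) = (\<Sum>i\<in>UNIV. lp_energy 2 (conv (moll n) (\<lambda>y. g y $ i)))"
    by (simp add: l2_energy_components gc)
  also have "\<dots> \<le> (\<Sum>i\<in>UNIV. lp_energy 2 (\<lambda>x. g x $ i))"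
    by (intro sum_mono L.contraction gi)
  also have "\<dots> = l2_energy g" by (simp add: l2_energy_components)
  finally show "l2_energy (gradient (conv (moll n) u)) < \<infinity>" using fin by (rule le_less_trans)
qed

lemma dirichlet_energy_l2:
  "has_weak_gradient u g \<Longrightarrow> dirichlet_energy u = l2_energy g"
  by (simp add: dirichlet_energy_eq l2_energy_def nn_integral_completion)

lemma has_weak_gradient_cong_gradient:
  fixes g h :: "real ^ 'n \<Rightarrow> real ^ 'n"
  assumes g: "has_weak_gradient u g" and AE: "AE x in lebesgue. g x = h x"
  shows "has_weak_gradient u h"
  unfolding has_weak_gradient_def
proof (intro conjI ballI allI)
  show "locally_integrable u" "locally_integrable h"
    using g locally_integrable_cong_AE[OF AE] by (auto simp: has_weak_gradient_def)
  fix f :: "real ^ 'n \<Rightarrow> real" and i assume f: "f \<in> test_functions"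
  have "(\<integral>x. u x * partial_deriv i f x \<partial>lebesgue) = - (\<integral>x. g x $ i * f x \<partial>lebesgue)"
    using g f unfolding has_weak_gradient_def by blast
  also have "(\<integral>x. g x $ i * f x \<partial>lebesgue) = (\<integral>x. h x $ i * f x \<partial>lebesgue)"
    by (rule lebesgue_integrable_cong_AE(2)) (use AE in eventually_elim, simp)
  finally show "(\<integral>x. u x * partial_deriv i f x \<partial>lebesgue) = - (\<integral>x. h x $ i * f x \<partial>lebesgue)" .
qed

lemma weak_gradient_borel_rep:
  fixes u :: "real ^ 'n \<Rightarrow> real"
  assumes g: "has_weak_gradient u g"
  obtains h where "has_weak_gradient u h" "h \<in> borel_measurable borel"
proof -
  have "\<exists>d. loc_int d \<and> (AE x in lebesgue. g x $ i = d x)" for i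
  proof -
    have "locally_integrable (\<lambda>x. g x $ i)"
      using g by (auto simp: has_weak_gradient_def intro: locally_integrable_component)
    then show ?thesis by (rule locally_integrable_borel_rep) blast
  qed
  then obtain d where d: "\<And>i. loc_int (d i)" "\<And>i. AE x in lebesgue. g x $ i = d i x" by metis
  have "AE x in lebesgue. \<forall>i. g x $ i = d i x" using d(2) by (simp add: AE_all_countable)
  then have AE: "AE x in lebesgue. g x = (\<chi> i. d i x)"
    by eventually_elim (simp add: vec_eq_iff)
  have "(\<lambda>x. \<chi> i. d i x) \<in> borel_measurable borel"
  proof (subst borel_measurable_euclidean_space, rule ballI)
    fix b :: "real ^ 'n" assume "b \<in> Basis"
    then obtain i where "b = axis i 1" by (auto simp: Basis_vec_def)
    then show "(\<lambda>x. (\<chi> i. d i x) \<bullet> b) \<in> borel_measurable borel"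
      using loc_int_measurable[OF d(1)] by (simp add: inner_axis)
  qed
  with has_weak_gradient_cong_gradient[OF g AE] show ?thesis by (rule that)
qed

lemma test_function_coulomb_sobolev:
  fixes \<phi> :: "real ^ 'n \<Rightarrow> real"
  assumes \<alpha>: "0 < \<alpha>" "\<alpha> < real CARD('n)" and p: "1 \<le> p" and \<phi>: "\<phi> \<in> test_functions"
  shows "\<phi> \<in> coulomb_sobolev \<alpha> p"
proof -
  let ?Q = "kernel_energy (riesz_potential (\<alpha> / 2) :: real ^ 'n \<Rightarrow> real) p"
  interpret Q: mollifiable ?Q "4 * (2 powr p)\<^sup>2"
    by (rule mollifiable_riesz[OF \<alpha> p])
  note sm = test_function_smooth[OF \<phi>]
  obtain B where B: "0 < B" "\<And>x. \<bar>\<phi> x\<bar> \<le> B" by (rule test_function_bounded[OF \<phi>]) (rule that)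
  obtain r where r: "0 < r" "\<And>x. r < norm x \<Longrightarrow> \<phi> x = 0" by (rule test_function_supportE[OF \<phi>]) (rule that)
  obtain L where L: "0 < L" "\<And>x y. \<bar>\<phi> x - \<phi> y\<bar> \<le> L * norm (x - y)" "\<And>x. norm (gradient \<phi> x) \<le> L"
    by (rule test_function_Lipschitz[OF \<phi>]) (rule that)
  have "?Q \<phi> \<le> ?Q (\<lambda>x. B * indicator (cball 0 r) x)"
  proof (rule kernel_energy_mono)
    fix x
    show "\<bar>\<phi> x\<bar> \<le> \<bar>B * indicator (cball 0 r) x\<bar>"
      using B(2)[of x] r(2)[of x] B(1) by (cases "r < norm x") auto
  qed (use p in simp)
  also have "\<dots> < \<infinity>" by (rule Q.Q_ball)
  finally have E: "coulomb_energy \<alpha> p \<phi> < \<infinity>" by (simp add: coulomb_energy_eq)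
  have "l2_energy (gradient \<phi>) \<le> (\<integral>\<^sup>+(x::real ^ 'n). ennreal (L\<^sup>2) * indicator (cball 0 r) x \<partial>lborel)"
    unfolding l2_energy_def
  proof (rule nn_integral_mono)
    fix x
    show "ennreal ((norm (gradient \<phi> x))\<^sup>2) \<le> ennreal (L\<^sup>2) * indicator (cball 0 r) x"
    proof (cases "r < norm x")
      case True
      then have "gradient \<phi> x = 0"
        using partial_deriv_zero_outside[of r \<phi> x] r(2) by (simp add: gradient_def vec_eq_iff)
      then show ?thesis by simp
    next
      case False
      have "(norm (gradient \<phi> x))\<^sup>2 \<le> L\<^sup>2" by (rule power_mono[OF L(3)]) simp
      then show ?thesis using False by (simp add: ennreal_leI)
    qed
  qed
  also have "\<dots> = ennreal (L\<^sup>2) * emeasure lborel (cball (0 :: real ^ 'n) r)"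
    by (rule nn_integral_cmult_indicator) simp
  also have "\<dots> < \<infinity>"
    using emeasure_lborel_cball_finite[of "0 :: real ^ 'n" r] by (simp add: ennreal_mult_less_top)
  finally have D: "dirichlet_energy \<phi> < \<infinity>"
    by (simp add: dirichlet_energy_l2[OF has_weak_gradient_smooth[OF sm]])
  have "\<phi> \<in> borel_measurable lebesgue"
    using smooth_measurable[OF sm] by (intro measurable_completion) simp
  then show ?thesis
    using E D has_weak_gradient_smooth[OF sm] by (auto simp: coulomb_sobolev_def weakly_differentiable_def)
qed

text \<open>Both energies depend only on the almost everywhere class, so a Borel function with a Borel weak
  gradient may take the place of \<open>u\<close>.\<close>

lemma coulomb_sobolev_borel_rep:
  fixes u :: "real ^ 'n \<Rightarrow> real"
  assumes u: "u \<in> coulomb_sobolev \<alpha> p"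
  obtains v g where "AE x in lebesgue. u x = v x" "v \<in> borel_measurable borel" "g \<in> borel_measurable borel"
    "has_weak_gradient v g" "l2_energy g < \<infinity>" "kernel_energy (riesz_potential (\<alpha> / 2)) p v < \<infinity>"
proof -
  obtain v where v: "v \<in> borel_measurable lborel" "AE x in lborel. u x = v x"
    using completion_ex_borel_measurable_real[of u lborel] u by (auto simp: coulomb_sobolev_def)
  from v(2) have AE: "AE x in lebesgue. u x = v x" by (rule AE_completion)
  obtain g0 where "has_weak_gradient v g0"
    using u has_weak_gradient_cong_AE[OF AE] by (auto simp: coulomb_sobolev_def weakly_differentiable_def)
  then obtain g where g: "has_weak_gradient v g" "g \<in> borel_measurable borel"
    by (rule weak_gradient_borel_rep)
  have "l2_energy g < \<infinity>"
    using u dirichlet_energy_l2[OF g(1)] dirichlet_energy_cong_AE[OF AE] by (simp add: coulomb_sobolev_def)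
  moreover have "kernel_energy (riesz_potential (\<alpha> / 2)) p v < \<infinity>"
    using u coulomb_energy_cong_AE[OF AE, of \<alpha> p] by (simp add: coulomb_sobolev_def coulomb_energy_eq)
  ultimately show ?thesis
    using that[OF AE _ g(2,1)] v(1) by simp
qed

lemma energy_approx:
  fixes u :: "real ^ 'n \<Rightarrow> real"
  assumes \<alpha>: "0 < \<alpha>" "\<alpha> < real CARD('n)" and p: "1 \<le> p"
    and u: "u \<in> coulomb_sobolev \<alpha> p" and e: "0 < e"
  obtains \<phi> where "\<phi> \<in> test_functions" "dirichlet_energy (\<lambda>x. u x - \<phi> x) < ennreal e"
    "coulomb_energy \<alpha> p (\<lambda>x. u x - \<phi> x) < ennreal e"
proof -
  let ?Q = "kernel_energy (riesz_potential (\<alpha> / 2) :: real ^ 'n \<Rightarrow> real) p"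
  define C :: real where "C = 4 * (2 powr p)\<^sup>2"
  interpret Q: mollifiable ?Q C
    unfolding C_def by (rule mollifiable_riesz[OF \<alpha> p])
  have C2: "2 \<le> C"
  proof -
    have "1 \<le> (2 :: real) powr p" using p by (simp add: ge_one_powr_ge_zero)
    then have "1 \<le> ((2 :: real) powr p)\<^sup>2" by (rule one_le_power)
    then show ?thesis unfolding C_def by linarith
  qed
  define d where "d = e / (2 * C)"
  have d: "0 < d" using e C2 by (simp add: d_def)
  obtain v g where AE: "AE x in lebesgue. u x = v x"
    and v [measurable]: "v \<in> borel_measurable borel" and g [measurable]: "g \<in> borel_measurable borel"
    and vg: "has_weak_gradient v g" and D: "l2_energy g < \<infinity>" and E: "?Q v < \<infinity>"
    by (rule coulomb_sobolev_borel_rep[OF u]) (rule that)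
  have vl: "loc_int v"
    using vg by (intro locally_integrable_loc_int v) (simp add: has_weak_gradient_def)
  have "eventually (\<lambda>n. l2_energy (\<lambda>x. gradient (conv (moll n) v) x - g x) < ennreal d) sequentially"
    using d by (intro order_tendstoD(2)[OF mollify_gradient(1)[OF vg v g D]]) auto
  moreover have "eventually (\<lambda>n. ?Q (\<lambda>x. conv (moll n) v x - v x) < ennreal d) sequentially"
    using d by (intro order_tendstoD(2)[OF Q.mollification_tendsto[OF vl E]]) auto
  ultimately have "eventually (\<lambda>n. l2_energy (\<lambda>x. gradient (conv (moll n) v) x - g x) < ennreal d
      \<and> ?Q (\<lambda>x. conv (moll n) v x - v x) < ennreal d) sequentially"
    by eventually_elim simp
  then obtain n where n: "l2_energy (\<lambda>x. gradient (conv (moll n) v) x - g x) < ennreal d"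
      "?Q (\<lambda>x. conv (moll n) v x - v x) < ennreal d"
    using eventually_happens'[OF sequentially_bot] by blast
  define w where "w = conv (moll n) v"
  have w: "smooth w" unfolding w_def by (rule smooth_conv[OF moll_test vl])
  have wD: "l2_energy (gradient w) < \<infinity>"
    unfolding w_def by (rule mollify_gradient(2)[OF vg v g D])
  have wE: "?Q w < \<infinity>"
    unfolding w_def using Q.contraction[OF vl] E by (rule le_less_trans)
  obtain \<phi> where \<phi>: "\<phi> \<in> test_functions" "l2_energy (\<lambda>x. gradient \<phi> x - gradient w x) < ennreal d"
    "?Q (\<lambda>x. \<phi> x - w x) < ennreal d"
    by (rule smooth_approx[OF \<alpha> p w wD wE d]) (rule that)
  note [measurable] = smooth_measurable[OF w] measurable_gradient[OF w]
    smooth_measurable[OF test_function_smooth[OF \<phi>(1)]] measurable_gradient[OF test_function_smooth[OF \<phi>(1)]]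
  have nw: "l2_energy (\<lambda>x. gradient w x - g x) < ennreal (e / (2 * C))"
    "?Q (\<lambda>x. w x - v x) < ennreal (e / (2 * C))"
    using n by (simp_all add: w_def d_def)
  have 1: "l2_energy (\<lambda>x. (gradient \<phi> x - gradient w x) + (gradient w x - g x)) < ennreal e"
    by (rule l2_energy_add_less[OF _ _ \<phi>(2)[unfolded d_def] nw(1) e C2]) measurable
  have 2: "?Q (\<lambda>x. (\<phi> x - w x) + (w x - v x)) < ennreal e"
    by (rule Q.quasi_add_less[OF _ _ \<phi>(3)[unfolded d_def] nw(2) e]) measurable
  have AE': "AE x in lebesgue. u x - \<phi> x = v x - \<phi> x"
    using AE by eventually_elim simp
  have "dirichlet_energy (\<lambda>x. u x - \<phi> x) = l2_energy (\<lambda>x. g x - gradient \<phi> x)"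
    unfolding dirichlet_energy_cong_AE[OF AE']
    by (rule dirichlet_energy_l2[OF has_weak_gradient_diff[OF vg has_weak_gradient_smooth[OF test_function_smooth[OF \<phi>(1)]]]])
  also have "\<dots> = l2_energy (\<lambda>x. (gradient \<phi> x - gradient w x) + (gradient w x - g x))"
    by (simp add: l2_energy_def norm_minus_commute)
  finally have 3: "dirichlet_energy (\<lambda>x. u x - \<phi> x) < ennreal e" using 1 by simp
  have "coulomb_energy \<alpha> p (\<lambda>x. u x - \<phi> x) = ?Q (\<lambda>x. v x - \<phi> x)"
    unfolding coulomb_energy_cong_AE[OF AE'] by (rule coulomb_energy_eq)
  also have "\<dots> = ?Q (\<lambda>x. (\<phi> x - w x) + (w x - v x))"
    by (simp add: kernel_energy_def abs_minus_commute)
  finally have 4: "coulomb_energy \<alpha> p (\<lambda>x. u x - \<phi> x) < ennreal e" using 2 by simp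
  from \<phi>(1) 3 4 show ?thesis by (rule that)
qed

theorem proposition2p6:
  fixes \<alpha> p :: real
  assumes "0 < \<alpha>" and "\<alpha> < real CARD('n::finite)" and "1 \<le> p"
  shows "(test_functions :: (real ^ 'n \<Rightarrow> real) set) \<subseteq> coulomb_sobolev \<alpha> p \<and>
    (\<forall>u \<in> (coulomb_sobolev \<alpha> p :: (real ^ 'n \<Rightarrow> real) set). \<forall>\<epsilon>>0.
       \<exists>\<phi>\<in>test_functions. coulomb_sobolev_norm \<alpha> p (\<lambda>x. u x - \<phi> x) < \<epsilon>)"
proof (intro conjI ballI allI impI)
  show "(test_functions :: (real ^ 'n \<Rightarrow> real) set) \<subseteq> coulomb_sobolev \<alpha> p"
    using test_function_coulomb_sobolev[OF assms] by blast
  fix u :: "real ^ 'n \<Rightarrow> real" and \<epsilon> :: real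
  assume u: "u \<in> coulomb_sobolev \<alpha> p" and \<epsilon>: "0 < \<epsilon>"
  \<comment> \<open>Both summands under the root have to be less than \<open>\<epsilon>\<^sup>2 / 2\<close>, the second one after taking the root
    of order \<open>p\<close>.\<close>
  define h where "h = \<epsilon>\<^sup>2 / 2"
  have h: "0 < h" using \<epsilon> by (simp add: h_def)
  have e: "0 < min h (h powr p)" using h by simp
  obtain \<phi> where \<phi>: "\<phi> \<in> test_functions"
    and D: "dirichlet_energy (\<lambda>x. u x - \<phi> x) < ennreal (min h (h powr p))"
    and E: "coulomb_energy \<alpha> p (\<lambda>x. u x - \<phi> x) < ennreal (min h (h powr p))"
    by (rule energy_approx[OF assms u e]) (rule that)
  have real_less: "enn2real X < c" if "X < ennreal (min c d)" for X c d
    using that by (cases X) (auto simp: ennreal_less_iff)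
  have "enn2real (dirichlet_energy (\<lambda>x. u x - \<phi> x)) < h"
    by (rule real_less[OF D])
  moreover have "enn2real (coulomb_energy \<alpha> p (\<lambda>x. u x - \<phi> x)) powr (1 / p) < h"
  proof -
    have "enn2real (coulomb_energy \<alpha> p (\<lambda>x. u x - \<phi> x)) < h powr p"
      by (rule real_less) (use E in \<open>simp add: min.commute\<close>)
    then have "enn2real (coulomb_energy \<alpha> p (\<lambda>x. u x - \<phi> x)) powr (1 / p) < (h powr p) powr (1 / p)"
      using assms(3) by (intro powr_less_mono2) auto
    also have "\<dots> = h" using h assms(3) by (simp add: powr_powr)
    finally show ?thesis .
  qed
  ultimately have "coulomb_sobolev_norm \<alpha> p (\<lambda>x. u x - \<phi> x) < sqrt (\<epsilon>\<^sup>2)"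
    unfolding coulomb_sobolev_norm_def by (intro real_sqrt_less_mono) (simp add: h_def)
  then have "coulomb_sobolev_norm \<alpha> p (\<lambda>x. u x - \<phi> x) < \<epsilon>" using \<epsilon> by simp
  with \<phi> show "\<exists>\<phi>\<in>test_functions. coulomb_sobolev_norm \<alpha> p (\<lambda>x. u x - \<phi> x) < \<epsilon>" by blast
qed

end
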